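(* Let $T>0$. Assume that for all $K\ge 1$, all $r\in\{1,\dots,K\}$ and all $j\in\{1,\dots,N\}$, $q_j^{(K,r)}(0)=q_j^{(MF1,r)}(0)$, and that the random variables $\bigl(q_j^{(MF1,r)}(0)\bigr)_{j\in\{1,\dots,N\},\,r\ge1}$ are i.i.d. with finite mean. Then for every $i\in\{1,\dots,N\}$, $$\bigl(q_i^{(K,1)}(t)\bigr)_{0\le t\le T}\xrightarrow[K\to\infty]{d}\bigl(q_i^{(MF1,1)}(t)\bigr)_{0\le t\le T},$$ where the convergence is in distribution in $D([0,T],\mathbb N)$ endowed with the Skorokhod topology.
   Context: $\mathbb N=\{0,1,2,\dots\}$. Fix an integer $N\ge2$ and constants $B,\lambda>0$. There are $N$ queue positions $1,\dots,N$ on a discrete torus; $d(i,j)=\min(|i-j|,N-|i-j|)$. The path-loss function $l$ is one of $\ell_1(r)=(A\max(r,r_0))^{-C}$, $\ell_2(r)=(1+Ar)^{-C}$, $\ell_3(r)=Ae^{-Cr}$ with $A,C,r_0>0$, and $\xi_N=\sum_{j\ne i}l(d(i,j))$ (independent of $i$). $K$-replica system: $Q^K=(q_i^{(K,r)})_{1\le r\le K,\,1\le i\le N}$ is the Markov chain on $(\mathbb N^N)^K$ with generator $$\mathcal L^Kf(q)=\lambda\sum_{i,r}\bigl(f(q+e_{(r,i)})-f(q)\bigr)-\sum_{i,r}\mu_i^K(q)\bigl(f(q)-f(q-e_{(r,i)})\bigr)\mathbf 1_{\{q_{(r,i)}>0\}},$$ where $e_{(r,i)}$ is the unit vector in coordinate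 $(r,i)$ and $$\mu_i^K(q)=B\log_2\Bigl(1+\frac{1}{1+\frac1K\sum_{k=1}^K\sum_{j\neq i}\mathbf 1_{\{q_{(k,j)}>0\}}l(d(i,j))}\Bigr).$$ McKean–Vlasov system MF1: let $A_{r,i}$ be Poisson point processes on $\mathbb R_+$ of intensity $\lambda\,\mathrm dx$ and $D_{r,i}$ Poisson random measures on $\mathbb R_+\times\mathbb R_+$ of intensity $\mathrm du\,\mathrm dz$, all mutually independent ($r\ge 1$, $1\le i\le N$) and independent of the initial conditions. $(q_i^{(MF1,r)})_{r\ge1,\,1\le i\le N}$ is the solution of $$q_i^{(MF1,r)}(t)=q_i^{(MF1,r)}(0)+A_{r,i}[0,t]-\int_0^t\int_{\mathbb R_+}\mathbf 1_{\{q_i^{(MF1,r)}(z^-)>0\}}\mathbf 1_{\{u\le\mu^{MF1}(z^-)\}}D_{r,i}(\mathrm du,\mathrm dz),$$ with $\mu^{MF1}(z)=B\log_2\Bigl(1+\frac{1}{1+\mathbb P(q_1^{(MF1,1)}(z)>0)\,\xi_N}\Bigr)$. This equation has a pathwise unique strong solution. *)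

theory Defs
  imports "HOL-Probability.Probability"
begin

section \<open>Skorokhod space and convergence in distribution\<close>

text \<open>
  At each point the one-sided limits are taken within \<open>S\<close>. At a left endpoint of \<open>S\<close> the
  left-hand filter is trivial, so no condition is imposed there.
\<close>

definition cadlag_on :: "real set \<Rightarrow> (real \<Rightarrow> 'a::topological_space) \<Rightarrow> bool" where
  "cadlag_on S x \<longleftrightarrow>
     (\<forall>t\<in>S. (x \<longlongrightarrow> x t) (at t within S \<inter> {t..}) \<and>
             (\<exists>l. (x \<longlongrightarrow> l) (at t within S \<inter> {..t})))"

definition skorokhod_space :: "real \<Rightarrow> (real \<Rightarrow> nat) set" where
  "skorokhod_space T = {x \<in> extensional {0..T}. cadlag_on {0..T} x}"

text \<open>Increasing bijections of the time interval (automatically homeomorphisms).\<close>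

definition time_changes :: "real \<Rightarrow> (real \<Rightarrow> real) set" where
  "time_changes T = {\<theta>. strict_mono_on {0..T} \<theta> \<and> \<theta> ` {0..T} = {0..T}}"

text \<open>
  Billingsley's metric for the J1 topology. Outside the Skorokhod space it takes the value
  \<open>0\<close>, as the locale \<^locale>\<open>Metric_space\<close> asks for symmetry and nonnegativity everywhere.
\<close>

definition skorokhod_dist :: "real \<Rightarrow> (real \<Rightarrow> nat) \<Rightarrow> (real \<Rightarrow> nat) \<Rightarrow> real" where
  "skorokhod_dist T x y =
     (if x \<in> skorokhod_space T \<and> y \<in> skorokhod_space T
      then Inf {e. 0 < e \<and> (\<exists>\<theta>\<in>time_changes T. \<forall>t\<in>{0..T}.
                              \<bar>\<theta> t - t\<bar> \<le> e \<and> \<bar>real (x t) - real (y (\<theta> t))\<bar> \<le> e)}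
      else 0)"

definition skorokhod_topology :: "real \<Rightarrow> (real \<Rightarrow> nat) topology" where
  "skorokhod_topology T = Metric_space.mtopology (skorokhod_space T) (skorokhod_dist T)"

definition borel_of :: "'a topology \<Rightarrow> 'a measure" where
  "borel_of X = sigma (topspace X) {U. openin X U}"

definition converges_in_distribution ::
  "'w measure \<Rightarrow> 'a topology \<Rightarrow> (nat \<Rightarrow> 'w \<Rightarrow> 'a) \<Rightarrow> ('w \<Rightarrow> 'a) \<Rightarrow> bool" where
  "converges_in_distribution M X Y Z \<longleftrightarrow>
     (\<forall>n. Y n \<in> measurable M (borel_of X)) \<and> Z \<in> measurable M (borel_of X) \<and>
     (\<forall>\<phi>. continuous_map X euclideanreal \<phi> \<and> bounded (\<phi> ` topspace X) \<longrightarrow>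
        (\<lambda>n. \<integral>\<omega>. \<phi> (Y n \<omega>) \<partial>M) \<longlonglongrightarrow> (\<integral>\<omega>. \<phi> (Z \<omega>) \<partial>M))"


section \<open>Continuous-time Markov chains with a given generator\<close>

definition markov_semigroup :: "'s set \<Rightarrow> (real \<Rightarrow> 's \<Rightarrow> 's pmf) \<Rightarrow> bool" where
  "markov_semigroup S P \<longleftrightarrow>
     (\<forall>x\<in>S. P 0 x = return_pmf x) \<and>
     (\<forall>x\<in>S. \<forall>t\<ge>0. set_pmf (P t x) \<subseteq> S) \<and>
     (\<forall>x\<in>S. \<forall>s\<ge>0. \<forall>t\<ge>0. P (s + t) x = bind_pmf (P s x) (P t))"

text \<open>
  The infinitesimal generator of the semigroup on the Banach space of bounded functions
  on \<open>S\<close> with the supremum norm; its domain is the whole space.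
\<close>

definition has_generator ::
  "'s set \<Rightarrow> (real \<Rightarrow> 's \<Rightarrow> 's pmf) \<Rightarrow> (('s \<Rightarrow> real) \<Rightarrow> 's \<Rightarrow> real) \<Rightarrow> bool" where
  "has_generator S P L \<longleftrightarrow>
     (\<forall>f. bounded (f ` S) \<longrightarrow>
        uniform_limit S (\<lambda>h x. (measure_pmf.expectation (P h x) f - f x) / h) (L f) (at_right 0))"

text \<open>The Markov property is stated through the finite-dimensional distributions.\<close>

definition markov_chain_with_generator ::
  "'w measure \<Rightarrow> 's set \<Rightarrow> (real \<Rightarrow> 'w \<Rightarrow> 's) \<Rightarrow> (('s \<Rightarrow> real) \<Rightarrow> 's \<Rightarrow> real) \<Rightarrow> bool" where
  "markov_chain_with_generator M S X L \<longleftrightarrow>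
     (\<forall>t\<ge>0. X t \<in> measurable M (count_space S)) \<and>
     (\<exists>P. markov_semigroup S P \<and> has_generator S P L \<and>
        (\<forall>(n::nat) \<tau> x y h.
           (\<forall>i\<le>n. 0 \<le> \<tau> i \<and> x i \<in> S) \<and> (\<forall>i<n. \<tau> i \<le> \<tau> (Suc i)) \<and> y \<in> S \<and> 0 \<le> h \<longrightarrow>
           measure M {\<omega>\<in>space M. (\<forall>i\<le>n. X (\<tau> i) \<omega> = x i) \<and> X (\<tau> n + h) \<omega> = y} =
           measure M {\<omega>\<in>space M. \<forall>i\<le>n. X (\<tau> i) \<omega> = x i} * pmf (P h (x n)) y))"


section \<open>Poisson random measures\<close>

definition poisson_random_measure ::
  "'w measure \<Rightarrow> 'e measure \<Rightarrow> ('w \<Rightarrow> 'e measure) \<Rightarrow> bool" where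
  "poisson_random_measure M \<nu> R \<longleftrightarrow>
     (\<forall>\<omega>\<in>space M. sets (R \<omega>) = sets \<nu> \<and>
        (\<forall>E\<in>sets \<nu>. \<exists>k. emeasure (R \<omega>) E = ennreal_of_enat k)) \<and>
     (\<forall>E\<in>sets \<nu>. (\<lambda>\<omega>. emeasure (R \<omega>) E) \<in> borel_measurable M) \<and>
     (\<forall>E\<in>sets \<nu>. emeasure \<nu> E < \<infinity> \<longrightarrow>
        (\<forall>k::nat. measure M {\<omega>\<in>space M. emeasure (R \<omega>) E = of_nat k} =
                   exp (- measure \<nu> E) * measure \<nu> E ^ k / fact k)) \<and>
     (\<forall>(n::nat) E. (\<forall>k<n. E k \<in> sets \<nu>) \<and> disjoint_family_on E {..<n} \<longrightarrow>
        prob_space.indep_vars M (\<lambda>_. borel) (\<lambda>k \<omega>. emeasure (R \<omega>) (E k)) {..<n})"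

text \<open>The events generated by a random measure whose values are measures on \<open>sets \<nu>\<close>.\<close>

definition random_measure_events ::
  "'w measure \<Rightarrow> 'e measure \<Rightarrow> ('w \<Rightarrow> 'e measure) \<Rightarrow> 'w set set" where
  "random_measure_events M \<nu> R =
     sigma_sets (space M)
       {(\<lambda>\<omega>. emeasure (R \<omega>) E) -` V \<inter> space M | E V. E \<in> sets \<nu> \<and> V \<in> sets borel}"

definition halfline_intensity :: "real \<Rightarrow> real measure" where
  "halfline_intensity lam = density lborel (\<lambda>x. ennreal lam * indicator {0..} x)"

definition quadrant_intensity :: "(real \<times> real) measure" where
  "quadrant_intensity = density lborel (indicator ({0..} \<times> {0..}))"


section \<open>Interaction: torus, path loss, service rates\<close>

definition torus_dist :: "nat \<Rightarrow> nat \<Rightarrow> nat \<Rightarrow> real" where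
  "torus_dist N i j = min \<bar>real i - real j\<bar> (real N - \<bar>real i - real j\<bar>)"

definition path_loss :: "(real \<Rightarrow> real) \<Rightarrow> bool" where
  "path_loss l \<longleftrightarrow>
     (\<exists>A C r0. 0 < A \<and> 0 < C \<and> 0 < r0 \<and>
        ((\<forall>r\<ge>0. l r = (A * max r r0) powr (- C)) \<or>
         (\<forall>r\<ge>0. l r = (1 + A * r) powr (- C)) \<or>
         (\<forall>r\<ge>0. l r = A * exp (- C * r))))"

text \<open>By translation invariance, position \<open>1\<close> may be replaced by any other position; see
  \<open>xi_translation_invariant\<close> below.\<close>

definition xi :: "nat \<Rightarrow> (real \<Rightarrow> real) \<Rightarrow> real" where
  "xi N l = (\<Sum>j\<in>{1..N} - {1}. l (torus_dist N 1 j))"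

text \<open>States of the \<open>K\<close>-replica system: queue lengths indexed by (replica, position).\<close>

definition replica_states :: "nat \<Rightarrow> nat \<Rightarrow> (nat \<times> nat \<Rightarrow> nat) set" where
  "replica_states N K = ({1..K} \<times> {1..N}) \<rightarrow>\<^sub>E UNIV"

definition replica_rate ::
  "nat \<Rightarrow> real \<Rightarrow> (real \<Rightarrow> real) \<Rightarrow> nat \<Rightarrow> nat \<Rightarrow> (nat \<times> nat \<Rightarrow> nat) \<Rightarrow> real" where
  "replica_rate N B l K i q =
     B * log 2 (1 + 1 / (1 + 1 / real K *
       (\<Sum>k\<in>{1..K}. \<Sum>j\<in>{1..N} - {i}. of_bool (q (k, j) > 0) * l (torus_dist N i j))))"

definition replica_generator ::
  "nat \<Rightarrow> real \<Rightarrow> real \<Rightarrow> (real \<Rightarrow> real) \<Rightarrow> nat \<Rightarrow>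
   ((nat \<times> nat \<Rightarrow> nat) \<Rightarrow> real) \<Rightarrow> (nat \<times> nat \<Rightarrow> nat) \<Rightarrow> real" where
  "replica_generator N B lam l K f q =
     lam * (\<Sum>(r, i)\<in>{1..K} \<times> {1..N}. f (q((r, i) := q (r, i) + 1)) - f q) -
     (\<Sum>(r, i)\<in>{1..K} \<times> {1..N}.
        replica_rate N B l K i q * (f q - f (q((r, i) := q (r, i) - 1))) * of_bool (q (r, i) > 0))"

definition replica_system ::
  "'w measure \<Rightarrow> nat \<Rightarrow> real \<Rightarrow> real \<Rightarrow> (real \<Rightarrow> real) \<Rightarrow> nat \<Rightarrow>
   (real \<Rightarrow> 'w \<Rightarrow> nat \<times> nat \<Rightarrow> nat) \<Rightarrow> bool" where
  "replica_system M N B lam l K Q \<longleftrightarrow>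
     markov_chain_with_generator M (replica_states N K) Q (replica_generator N B lam l K) \<and>
     (\<forall>\<omega>\<in>space M. \<forall>r\<in>{1..K}. \<forall>i\<in>{1..N}. cadlag_on {0..} (\<lambda>t. Q t \<omega> (r, i)))"


section \<open>The McKean--Vlasov system\<close>

text \<open>In the following definitions \<open>q r i t \<omega>\<close> is the queue length at position \<open>i\<close> of replica \<open>r\<close>.\<close>

datatype source = Initial | Arrival nat nat | Departure nat nat

definition initial_events ::
  "'w measure \<Rightarrow> nat \<Rightarrow> (nat \<Rightarrow> nat \<Rightarrow> real \<Rightarrow> 'w \<Rightarrow> nat) \<Rightarrow> 'w set set" where
  "initial_events M N q =
     sigma_sets (space M) {q r i 0 -` V \<inter> space M | r i V. r \<in> {1..} \<and> i \<in> {1..N}}"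

definition source_events ::
  "'w measure \<Rightarrow> nat \<Rightarrow> real \<Rightarrow> (nat \<Rightarrow> nat \<Rightarrow> 'w \<Rightarrow> real measure) \<Rightarrow>
   (nat \<Rightarrow> nat \<Rightarrow> 'w \<Rightarrow> (real \<times> real) measure) \<Rightarrow> (nat \<Rightarrow> nat \<Rightarrow> real \<Rightarrow> 'w \<Rightarrow> nat) \<Rightarrow>
   source \<Rightarrow> 'w set set" where
  "source_events M N lam A D q s =
     (case s of
        Initial \<Rightarrow> initial_events M N q
      | Arrival r i \<Rightarrow> random_measure_events M (halfline_intensity lam) (A r i)
      | Departure r i \<Rightarrow> random_measure_events M quadrant_intensity (D r i))"

definition mf_rate ::
  "'w measure \<Rightarrow> nat \<Rightarrow> real \<Rightarrow> (real \<Rightarrow> real) \<Rightarrow> (nat \<Rightarrow> nat \<Rightarrow> real \<Rightarrow> 'w \<Rightarrow> nat) \<Rightarrow> real \<Rightarrow> real" where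
  "mf_rate M N B l q z =
     B * log 2 (1 + 1 / (1 + measure M {\<omega>\<in>space M. q 1 1 z \<omega> > 0} * xi N l))"

text \<open>
  Points of \<open>D r i \<omega>\<close> are pairs \<open>(u, z)\<close>. Left limits at time \<open>z\<close> are only meaningful for
  \<open>z > 0\<close>, so the time integral runs over \<open>(0, t]\<close>; almost surely \<open>D r i \<omega>\<close> has no point
  with \<open>z = 0\<close>. The integral is almost surely finite because the rate is bounded.
\<close>

definition mf_system ::
  "'w measure \<Rightarrow> nat \<Rightarrow> real \<Rightarrow> real \<Rightarrow> (real \<Rightarrow> real) \<Rightarrow> (nat \<Rightarrow> nat \<Rightarrow> 'w \<Rightarrow> real measure) \<Rightarrow>
   (nat \<Rightarrow> nat \<Rightarrow> 'w \<Rightarrow> (real \<times> real) measure) \<Rightarrow> (nat \<Rightarrow> nat \<Rightarrow> real \<Rightarrow> 'w \<Rightarrow> nat) \<Rightarrow> bool" where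
  "mf_system M N B lam l A D q \<longleftrightarrow>
     (\<forall>r\<ge>1. \<forall>i\<in>{1..N}. poisson_random_measure M (halfline_intensity lam) (A r i) \<and>
                        poisson_random_measure M quadrant_intensity (D r i)) \<and>
     prob_space.indep_sets M (source_events M N lam A D q)
       ({Initial} \<union> {Arrival r i | r i. r \<ge> 1 \<and> i \<in> {1..N}} \<union>
        {Departure r i | r i. r \<ge> 1 \<and> i \<in> {1..N}}) \<and>
     (\<forall>r\<ge>1. \<forall>i\<in>{1..N}. \<forall>t\<ge>0. q r i t \<in> measurable M (count_space UNIV)) \<and>
     (\<forall>r\<ge>1. \<forall>i\<in>{1..N}. \<forall>\<omega>\<in>space M. cadlag_on {0..} (\<lambda>t. q r i t \<omega>)) \<and>
     (\<forall>r\<ge>1. \<forall>i\<in>{1..N}. AE \<omega> in M. \<forall>t\<ge>0.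
        real (q r i t \<omega>) =
          real (q r i 0 \<omega>) + measure (A r i \<omega>) {0..t} -
          (\<integral>(u, z). indicator ({0..} \<times> {0<..t}) (u, z) *
                    of_bool (Lim (at_left z) (\<lambda>s. q r i s \<omega>) > 0) *
                    of_bool (u \<le> Lim (at_left z) (mf_rate M N B l q)) \<partial>(D r i \<omega>)))"

definition iid_with_finite_mean ::
  "'w measure \<Rightarrow> 'i set \<Rightarrow> ('i \<Rightarrow> 'w \<Rightarrow> nat) \<Rightarrow> bool" where
  "iid_with_finite_mean M I X \<longleftrightarrow>
     prob_space.indep_vars M (\<lambda>_. count_space UNIV) X I \<and>
     (\<forall>i\<in>I. \<forall>j\<in>I. distr M (count_space UNIV) (X i) = distr M (count_space UNIV) (X j)) \<and>
     (\<forall>i\<in>I. integrable M (\<lambda>\<omega>. real (X i \<omega>)))"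


section \<open>Well-definedness\<close>

lemma xi_translation_invariant:
  assumes "i \<in> {1..N}"
  shows "(\<Sum>j\<in>{1..N} - {i}. l (torus_dist N i j)) = xi N l"
proof -
  define f where "f j = (if j \<ge> i then j - i + 1 else j + N - i + 1)" for j
  define g where "g j = (if j + i \<le> N + 1 then j + i - 1 else j + i - 1 - N)" for j
  have "(\<Sum>j\<in>{1..N} - {i}. l (torus_dist N i j)) = (\<Sum>j\<in>{1..N} - {1}. l (torus_dist N 1 j))"
  proof (rule sum.reindex_bij_witness[where i = g and j = f])
    fix j assume j: "j \<in> {1..N} - {i}"
    show "g (f j) = j" "f j \<in> {1..N} - {1}"
      using j assms by (auto simp: f_def g_def)
    have "torus_dist N 1 (f j) = torus_dist N i j"
      using j assms by (auto simp: torus_dist_def f_def of_nat_diff min_def)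
    then show "l (torus_dist N 1 (f j)) = l (torus_dist N i j)" by simp
  next
    fix j assume j: "j \<in> {1..N} - {1}"
    show "f (g j) = j" "g j \<in> {1..N} - {i}"
      using j assms by (auto simp: f_def g_def)
  qed
  then show ?thesis by (simp add: xi_def)
qed

lemma skorokhod_space_bounded:
  assumes "x \<in> skorokhod_space T"
  shows "\<exists>b. \<forall>t\<in>{0..T}. x t \<le> b"
proof -
  have "\<exists>U b. open U \<and> t \<in> U \<and> (\<forall>s\<in>U \<inter> {0..T}. x s \<le> b)" if t: "t \<in> {0..T}" for t
  proof -
    from assms t obtain l where
      r: "(x \<longlongrightarrow> x t) (at t within {0..T} \<inter> {t..})" and l: "(x \<longlongrightarrow> l) (at t within {0..T} \<inter> {..t})"
      unfolding skorokhod_space_def cadlag_on_def by blast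
    from r obtain U where U: "open U" "t \<in> U"
      "\<And>s. s \<in> U \<Longrightarrow> s \<noteq> t \<Longrightarrow> s \<in> {0..T} \<inter> {t..} \<Longrightarrow> x s = x t"
      unfolding tendsto_discrete eventually_at_topological by blast
    from l obtain V where V: "open V" "t \<in> V"
      "\<And>s. s \<in> V \<Longrightarrow> s \<noteq> t \<Longrightarrow> s \<in> {0..T} \<inter> {..t} \<Longrightarrow> x s = l"
      unfolding tendsto_discrete eventually_at_topological by blast
    have "x s \<le> max (x t) l" if s: "s \<in> (U \<inter> V) \<inter> {0..T}" for s
    proof (cases s t rule: linorder_cases)
      case less then show ?thesis using V(3)[of s] s by auto
    next
      case greater then show ?thesis using U(3)[of s] s by auto
    qed simp
    then show ?thesis using U V by (intro exI[of _ "U \<inter> V"] exI[of _ "max (x t) l"]) auto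
  qed
  then obtain U b where Ub: "\<And>t. t \<in> {0..T} \<Longrightarrow>
      open (U t) \<and> t \<in> U t \<and> (\<forall>s\<in>U t \<inter> {0..T}. x s \<le> b t)" by metis
  have "compact {0..T}" by simp
  then obtain C where C: "C \<subseteq> {0..T}" "finite C" "{0..T} \<subseteq> (\<Union>c\<in>C. U c)"
    by (rule compactE_image[where C = "{0..T}" and f = U]) (use Ub in auto)
  have "x t \<le> (\<Sum>c\<in>C. b c)" if t: "t \<in> {0..T}" for t
  proof -
    obtain c where c: "c \<in> C" "t \<in> U c" using C(3) t by blast
    then have "x t \<le> b c" using Ub[of c] C(1) t by blast
    also have "b c \<le> (\<Sum>c\<in>C. b c)" using c C(2) by (simp add: member_le_sum)
    finally show ?thesis .
  qed
  then show ?thesis by blast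
qed

lemma time_changes_inv:
  assumes "\<theta> \<in> time_changes T"
  shows "the_inv_into {0..T} \<theta> \<in> time_changes T"
proof -
  have m: "strict_mono_on {0..T} \<theta>" and im: "\<theta> ` {0..T} = {0..T}"
    using assms by (auto simp: time_changes_def)
  have inj: "inj_on \<theta> {0..T}" using m by (rule strict_mono_on_imp_inj_on)
  let ?g = "the_inv_into {0..T} \<theta>"
  have img: "?g ` {0..T} = {0..T}" using the_inv_into_onto[OF inj] im by simp
  have "?g s < ?g t" if "s \<in> {0..T}" "t \<in> {0..T}" "s < t" for s t
  proof (rule ccontr)
    assume "\<not> ?g s < ?g t"
    moreover have "?g s \<in> {0..T}" "?g t \<in> {0..T}" using that img by blast+
    ultimately have "\<theta> (?g t) \<le> \<theta> (?g s)"
      using m by (metis linorder_not_less order_le_less strict_mono_onD)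
    then show False using f_the_inv_into_f[OF inj] that im by auto
  qed
  then show ?thesis using img by (auto simp: time_changes_def intro: strict_mono_onI)
qed

lemma skorokhod_metric_space: "Metric_space (skorokhod_space T) (skorokhod_dist T)"
proof -
  define E where "E x y = {e. 0 < e \<and> (\<exists>\<theta>\<in>time_changes T. \<forall>t\<in>{0..T}.
       \<bar>\<theta> t - t\<bar> \<le> e \<and> \<bar>real (x t) - real (y (\<theta> t))\<bar> \<le> e)}" for x y :: "real \<Rightarrow> nat"
  have d: "skorokhod_dist T x y = (if x \<in> skorokhod_space T \<and> y \<in> skorokhod_space T then Inf (E x y) else 0)"
    for x y unfolding skorokhod_dist_def E_def ..
  have pos: "0 < e" if "e \<in> E x y" for e x y using that by (simp add: E_def)
  have bdd: "bdd_below (E x y)" for x y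
    by (rule bdd_belowI[of _ 0]) (use pos in \<open>auto intro: less_imp_le\<close>)
  have id: "(\<lambda>t. t) \<in> time_changes T" by (auto simp: time_changes_def strict_mono_on_def)
  have ne: "E x y \<noteq> {}" if x: "x \<in> skorokhod_space T" and y: "y \<in> skorokhod_space T" for x y
  proof -
    obtain b c where b: "\<forall>t\<in>{0..T}. x t \<le> b" and c: "\<forall>t\<in>{0..T}. y t \<le> c"
      using skorokhod_space_bounded x y by metis
    have "\<bar>real (x t) - real (y t)\<bar> \<le> 1 + real b + real c" if "t \<in> {0..T}" for t
    proof -
      have "real (x t) \<le> real b" "real (y t) \<le> real c" using b c that by auto
      then show ?thesis by (simp add: abs_le_iff)
    qed
    then have "1 + real b + real c \<in> E x y"
      unfolding E_def by (auto intro!: bexI[OF _ id] add_pos_nonneg)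
    then show ?thesis by blast
  qed
  have nonneg: "0 \<le> Inf (E x y)" if "x \<in> skorokhod_space T" "y \<in> skorokhod_space T" for x y
    by (rule cInf_greatest[OF ne[OF that]]) (rule less_imp_le[OF pos])
  have sub: "E x y \<subseteq> E y x" for x y
  proof
    fix e assume "e \<in> E x y"
    then obtain \<theta> where e: "0 < e" and \<theta>: "\<theta> \<in> time_changes T"
      and *: "\<And>t. t \<in> {0..T} \<Longrightarrow> \<bar>\<theta> t - t\<bar> \<le> e \<and> \<bar>real (x t) - real (y (\<theta> t))\<bar> \<le> e"
      by (auto simp: E_def)
    let ?g = "the_inv_into {0..T} \<theta>"
    have inj: "inj_on \<theta> {0..T}" and im: "\<theta> ` {0..T} = {0..T}"
      using \<theta> by (auto simp: time_changes_def intro: strict_mono_on_imp_inj_on)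
    have "\<bar>?g t - t\<bar> \<le> e \<and> \<bar>real (y t) - real (x (?g t))\<bar> \<le> e" if t: "t \<in> {0..T}" for t
    proof -
      have "?g t \<in> {0..T}" using the_inv_into_into[OF inj] t im by blast
      moreover have "\<theta> (?g t) = t" using f_the_inv_into_f[OF inj] t im by simp
      ultimately show ?thesis using *[of "?g t"] by (simp add: abs_minus_commute)
    qed
    then show "e \<in> E y x" unfolding E_def using e time_changes_inv[OF \<theta>] by blast
  qed
  have tri: "e + e' \<in> E x z" if "e \<in> E x y" "e' \<in> E y z" for e e' x y z
  proof -
    from that obtain \<theta> \<eta> where e: "0 < e" "0 < e'"
      and \<theta>: "\<theta> \<in> time_changes T" and \<eta>: "\<eta> \<in> time_changes T"
      and 1: "\<And>t. t \<in> {0..T} \<Longrightarrow> \<bar>\<theta> t - t\<bar> \<le> e \<and> \<bar>real (x t) - real (y (\<theta> t))\<bar> \<le> e"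
      and 2: "\<And>t. t \<in> {0..T} \<Longrightarrow> \<bar>\<eta> t - t\<bar> \<le> e' \<and> \<bar>real (y t) - real (z (\<eta> t))\<bar> \<le> e'"
      by (auto simp: E_def)
    have in\<theta>: "\<theta> t \<in> {0..T}" if "t \<in> {0..T}" for t using \<theta> that by (auto simp: time_changes_def)
    have "(\<lambda>t. \<eta> (\<theta> t)) ` {0..T} = {0..T}"
      using \<theta> \<eta> image_image[of \<eta> \<theta> "{0..T}"] by (simp add: time_changes_def)
    moreover have "strict_mono_on {0..T} (\<lambda>t. \<eta> (\<theta> t))"
    proof (rule strict_mono_onI)
      fix r s assume rs: "r \<in> {0..T}" "s \<in> {0..T}" "r < s"
      have m: "strict_mono_on {0..T} \<theta>" "strict_mono_on {0..T} \<eta>"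
        using \<theta> \<eta> by (auto simp: time_changes_def)
      show "\<eta> (\<theta> r) < \<eta> (\<theta> s)"
        by (rule strict_mono_onD[OF m(2) in\<theta>[OF rs(1)] in\<theta>[OF rs(2)] strict_mono_onD[OF m(1) rs]])
    qed
    ultimately have "(\<lambda>t. \<eta> (\<theta> t)) \<in> time_changes T" by (simp add: time_changes_def)
    moreover have "\<bar>\<eta> (\<theta> t) - t\<bar> \<le> e + e' \<and> \<bar>real (x t) - real (z (\<eta> (\<theta> t)))\<bar> \<le> e + e'" if t: "t \<in> {0..T}" for t
      using 1[OF t] 2[OF in\<theta>[OF t]] by linarith
    ultimately have "\<exists>\<theta>\<in>time_changes T. \<forall>t\<in>{0..T}. \<bar>\<theta> t - t\<bar> \<le> e + e' \<and> \<bar>real (x t) - real (z (\<theta> t))\<bar> \<le> e + e'"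
      by (intro bexI[of _ "\<lambda>t. \<eta> (\<theta> t)"] ballI)
    then show ?thesis using e by (simp add: E_def)
  qed
  have sep: "x = y" if x: "x \<in> skorokhod_space T" and y: "y \<in> skorokhod_space T" and 0: "Inf (E x y) = 0" for x y
  proof -
    have small: "\<exists>\<theta>\<in>time_changes T. \<forall>t\<in>{0..T}. \<bar>\<theta> t - t\<bar> < \<delta> \<and> x t = y (\<theta> t)" if "\<delta> > 0" for \<delta>
    proof -
      have "Inf (E x y) < min \<delta> 1" using 0 that by simp
      then obtain e where "e \<in> E x y" and e: "e < min \<delta> 1"
        using cInf_less_iff[OF ne[OF x y] bdd] by blast
      then obtain \<theta> where \<theta>: "\<theta> \<in> time_changes T"
        and *: "\<And>t. t \<in> {0..T} \<Longrightarrow> \<bar>\<theta> t - t\<bar> \<le> e \<and> \<bar>real (x t) - real (y (\<theta> t))\<bar> \<le> e"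
        by (auto simp: E_def)
      have "\<bar>\<theta> t - t\<bar> < \<delta> \<and> x t = y (\<theta> t)" if "t \<in> {0..T}" for t
        using *[OF that] e by (auto simp: abs_less_iff)
      then show ?thesis using \<theta> by blast
    qed
    have "x t = y t" if t: "t \<in> {0..T}" for t
    proof (cases "t = T")
      case True
      obtain \<theta> where \<theta>: "\<theta> \<in> time_changes T" and *: "\<And>t. t \<in> {0..T} \<Longrightarrow> x t = y (\<theta> t)"
        using small[of 1] by auto
      have "\<theta> T = T"
      proof -
        have im: "\<theta> ` {0..T} = {0..T}" and m: "strict_mono_on {0..T} \<theta>"
          using \<theta> by (auto simp: time_changes_def)
        have T: "T \<in> {0..T}" using t True by simp
        with im obtain s where s: "s \<in> {0..T}" "\<theta> s = T" by (metis imageE)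
        have "\<theta> T \<le> T" using im T by (metis atLeastAtMost_iff imageI)
        then show ?thesis using m s T
          by (metis atLeastAtMost_iff linorder_not_less order_le_less strict_mono_onD)
      qed
      then show ?thesis using *[OF t] True by simp
    next
      case False
      have tT: "0 \<le> t" "t < T" using t False by auto
      have rc: "\<exists>d>0. \<forall>s\<in>{0..T}. t \<le> s \<and> s < t + d \<longrightarrow> w s = w t" if w: "w \<in> skorokhod_space T" for w
      proof -
        have "(w \<longlongrightarrow> w t) (at t within {0..T} \<inter> {t..})"
          using w t unfolding skorokhod_space_def cadlag_on_def by blast
        then obtain d where "d > 0" "\<And>s. s \<in> {0..T} \<inter> {t..} \<Longrightarrow> s \<noteq> t \<Longrightarrow> dist s t < d \<Longrightarrow> w s = w t"
          unfolding tendsto_discrete eventually_at by blast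
        then show ?thesis by (intro exI[of _ d]) (force simp: dist_real_def)
      qed
      obtain d1 d2 where d1: "d1 > 0" "\<And>s. s \<in> {0..T} \<Longrightarrow> t \<le> s \<Longrightarrow> s < t + d1 \<Longrightarrow> x s = x t"
        and d2: "d2 > 0" "\<And>s. s \<in> {0..T} \<Longrightarrow> t \<le> s \<Longrightarrow> s < t + d2 \<Longrightarrow> y s = y t"
        using rc[OF x] rc[OF y] by metis
      define h where "h = min (min d1 d2) (T - t) / 2"
      have h: "0 < h" "2 * h \<le> d1" "2 * h \<le> d2" "2 * h \<le> T - t"
        using d1(1) d2(1) tT by (auto simp: h_def)
      obtain \<theta> where \<theta>: "\<theta> \<in> time_changes T"
        and *: "\<And>s. s \<in> {0..T} \<Longrightarrow> \<bar>\<theta> s - s\<bar> < h \<and> x s = y (\<theta> s)"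
        using small[OF h(1)] by blast
      have th: "t + h \<in> {0..T}" using h tT by auto
      then have "\<theta> (t + h) \<in> {0..T}" using \<theta> by (auto simp: time_changes_def)
      moreover have "t \<le> \<theta> (t + h)" "\<theta> (t + h) < t + d2" using *[OF th] h by auto
      ultimately have "y (\<theta> (t + h)) = y t" by (intro d2(2))
      moreover have "x (t + h) = x t" using th h by (intro d1(2)) auto
      ultimately show ?thesis using *[OF th] by simp
    qed
    then show ?thesis using x y unfolding skorokhod_space_def by (auto intro: extensionalityI)
  qed
  show ?thesis
  proof
    show "0 \<le> skorokhod_dist T x y" for x y
      using nonneg[of x y] by (simp add: d)
    show "skorokhod_dist T x y = skorokhod_dist T y x" for x y
      using sub[of x y] sub[of y x] by (auto simp: d)
    show "skorokhod_dist T x y = 0 \<longleftrightarrow> x = y"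
      if x: "x \<in> skorokhod_space T" and y: "y \<in> skorokhod_space T" for x y
    proof
      show "x = y" if "skorokhod_dist T x y = 0" using that sep x y by (simp add: d)
      assume xy: "x = y"
      have "e \<in> E x x" if "e > 0" for e unfolding E_def using that by (auto intro!: bexI[OF _ id])
      then have "Inf (E x x) \<le> e" if "e > 0" for e by (rule cInf_lower[OF _ bdd]) (rule that)
      moreover have "0 \<le> Inf (E x x)" using nonneg[OF x x] .
      moreover have "Inf (E x x) \<le> 0"
        by (rule field_le_epsilon) (use calculation(1) in simp)
      ultimately have "Inf (E x x) = 0" by linarith
      then show "skorokhod_dist T x y = 0" using xy x by (simp add: d)
    qed
    show "skorokhod_dist T x z \<le> skorokhod_dist T x y + skorokhod_dist T y z"
      if x: "x \<in> skorokhod_space T" and y: "y \<in> skorokhod_space T" and z: "z \<in> skorokhod_space T" for x y z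
    proof -
      have le: "Inf (E x z) \<le> e + e'" if "e \<in> E x y" "e' \<in> E y z" for e e'
        by (rule cInf_lower[OF tri[OF that] bdd])
      have "Inf (E x z) - e' \<le> Inf (E x y)" if e': "e' \<in> E y z" for e'
      proof (rule cInf_greatest[OF ne[OF x y]])
        fix e assume "e \<in> E x y"
        then show "Inf (E x z) - e' \<le> e" using le[OF _ e'] by fastforce
      qed
      then have *: "Inf (E x z) - Inf (E x y) \<le> e'" if "e' \<in> E y z" for e'
        using that by fastforce
      have "Inf (E x z) - Inf (E x y) \<le> Inf (E y z)"
        by (rule cInf_greatest[OF ne[OF y z] *])
      then show ?thesis using x y z by (simp add: d)
    qed
  qed
qed

end

theory Submission
  imports Defs
begin

text \<open>
  The convergence holds in a strong sense: if \<open>\<bar>\<phi>\<bar> \<le> b\<close> and \<open>\<phi>\<close> is continuous on the Skorokhod space, then the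
  expectations of \<open>\<phi>\<close> under the laws of the two queues on \<open>[0, T]\<close> differ by at most a constant times
  \<open>b / sqrt K\<close> (\<open>expectation_gap\<close>). The idea is to compare, for fixed \<open>K\<close>, the laws of the values on a time grid
  of mesh \<open>h = T / n\<close>, uniformly over all test functions with values in \<open>[-1, 1]\<close>, and to let \<open>n\<close> tend to
  infinity before \<open>K\<close> does.

  A cadlag path with values in the natural numbers is the Skorokhod limit of the step paths through its grid values
  (\<open>step_path_approximation\<close>): on a fine grid each cell contains at most one jump, which a small change of time moves
  to the end of the cell. This makes path maps measurable (\<open>measurable_skorokhod_path\<close>) and carries bounds on
  functionals of grid values over to continuous functionals of paths (\<open>expectation_step_path_tendsto\<close>).

  For fixed \<open>K\<close> both queues move over one cell, up to an error of order \<open>h\<^sup>2\<close> in total variation, by one step of a birth-death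
  chain (\<open>birth_death_step\<close>) with birth probability \<open>\<lambda> h\<close> and death probability \<open>\<mu> h\<close>. For the replica system this is the
  second-order expansion of the semigroup of a bounded generator (\<open>taylor\<close>, \<open>markov_chain_step\<close>). For the mean-field
  queue the reason is that a cell contains two relevant Poisson points only with probability of order \<open>h\<^sup>2\<close>; outside
  such cells the queue follows a chain built from independent Poisson counts (\<open>good_cell_increment\<close>,
  \<open>chain_deviation\<close>, \<open>chain_step\<close>).

  So the two laws differ only through their rates. The rate of the replica system at position \<open>i\<close> is a Lipschitz function
  of the fractions of busy queues at the other positions, and the mean-field rate is the same function of the
  probability of being busy. The rates are therefore close by a law of large numbers for the empirical means
  \<open>1/K * (\<Sum>r. f (q (r, j)))\<close>, which \<open>empirical_variance\<close> proves by a Gronwall argument in mean square. Let \<open>w\<^sub>k\<close> be the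
  largest mean square distance, over positions \<open>j\<close> and functions \<open>\<bar>f\<bar> \<le> 1\<close>, of the empirical mean at time \<open>k h\<close> from the
  mean-field expectation of \<open>f\<close>. The quadratic variation of an empirical mean is of order \<open>1/K\<close> (\<open>gen_square\<close>), and the
  error in the rates is bounded by the distances for \<open>f = busy\<close>, so the family of all these \<open>f\<close> is closed under the
  dynamics and \<open>w\<^sub>k\<^sub>+\<^sub>1 \<le> (1 + C h) w\<^sub>k + C h / K + O(h\<^sup>2)\<close>. As the initial values are independent and identically
  distributed, \<open>w\<^sub>0 \<le> 1/K\<close>, and hence \<open>w\<^sub>k = O(1/K)\<close> up to time \<open>T\<close>. Finally the distance of the laws of the grid values
  grows in each step by at most \<open>2 h\<close> times the expected error of the rate, which is \<open>O(1 / sqrt K)\<close>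
  (\<open>path_comparison\<close>, \<open>grid_law_distance\<close>).
\<close>


section \<open>Step paths approximate cadlag paths in the Skorokhod metric\<close>

text \<open>For grid values on \<open>[0, T]\<close> the list has length \<open>n + 1\<close>; its last entry is the value at \<open>T\<close> only.\<close>

definition step_path :: "real \<Rightarrow> nat \<Rightarrow> nat list \<Rightarrow> real \<Rightarrow> nat" where
  "step_path T n w = restrict (\<lambda>t. w ! nat \<lfloor>real n * t / T\<rfloor>) {0..T}"

definition grid_values :: "real \<Rightarrow> nat \<Rightarrow> (real \<Rightarrow> 'a) \<Rightarrow> 'a list" where
  "grid_values h n x = map (\<lambda>k. x (real k * h)) [0..<Suc n]"

lemma tendsto_floor_right:
  fixes c t :: real
  assumes "c > 0"
  shows "((\<lambda>s. v \<lfloor>c * s\<rfloor>) \<longlongrightarrow> v \<lfloor>c * t\<rfloor>) (at t within S \<inter> {t..})"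
proof (rule tendsto_eventually)
  define d where "d = (of_int \<lfloor>c * t\<rfloor> + 1 - c * t) / c"
  have "d > 0" unfolding d_def using assms by (intro divide_pos_pos) linarith+
  moreover have "v \<lfloor>c * s\<rfloor> = v \<lfloor>c * t\<rfloor>" if "t \<le> s" "dist s t < d" for s
  proof -
    have "c * (s - t) < c * d" using that assms by (intro mult_strict_left_mono) (auto simp: dist_real_def)
    moreover have "c * d = of_int \<lfloor>c * t\<rfloor> + 1 - c * t" using assms by (simp add: d_def)
    ultimately have "c * s < of_int \<lfloor>c * t\<rfloor> + 1" by (simp add: right_diff_distrib)
    moreover have "c * t \<le> c * s" using that assms by simp
    ultimately have "\<lfloor>c * s\<rfloor> = \<lfloor>c * t\<rfloor>" by linarith
    then show ?thesis by (rule arg_cong)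
  qed
  ultimately show "\<forall>\<^sub>F s in at t within S \<inter> {t..}. v \<lfloor>c * s\<rfloor> = v \<lfloor>c * t\<rfloor>"
    unfolding eventually_at by blast
qed

lemma tendsto_floor_left:
  fixes c t :: real
  assumes "c > 0"
  shows "((\<lambda>s. v \<lfloor>c * s\<rfloor>) \<longlongrightarrow> v (\<lceil>c * t\<rceil> - 1)) (at t within S \<inter> {..t})"
proof (rule tendsto_eventually)
  define d where "d = (c * t - of_int \<lceil>c * t\<rceil> + 1) / c"
  have "d > 0" unfolding d_def using assms by (intro divide_pos_pos) linarith+
  moreover have "v \<lfloor>c * s\<rfloor> = v (\<lceil>c * t\<rceil> - 1)" if "s \<le> t" "s \<noteq> t" "dist s t < d" for s
  proof -
    have "c * (t - s) < c * d" using that assms by (intro mult_strict_left_mono) (auto simp: dist_real_def)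
    moreover have "c * d = c * t - of_int \<lceil>c * t\<rceil> + 1" using assms by (simp add: d_def)
    ultimately have "c * s > of_int \<lceil>c * t\<rceil> - 1" by (simp add: right_diff_distrib)
    moreover have "c * s < c * t" using that assms by simp
    ultimately have "\<lfloor>c * s\<rfloor> = \<lceil>c * t\<rceil> - 1" by linarith
    then show ?thesis by (rule arg_cong)
  qed
  ultimately show "\<forall>\<^sub>F s in at t within S \<inter> {..t}. v \<lfloor>c * s\<rfloor> = v (\<lceil>c * t\<rceil> - 1)"
    unfolding eventually_at by blast
qed

lemma cadlag_on_cong:
  assumes "\<And>t. t \<in> S \<Longrightarrow> x t = y t" and "cadlag_on S x"
  shows "cadlag_on S y"
  unfolding cadlag_on_def
proof (intro ballI conjI)
  fix t assume t: "t \<in> S"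
  have "(x \<longlongrightarrow> x t) (at t within S \<inter> {t..})" using assms(2) t by (auto simp: cadlag_on_def)
  then show "(y \<longlongrightarrow> y t) (at t within S \<inter> {t..})"
    unfolding assms(1)[OF t]
    by (rule tendsto_cong[THEN iffD1, rotated]) (auto simp: eventually_at_filter assms(1))
  obtain l where "(x \<longlongrightarrow> l) (at t within S \<inter> {..t})" using assms(2) t by (auto simp: cadlag_on_def)
  then have "(y \<longlongrightarrow> l) (at t within S \<inter> {..t})"
    by (rule tendsto_cong[THEN iffD1, rotated]) (auto simp: eventually_at_filter assms(1))
  then show "\<exists>l. (y \<longlongrightarrow> l) (at t within S \<inter> {..t})" ..
qed

lemma cadlag_on_subset:
  assumes "cadlag_on S x" "R \<subseteq> S"
  shows "cadlag_on R x"
  unfolding cadlag_on_def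
proof (intro ballI conjI)
  fix t assume "t \<in> R"
  then have t: "t \<in> S" using assms(2) by auto
  have "(x \<longlongrightarrow> x t) (at t within S \<inter> {t..})" using assms(1) t by (simp add: cadlag_on_def)
  then show "(x \<longlongrightarrow> x t) (at t within R \<inter> {t..})"
    by (rule tendsto_within_subset) (use assms(2) in blast)
  obtain l where "(x \<longlongrightarrow> l) (at t within S \<inter> {..t})" using assms(1) t unfolding cadlag_on_def by blast
  then have "(x \<longlongrightarrow> l) (at t within R \<inter> {..t})"
    by (rule tendsto_within_subset) (use assms(2) in blast)
  then show "\<exists>l. (x \<longlongrightarrow> l) (at t within R \<inter> {..t})" ..
qed

lemma restrict_in_skorokhod_space:
  assumes "cadlag_on {0..} x"
  shows "restrict x {0..T} \<in> skorokhod_space T"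
proof -
  have "cadlag_on {0..T} x" by (rule cadlag_on_subset[OF assms]) auto
  then have "cadlag_on {0..T} (restrict x {0..T})" by (rule cadlag_on_cong[rotated]) simp
  then show ?thesis by (auto simp: skorokhod_space_def)
qed

lemma step_path_in_skorokhod_space:
  assumes "T > 0" "n > 0"
  shows "step_path T n w \<in> skorokhod_space T"
proof -
  have c: "real n / T > 0" using assms by simp
  have "cadlag_on {0..} (\<lambda>t. w ! nat \<lfloor>(real n / T) * t\<rfloor>)"
    unfolding cadlag_on_def
    using tendsto_floor_right[OF c, of "\<lambda>z. w ! nat z"] tendsto_floor_left[OF c, of "\<lambda>z. w ! nat z"] by blast
  then have "cadlag_on {0..} (\<lambda>t. w ! nat \<lfloor>real n * t / T\<rfloor>)" by simp
  then show ?thesis unfolding step_path_def by (rule restrict_in_skorokhod_space)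
qed

lemma strict_mono_nat_interval:
  fixes \<tau> :: "nat \<Rightarrow> real"
  assumes "\<And>k. k < n \<Longrightarrow> \<tau> k < \<tau> (Suc k)" "i \<le> j" "j \<le> n"
  shows "\<tau> i \<le> \<tau> j"
  using assms(2,3)
proof (induction j)
  case 0 then show ?case by simp
next
  case (Suc j)
  have "\<tau> j \<le> \<tau> (Suc j)" by (rule less_imp_le, rule assms(1)) (use Suc.prems in simp)
  show ?case
  proof (cases "i = Suc j")
    case True then show ?thesis by simp
  next
    case False
    with Suc.prems have ij: "i \<le> j" "j \<le> n" by linarith+
    show ?thesis using Suc.IH[OF ij] \<open>\<tau> j \<le> _\<close> by (rule order_trans)
  qed
qed

text \<open>A piecewise linear time change through prescribed points, built one cell at a time.\<close>

lemma monotone_interpolation: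
  fixes \<tau> g :: "nat \<Rightarrow> real"
  assumes "\<And>k. k < n \<Longrightarrow> \<tau> k < \<tau> (Suc k)" "\<And>k. k < n \<Longrightarrow> g k < g (Suc k)"
  shows "\<exists>\<theta>. strict_mono_on {\<tau> 0..\<tau> n} \<theta> \<and> \<theta> ` {\<tau> 0..\<tau> n} = {g 0..g n} \<and> (\<forall>k\<le>n. \<theta> (\<tau> k) = g k)"
  using assms
proof (induction n)
  case 0
  show ?case by (rule exI[of _ "\<lambda>_. g 0"]) (auto simp: strict_mono_on_def)
next
  case (Suc n)
  have "\<exists>\<theta>. strict_mono_on {\<tau> 0..\<tau> n} \<theta> \<and> \<theta> ` {\<tau> 0..\<tau> n} = {g 0..g n} \<and> (\<forall>k\<le>n. \<theta> (\<tau> k) = g k)"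
    by (rule Suc.IH) (simp_all add: Suc.prems)
  then obtain \<theta> where m: "strict_mono_on {\<tau> 0..\<tau> n} \<theta>" and im: "\<theta> ` {\<tau> 0..\<tau> n} = {g 0..g n}"
    and v: "\<And>k. k \<le> n \<Longrightarrow> \<theta> (\<tau> k) = g k" by blast
  define c where "c = (g (Suc n) - g n) / (\<tau> (Suc n) - \<tau> n)"
  define \<theta>' where "\<theta>' t = (if t \<le> \<tau> n then \<theta> t else g n + c * (t - \<tau> n))" for t
  have lt: "\<tau> n < \<tau> (Suc n)" "g n < g (Suc n)" by (simp_all add: Suc.prems)
  have c: "c > 0" using lt by (simp add: c_def)
  have cg: "g n + c * (\<tau> (Suc n) - \<tau> n) = g (Suc n)" using lt by (simp add: c_def)
  have ord\<tau>: "\<tau> k \<le> \<tau> n" if "k \<le> n" for k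
    by (rule strict_mono_nat_interval[where n = n]) (simp_all add: Suc.prems that)
  have ordg: "g k \<le> g n" if "k \<le> n" for k
    by (rule strict_mono_nat_interval[where n = n]) (simp_all add: Suc.prems that)
  have vn: "\<theta> (\<tau> n) = g n" using v by simp
  have top: "\<theta> t \<le> g n" if "t \<in> {\<tau> 0..\<tau> n}" for t using im that by (metis atLeastAtMost_iff imageI)
  have "strict_mono_on {\<tau> 0..\<tau> (Suc n)} \<theta>'"
  proof (rule strict_mono_onI)
    fix r s assume rs: "r \<in> {\<tau> 0..\<tau> (Suc n)}" "s \<in> {\<tau> 0..\<tau> (Suc n)}" "r < s"
    consider "s \<le> \<tau> n" | "r \<le> \<tau> n" "\<tau> n < s" | "\<tau> n < r" by linarith
    then show "\<theta>' r < \<theta>' s"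
    proof cases
      case 1 then show ?thesis using rs strict_mono_onD[OF m, of r s] by (auto simp: \<theta>'_def)
    next
      case 2
      have "c * (s - \<tau> n) > 0" using 2 c by simp
      then show ?thesis using 2 rs top[of r] by (auto simp: \<theta>'_def)
    next
      case 3 then show ?thesis using rs c by (auto simp: \<theta>'_def)
    qed
  qed
  moreover have "\<theta>' ` {\<tau> 0..\<tau> (Suc n)} = {g 0..g (Suc n)}"
  proof
    show "\<theta>' ` {\<tau> 0..\<tau> (Suc n)} \<subseteq> {g 0..g (Suc n)}"
    proof
      fix y assume "y \<in> \<theta>' ` {\<tau> 0..\<tau> (Suc n)}"
      then obtain t where t: "t \<in> {\<tau> 0..\<tau> (Suc n)}" "y = \<theta>' t" by auto
      show "y \<in> {g 0..g (Suc n)}"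
      proof (cases "t \<le> \<tau> n")
        case True
        then have "\<theta> t \<in> {g 0..g n}" using t im by (metis atLeastAtMost_iff imageI)
        then show ?thesis using t True lt by (auto simp: \<theta>'_def)
      next
        case False
        have "c * (t - \<tau> n) \<le> c * (\<tau> (Suc n) - \<tau> n)" using t c by (intro mult_left_mono) auto
        moreover have "0 \<le> c * (t - \<tau> n)" using False c by simp
        ultimately have "g n \<le> y" "y \<le> g (Suc n)" using t False cg by (simp_all add: \<theta>'_def)
        then show ?thesis using ordg[of 0] by simp
      qed
    qed
    show "{g 0..g (Suc n)} \<subseteq> \<theta>' ` {\<tau> 0..\<tau> (Suc n)}"
    proof
      fix y assume y: "y \<in> {g 0..g (Suc n)}"
      show "y \<in> \<theta>' ` {\<tau> 0..\<tau> (Suc n)}"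
      proof (cases "y \<le> g n")
        case True
        then have "y \<in> \<theta> ` {\<tau> 0..\<tau> n}" using im y by auto
        then obtain t where "t \<in> {\<tau> 0..\<tau> n}" "y = \<theta> t" by auto
        then show ?thesis using lt by (intro image_eqI[of _ _ t]) (auto simp: \<theta>'_def)
      next
        case False
        define t where "t = \<tau> n + (y - g n) / c"
        have 1: "t > \<tau> n" using False c by (simp add: t_def)
        have "y - g n \<le> c * (\<tau> (Suc n) - \<tau> n)" using y cg by auto
        then have "(y - g n) / c \<le> \<tau> (Suc n) - \<tau> n" using c by (simp add: field_simps)
        then have "t \<le> \<tau> (Suc n)" by (simp add: t_def)
        moreover have "\<theta>' t = y" using 1 c by (simp add: \<theta>'_def t_def)
        ultimately show ?thesis using 1 ord\<tau>[of 0] by (intro image_eqI[of _ _ t]) auto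
      qed
    qed
  qed
  moreover have "\<forall>k\<le>Suc n. \<theta>' (\<tau> k) = g k"
    using v ord\<tau> lt cg by (auto simp: \<theta>'_def le_Suc_eq)
  ultimately show ?case by blast
qed

lemma grid_cell_exists:
  fixes \<tau> :: "nat \<Rightarrow> real"
  assumes "\<tau> 0 \<le> t" "t < \<tau> n"
  obtains k where "k < n" "\<tau> k \<le> t" "t < \<tau> (Suc k)"
proof -
  have "\<exists>k<n. \<tau> k \<le> t \<and> t < \<tau> (Suc k)" using assms
  proof (induction n)
    case (Suc n)
    then show ?case by (cases "t < \<tau> n") (auto simp: less_Suc_eq)
  qed simp
  then show ?thesis using that by blast
qed

lemma nth_grid_values: "k \<le> n \<Longrightarrow> grid_values h n x ! k = x (real k * h)"
  by (simp add: grid_values_def del: upt_Suc)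

text \<open>If the path jumps at most once per cell, at \<open>\<tau> (Suc k)\<close>, then the time change that maps the jump times to the
  following grid points turns it into its step path exactly. Times then move by at most two cells. On the last cell the
  path has to keep its value up to \<open>T\<close>, as time changes fix \<open>T\<close> and the step path jumps there.\<close>

lemma skorokhod_dist_step_path_le:
  assumes T: "T > 0" and n: "n > 0" and x: "x \<in> skorokhod_space T"
    and \<tau>: "\<tau> 0 = 0" "\<tau> n = T"
    and cell: "\<And>k. k < n \<Longrightarrow> real k * (T / n) < \<tau> (Suc k) \<and> \<tau> (Suc k) \<le> real (Suc k) * (T / n)"
    and const: "\<And>k t. k < n \<Longrightarrow> \<tau> k \<le> t \<Longrightarrow> t < \<tau> (Suc k) \<Longrightarrow> x t = x (real k * (T / n))"
  shows "skorokhod_dist T x (step_path T n (grid_values (T / n) n x)) \<le> 2 * T / n"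
proof -
  define g where "g k = real k * (T / n)" for k
  have g: "g k < g (Suc k)" for k using T n by (simp add: g_def field_simps)
  have gS: "g (Suc k) = g k + T / n" for k by (simp add: g_def algebra_simps add_divide_distrib)
  have gn: "g n = T" "g 0 = 0" using n by (simp_all add: g_def)
  have \<tau>g: "\<tau> k \<le> g k" if "k \<le> n" for k
    using that cell[of "k - 1"] \<tau> by (cases k) (auto simp: g_def)
  have inc: "\<tau> k < \<tau> (Suc k)" if "k < n" for k
    using \<tau>g[of k] cell[OF that] that by (simp add: g_def)
  have \<tau>g': "g k \<le> \<tau> k + T / n" if "k \<le> n" for k
  proof (cases k)
    case 0 then show ?thesis using \<tau> gn T by simp
  next
    case (Suc j)
    then show ?thesis using cell[of j] that gS[of j] by (simp add: g_def)
  qed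
  obtain \<theta> where m: "strict_mono_on {0..T} \<theta>" and im: "\<theta> ` {0..T} = {0..T}"
    and v: "\<And>k. k \<le> n \<Longrightarrow> \<theta> (\<tau> k) = g k"
    using monotone_interpolation[of n \<tau> g] inc g unfolding \<tau> gn by blast
  have \<theta>: "\<theta> \<in> time_changes T" using m im by (simp add: time_changes_def)
  define y where "y = step_path T n (grid_values (T / n) n x)"
  have "\<bar>\<theta> t - t\<bar> \<le> 2 * T / n \<and> \<bar>real (x t) - real (y (\<theta> t))\<bar> \<le> 2 * T / n" if t: "t \<in> {0..T}" for t
  proof (cases "t = T")
    case True
    have "\<theta> T = T" using v[of n] \<tau> gn by simp
    moreover have "y T = x T"
      using T n by (simp add: y_def step_path_def nth_grid_values)
    ultimately show ?thesis using True T by simp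
  next
    case False
    then have "\<tau> 0 \<le> t" "t < \<tau> n" using t \<tau> by auto
    then obtain k where k: "k < n" "\<tau> k \<le> t" "t < \<tau> (Suc k)" by (rule grid_cell_exists)
    have tk: "\<tau> k \<in> {0..T}" "\<tau> (Suc k) \<in> {0..T}"
      using strict_mono_nat_interval[of n \<tau>, OF inc, of 0 k] strict_mono_nat_interval[of n \<tau>, OF inc, of k n]
        strict_mono_nat_interval[of n \<tau>, OF inc, of 0 "Suc k"] strict_mono_nat_interval[of n \<tau>, OF inc, of "Suc k" n] k \<tau>
            by simp_all
    have "\<theta> (\<tau> k) \<le> \<theta> t" using strict_mono_onD[OF m tk(1) t] k by (cases "\<tau> k = t") auto
    moreover have "\<theta> t < \<theta> (\<tau> (Suc k))" using strict_mono_onD[OF m t tk(2)] k by auto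
    ultimately have \<theta>t: "g k \<le> \<theta> t" "\<theta> t < g (Suc k)" using v[of k] v[of "Suc k"] k by auto
    have "\<lfloor>real n * \<theta> t / T\<rfloor> = int k"
    proof (rule floor_unique)
      show "real_of_int (int k) \<le> real n * \<theta> t / T" using \<theta>t(1) T n by (simp add: g_def field_simps)
      show "real n * \<theta> t / T < real_of_int (int k) + 1" using \<theta>t(2) T n by (simp add: g_def field_simps)
    qed
    moreover have "\<theta> t \<in> {0..T}" using im t by blast
    ultimately have "y (\<theta> t) = x (g k)"
      using k by (simp add: y_def step_path_def nth_grid_values g_def)
    also have "\<dots> = x t" using const[OF k] by (simp add: g_def)
    finally have 1: "y (\<theta> t) = x t" .
    have "\<bar>\<theta> t - t\<bar> \<le> 2 * (T / n)"
      using \<theta>t k \<tau>g[of "Suc k"] \<tau>g'[of k] gS[of k] T by (auto simp: abs_le_iff)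
    then show ?thesis using 1 T by simp
  qed
  then have "\<forall>t\<in>{0..T}. \<bar>\<theta> t - t\<bar> \<le> 2 * T / n \<and> \<bar>real (x t) - real (y (\<theta> t))\<bar> \<le> 2 * T / n" ..
  moreover have "0 < 2 * T / n" using T n by simp
  ultimately have mem: "2 * T / n \<in> {e. 0 < e \<and> (\<exists>\<theta>\<in>time_changes T. \<forall>t\<in>{0..T}.
        \<bar>\<theta> t - t\<bar> \<le> e \<and> \<bar>real (x t) - real (y (\<theta> t))\<bar> \<le> e)}" using \<theta> by blast
  have "y \<in> skorokhod_space T" unfolding y_def by (rule step_path_in_skorokhod_space[OF T n])
  then have "skorokhod_dist T x y \<le> 2 * T / n"
    unfolding skorokhod_dist_def using x
    by (simp only: simp_thms if_True) (rule cInf_lower[OF mem], rule bdd_belowI[of _ 0], auto)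
  then show ?thesis by (simp add: y_def)
qed

text \<open>Discreteness of the values turns one-sided limits into one-sided constancy.\<close>

lemma cadlag_locally_two_valued:
  assumes x: "x \<in> skorokhod_space T" and c: "c \<in> {0..T}"
  shows "\<exists>d>0. (\<forall>s\<in>{0..T}. c \<le> s \<longrightarrow> dist c s < d \<longrightarrow> x s = x c) \<and>
     (\<forall>s\<in>{0..T}. \<forall>s'\<in>{0..T}. s < c \<longrightarrow> s' < c \<longrightarrow> dist c s < d \<longrightarrow> dist c s' < d \<longrightarrow> x s = x s')"
proof -
  have "(x \<longlongrightarrow> x c) (at c within {0..T} \<inter> {c..})"
    using x c unfolding skorokhod_space_def cadlag_on_def by blast
  then obtain d where d: "d > 0" "\<And>s. s \<in> {0..T} \<inter> {c..} \<Longrightarrow> s \<noteq> c \<Longrightarrow> dist s c < d \<Longrightarrow> x s = x c"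
    unfolding tendsto_discrete eventually_at by blast
  obtain l where "(x \<longlongrightarrow> l) (at c within {0..T} \<inter> {..c})"
    using x c unfolding skorokhod_space_def cadlag_on_def by blast
  then obtain e where e: "e > 0" "\<And>s. s \<in> {0..T} \<inter> {..c} \<Longrightarrow> s \<noteq> c \<Longrightarrow> dist s c < e \<Longrightarrow> x s = l"
    unfolding tendsto_discrete eventually_at by blast
  show ?thesis
  proof (intro exI[of _ "min d e"] conjI ballI impI)
    show "0 < min d e" using d e by simp
    show "x s = x c" if "s \<in> {0..T}" "c \<le> s" "dist c s < min d e" for s
      using d(2)[of s] that by (cases "s = c") (auto simp: dist_commute)
    show "x s = x s'" if "s \<in> {0..T}" "s' \<in> {0..T}" "s < c" "s' < c" "dist c s < min d e" "dist c s' < min d e" for s s'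
      using e(2)[of s] e(2)[of s'] that by (auto simp: dist_commute)
  qed
qed

text \<open>The balls on which the path takes only two values cover the compact interval. By Lebesgue's number
  lemma every cell of a fine grid lies in such a ball and contains at most one jump.\<close>

lemma skorokhod_dist_step_path_tendsto:
  assumes T: "T > 0" and x: "x \<in> skorokhod_space T"
  shows "(\<lambda>n. skorokhod_dist T x (step_path T n (grid_values (T / n) n x))) \<longlonglongrightarrow> 0"
proof -
  have "\<forall>c\<in>{0..T}. \<exists>d>0. (\<forall>s\<in>{0..T}. c \<le> s \<longrightarrow> dist c s < d \<longrightarrow> x s = x c) \<and>
     (\<forall>s\<in>{0..T}. \<forall>s'\<in>{0..T}. s < c \<longrightarrow> s' < c \<longrightarrow> dist c s < d \<longrightarrow> dist c s' < d \<longrightarrow> x s = x s')"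
    using cadlag_locally_two_valued[OF x] by blast
  then obtain d where d: "\<And>c. c \<in> {0..T} \<Longrightarrow> d c > 0"
    and right: "\<And>c s. c \<in> {0..T} \<Longrightarrow> s \<in> {0..T} \<Longrightarrow> c \<le> s \<Longrightarrow> dist c s < d c \<Longrightarrow> x s = x c"
    and left: "\<And>c s s'. c \<in> {0..T} \<Longrightarrow> s \<in> {0..T} \<Longrightarrow> s' \<in> {0..T} \<Longrightarrow> s < c \<Longrightarrow> s' < c \<Longrightarrow>
       dist c s < d c \<Longrightarrow> dist c s' < d c \<Longrightarrow> x s = x s'"
    by (subst (asm) bchoice_iff) blast
  have "compact {0..T}" by simp
  then obtain \<delta> where \<delta>: "\<delta> > 0"
    "\<And>I. I \<subseteq> {0..T} \<Longrightarrow> diameter I < \<delta> \<Longrightarrow> \<exists>B\<in>(\<lambda>c. ball c (d c)) ` {0..T}. I \<subseteq> B"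
    by (rule Lebesgue_number_lemma[of "{0..T}" "(\<lambda>c. ball c (d c)) ` {0..T}"])
       (use T d in \<open>auto intro!: bexI\<close>)
  have T0: "T \<in> {0..T}" using T by simp
  define \<delta>' where "\<delta>' = min \<delta> (d T)"
  have \<delta>': "\<delta>' > 0" using \<delta> d[OF T0] by (simp add: \<delta>'_def)
  have main: "skorokhod_dist T x (step_path T n (grid_values (T / n) n x)) \<le> 2 * T / n"
    if n: "n > 0" "T / n < \<delta>'" for n
  proof -
    define g where "g k = real k * (T / n)" for k
    have gS: "g (Suc k) = g k + T / n" for k by (simp add: g_def algebra_simps add_divide_distrib)
    have h: "T / n > 0" using T n by simp
    have g01: "0 \<le> g k" "g k \<le> T" if "k \<le> n" for k
    proof -
      show "0 \<le> g k" unfolding g_def by (rule mult_nonneg_nonneg) (use h in auto)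
      have "g k \<le> real n * (T / n)" unfolding g_def using that h by (intro mult_right_mono) auto
      then show "g k \<le> T" using n by simp
    qed
    have gn: "g n = T" using n by (simp add: g_def)
    \<comment> \<open>The centre \<open>T\<close> for the last cell excludes a jump strictly before \<open>T\<close> in it.\<close>
    have ex: "\<exists>c\<in>{0..T}. {g k..g (Suc k)} \<subseteq> ball c (d c) \<and> (Suc k = n \<longrightarrow> c = T)" if k: "k < n" for k
    proof (cases "Suc k = n")
      case True
      have "{g k..g (Suc k)} \<subseteq> ball T (d T)"
        using True gn gS[of k] n by (auto simp: dist_real_def \<delta>'_def)
      then show ?thesis using T0 by blast
    next
      case False
      have "{g k..g (Suc k)} \<subseteq> {0..T}" using g01[of k] g01[of "Suc k"] k by auto
      moreover have "diameter {g k..g (Suc k)} < \<delta>"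
        using n h gS[of k] by (simp add: diameter_closed_interval \<delta>'_def)
      ultimately show ?thesis using \<delta>(2) False by blast
    qed
    define c where "c k = (SOME c. c \<in> {0..T} \<and> {g k..g (Suc k)} \<subseteq> ball c (d c) \<and> (Suc k = n \<longrightarrow> c = T))" for k
    have c: "c k \<in> {0..T}" "{g k..g (Suc k)} \<subseteq> ball (c k) (d (c k))" "Suc k = n \<Longrightarrow> c k = T" if "k < n" for k
      using someI_ex[of "\<lambda>c. c \<in> {0..T} \<and> {g k..g (Suc k)} \<subseteq> ball c (d c) \<and> (Suc k = n \<longrightarrow> c = T)"] ex[OF that]
      unfolding c_def[symmetric] by blast+
    \<comment> \<open>The possible jump time of a cell; if the centre lies outside, the path is constant and any time would do.\<close>
    define \<sigma> where "\<sigma> k = (if g k < c k \<and> c k \<le> g (Suc k) then c k else g (Suc k))" for k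
    have \<sigma>: "g k < \<sigma> k" "\<sigma> k \<le> g (Suc k)" for k using gS[of k] h by (auto simp: \<sigma>_def)
    have before: "x t = x (g k)" if k: "k < n" and t: "g k \<le> t" "t < \<sigma> k" for k t
    proof -
      have mem: "t \<in> {0..T}" "g k \<in> {0..T}" using g01[of k] g01[of "Suc k"] k t \<sigma>[of k] by auto
      have ds: "dist (c k) t < d (c k)" "dist (c k) (g k) < d (c k)"
        using c(2)[OF k] t \<sigma>[of k] by (auto simp: subset_eq)
      show ?thesis
      proof (cases "c k \<le> g k")
        case True
        then show ?thesis using right[OF c(1)[OF k] mem(1)] right[OF c(1)[OF k] mem(2)] ds t by simp
      next
        case False
        then have "t < c k" using t by (auto simp: \<sigma>_def split: if_splits)
        then show ?thesis using left[OF c(1)[OF k] mem] False ds by simp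
      qed
    qed
    have after: "x t = x (g (Suc k))" if k: "k < n" and t: "\<sigma> k \<le> t" "t \<le> g (Suc k)" for k t
    proof (cases "c k \<le> g (Suc k) \<and> g k < c k")
      case False
      then show ?thesis using t by (simp add: \<sigma>_def split: if_splits)
    next
      case True
      have mem: "t \<in> {0..T}" "g (Suc k) \<in> {0..T}" using g01[of k] g01[of "Suc k"] k t \<sigma>[of k] by auto
      have ds: "dist (c k) t < d (c k)" "dist (c k) (g (Suc k)) < d (c k)"
        using c(2)[OF k] t \<sigma>[of k] by (auto simp: subset_eq)
      have "c k \<le> t" using True t by (simp add: \<sigma>_def)
      then show ?thesis using right[OF c(1)[OF k] mem(1)] right[OF c(1)[OF k] mem(2)] ds True by simp
    qed
    \<comment> \<open>A cell \<open>[\<tau> k, \<tau> (Suc k))\<close> begins with the jump of the previous grid cell.\<close>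
    define \<tau> where "\<tau> k = (case k of 0 \<Rightarrow> 0 | Suc j \<Rightarrow> \<sigma> j)" for k
    show ?thesis
    proof (rule skorokhod_dist_step_path_le[OF T n(1) x, of \<tau>])
      show "\<tau> 0 = 0" by (simp add: \<tau>_def)
      obtain j where j: "n = Suc j" using n by (cases n) auto
      have cj: "c j = T" by (rule c(3)) (simp_all add: j)
      have gj: "g (Suc j) = T" using gn by (simp only: j)
      have "g j < T" using gS[of j] gj h by linarith
      then have "\<sigma> j = T" using cj gj by (simp add: \<sigma>_def)
      then show "\<tau> n = T" by (simp add: \<tau>_def j)
      show "real k * (T / n) < \<tau> (Suc k) \<and> \<tau> (Suc k) \<le> real (Suc k) * (T / n)" for k
        using \<sigma>[of k] by (simp add: \<tau>_def g_def)
      show "x t = x (real k * (T / n))" if k: "k < n" and t: "\<tau> k \<le> t" "t < \<tau> (Suc k)" for k t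
      proof (cases "g k \<le> t")
        case True then show ?thesis using before[OF k True] t by (simp add: \<tau>_def g_def)
      next
        case False
        then obtain j where "k = Suc j" using t by (cases k) (auto simp: \<tau>_def g_def)
        then show ?thesis using after[of j t] k t False by (simp add: \<tau>_def g_def)
      qed
    qed
  qed
  have nonneg: "0 \<le> skorokhod_dist T x y" for y
    using Metric_space.nonneg[OF skorokhod_metric_space] .
  have "(\<lambda>n. T / real n) \<longlonglongrightarrow> 0" by (rule lim_const_over_n)
  then have "\<forall>\<^sub>F n in sequentially. T / real n < \<delta>'" using \<delta>' by (rule order_tendstoD)
  then have ev: "\<forall>\<^sub>F n in sequentially. skorokhod_dist T x (step_path T n (grid_values (T / n) n x)) \<le> 2 * T / n"
    using eventually_gt_at_top[of 0] by eventually_elim (use main in auto)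
  have "(\<lambda>n. 2 * T / real n) \<longlonglongrightarrow> 0" by (rule lim_const_over_n)
  then show ?thesis
    by (rule tendsto_sandwich[OF _ ev tendsto_const, rotated]) (simp add: nonneg)
qed

lemma measurable_map_list:
  assumes "countable A" and "\<And>k. k < m \<Longrightarrow> f k \<in> measurable M (count_space A)"
  shows "(\<lambda>\<omega>. map (\<lambda>k. f k \<omega>) [0..<m]) \<in> measurable M (count_space (lists A))"
  unfolding measurable_count_space_eq_countable[OF countable_lists[OF assms(1)]]
proof (intro conjI funcsetI ballI)
  fix \<omega> assume "\<omega> \<in> space M"
  then show "map (\<lambda>k. f k \<omega>) [0..<m] \<in> lists A"
    using measurable_space[OF assms(2)] by (fastforce simp: in_lists_conv_set)
next
  fix w assume w: "w \<in> lists A"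
  show "(\<lambda>\<omega>. map (\<lambda>k. f k \<omega>) [0..<m]) -` {w} \<inter> space M \<in> sets M"
  proof (cases "length w = m")
    case False
    then have "(\<lambda>\<omega>. map (\<lambda>k. f k \<omega>) [0..<m]) -` {w} \<inter> space M = {}" by auto
    then show ?thesis by simp
  next
    case True
    have "{\<omega> \<in> space M. f k \<omega> = w ! k} \<in> sets M" if k: "k < m" for k
    proof -
      have "w ! k \<in> A" using w k True nth_mem[of k w] by (auto simp: in_lists_conv_set)
      then have "f k -` {w ! k} \<inter> space M \<in> sets M"
        using k by (intro measurable_sets[OF assms(2)]) auto
      moreover have "f k -` {w ! k} \<inter> space M = {\<omega> \<in> space M. f k \<omega> = w ! k}" by blast
      ultimately show ?thesis by simp
    qed
    then have "{\<omega> \<in> space M. \<forall>k\<in>{..<m}. f k \<omega> = w ! k} \<in> sets M"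
      by (intro sets.sets_Collect_finite_All) auto
    moreover have "map (\<lambda>k. f k \<omega>) [0..<m] = w \<longleftrightarrow> (\<forall>k\<in>{..<m}. f k \<omega> = w ! k)" for \<omega>
      by (subst list_eq_iff_nth_eq) (simp add: True Ball_def)
    then have "(\<lambda>\<omega>. map (\<lambda>k. f k \<omega>) [0..<m]) -` {w} \<inter> space M = {\<omega> \<in> space M. \<forall>k\<in>{..<m}. f k \<omega> = w ! k}"
      by blast
    ultimately show ?thesis by simp
  qed
qed

lemma measurable_grid_values:
  fixes X :: "real \<Rightarrow> 'w \<Rightarrow> 'a::countable"
  assumes "\<And>t. t \<ge> 0 \<Longrightarrow> X t \<in> measurable M (count_space UNIV)" "h \<ge> 0"
  shows "(\<lambda>\<omega>. grid_values h n (\<lambda>t. X t \<omega>)) \<in> measurable M (count_space UNIV)"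
  using measurable_map_list[of UNIV "Suc n" "\<lambda>k. X (real k * h)" M] assms
  by (simp add: grid_values_def)

lemma grid_values_restrict:
  assumes "T > 0" "n > 0"
  shows "grid_values (T / real n) n (restrict x {0..T}) = grid_values (T / real n) n x"
proof -
  have "real k * (T / real n) \<in> {0..T}" if "k \<le> n" for k
  proof -
    have "real k * (T / real n) \<le> real n * (T / real n)" using that assms by (intro mult_right_mono) auto
    then show ?thesis using assms by auto
  qed
  then show ?thesis by (auto simp: grid_values_def simp del: upt_Suc)
qed

lemma step_path_approximation:
  assumes "T > 0" "cadlag_on {0..} x"
  shows "limitin (skorokhod_topology T) (\<lambda>n. step_path T (Suc n) (grid_values (T / real (Suc n)) (Suc n) x))
           (restrict x {0..T}) sequentially"
proof -
  interpret S: Metric_space "skorokhod_space T" "skorokhod_dist T" by (rule skorokhod_metric_space)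
  have in_sp: "restrict x {0..T} \<in> skorokhod_space T" by (rule restrict_in_skorokhod_space[OF assms(2)])
  have "(\<lambda>n. skorokhod_dist T (restrict x {0..T})
      (step_path T (Suc n) (grid_values (T / real (Suc n)) (Suc n) (restrict x {0..T})))) \<longlonglongrightarrow> 0"
    by (rule LIMSEQ_Suc[OF skorokhod_dist_step_path_tendsto[OF assms(1) in_sp]])
  then have "(\<lambda>n. skorokhod_dist T (step_path T (Suc n) (grid_values (T / real (Suc n)) (Suc n) x))
      (restrict x {0..T})) \<longlonglongrightarrow> 0"
    by (subst S.commute, subst (asm) grid_values_restrict) (use assms in auto)
  then show ?thesis unfolding skorokhod_topology_def S.limitin_metric_dist_null
    using in_sp step_path_in_skorokhod_space[OF assms(1)] by auto
qed

lemma topspace_skorokhod: "topspace (skorokhod_topology T) = skorokhod_space T"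
  unfolding skorokhod_topology_def by (rule Metric_space.topspace_mtopology[OF skorokhod_metric_space])

text \<open>The step paths depend on a list of numbers only, so every set of step paths has a measurable preimage, and
  preimages of open sets under the pointwise limit are countable combinations of such preimages.\<close>

lemma measurable_skorokhod_path:
  fixes X :: "real \<Rightarrow> 'w \<Rightarrow> nat"
  assumes T: "T > 0"
    and cadlag: "\<And>\<omega>. \<omega> \<in> space M \<Longrightarrow> cadlag_on {0..} (\<lambda>t. X t \<omega>)"
    and meas: "\<And>t. t \<ge> 0 \<Longrightarrow> X t \<in> measurable M (count_space UNIV)"
  shows "(\<lambda>\<omega>. restrict (\<lambda>t. X t \<omega>) {0..T}) \<in> measurable M (borel_of (skorokhod_topology T))"
proof -
  interpret S: Metric_space "skorokhod_space T" "skorokhod_dist T" by (rule skorokhod_metric_space)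
  define Y where "Y \<omega> = restrict (\<lambda>t. X t \<omega>) {0..T}" for \<omega>
  define V where "V n \<omega> = grid_values (T / real (Suc n)) (Suc n) (\<lambda>t. X t \<omega>)" for n \<omega>
  have Vm: "V n \<in> measurable M (count_space UNIV)" for n
    unfolding V_def by (rule measurable_grid_values[OF meas]) (use T in auto)
  have Yin: "Y \<omega> \<in> skorokhod_space T" if "\<omega> \<in> space M" for \<omega>
    unfolding Y_def by (rule restrict_in_skorokhod_space[OF cadlag[OF that]])
  have Zin: "step_path T (Suc n) w \<in> skorokhod_space T" for n w
    by (rule step_path_in_skorokhod_space[OF T]) simp
  have lim: "limitin S.mtopology (\<lambda>n. step_path T (Suc n) (V n \<omega>)) (Y \<omega>) sequentially" if "\<omega> \<in> space M" for \<omega>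
    using step_path_approximation[OF T cadlag[OF that]] by (simp add: V_def Y_def skorokhod_topology_def)
  have "Y -` U \<inter> space M \<in> sets M" if U: "openin S.mtopology U" for U
  proof -
    \<comment> \<open>Step paths that are inside \<open>U\<close> by a margin; membership for all large \<open>n\<close> and some margin characterises \<open>Y \<omega> \<in> U\<close>.\<close>
    define F where "F m n = {w. S.mball (step_path T (Suc n) w) (1 / real (Suc m)) \<subseteq> U}" for m n
    have "Y -` U \<inter> space M = {\<omega> \<in> space M. \<exists>m n0. \<forall>n. n0 \<le> n \<longrightarrow> V n \<omega> \<in> F m n}"
    proof (intro equalityI subsetI)
      fix \<omega> assume "\<omega> \<in> Y -` U \<inter> space M"
      then have \<omega>: "\<omega> \<in> space M" "Y \<omega> \<in> U" by auto
      then obtain r where r: "r > 0" "S.mball (Y \<omega>) r \<subseteq> U"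
        using U unfolding S.openin_mtopology by blast
      obtain m where m: "1 / real (Suc m) < r / 2" using reals_Archimedean[of "r / 2"] r by (auto simp: field_simps)
      have "\<forall>\<^sub>F n in sequentially. step_path T (Suc n) (V n \<omega>) \<in> skorokhod_space T \<and>
           skorokhod_dist T (step_path T (Suc n) (V n \<omega>)) (Y \<omega>) < r / 2"
        using lim[OF \<omega>(1)] half_gt_zero[OF r(1)] unfolding S.limitin_metric by blast
      then obtain n0 where n0: "\<And>n. n \<ge> n0 \<Longrightarrow> skorokhod_dist T (step_path T (Suc n) (V n \<omega>)) (Y \<omega>) < r / 2"
        unfolding eventually_sequentially by blast
      have "V n \<omega> \<in> F m n" if "n0 \<le> n" for n
      proof -
        have "y \<in> U" if y: "y \<in> S.mball (step_path T (Suc n) (V n \<omega>)) (1 / real (Suc m))" for y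
        proof -
          have "skorokhod_dist T (Y \<omega>) y \<le> skorokhod_dist T (Y \<omega>) (step_path T (Suc n) (V n \<omega>)) +
              skorokhod_dist T (step_path T (Suc n) (V n \<omega>)) y"
            by (rule S.triangle) (use y Yin[OF \<omega>(1)] Zin in \<open>auto simp: S.in_mball\<close>)
          also have "\<dots> < r / 2 + r / 2"
            using n0[OF \<open>n0 \<le> n\<close>] y m by (intro add_strict_mono) (auto simp: S.commute S.in_mball)
          finally have "y \<in> S.mball (Y \<omega>) r" using y Yin[OF \<omega>(1)] by (simp add: S.in_mball)
          then show ?thesis using r by blast
        qed
        then show ?thesis by (auto simp: F_def)
      qed
      then show "\<omega> \<in> {\<omega> \<in> space M. \<exists>m n0. \<forall>n. n0 \<le> n \<longrightarrow> V n \<omega> \<in> F m n}" using \<omega> by blast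
    next
      fix \<omega> assume "\<omega> \<in> {\<omega> \<in> space M. \<exists>m n0. \<forall>n. n0 \<le> n \<longrightarrow> V n \<omega> \<in> F m n}"
      then obtain m n0 where \<omega>: "\<omega> \<in> space M" and F: "\<And>n. n0 \<le> n \<Longrightarrow> V n \<omega> \<in> F m n" by blast
      have "\<forall>\<^sub>F n in sequentially. step_path T (Suc n) (V n \<omega>) \<in> skorokhod_space T \<and>
           skorokhod_dist T (step_path T (Suc n) (V n \<omega>)) (Y \<omega>) < 1 / real (Suc m)"
        using lim[OF \<omega>] unfolding S.limitin_metric by simp
      then obtain n1 where n1: "\<And>n. n \<ge> n1 \<Longrightarrow> skorokhod_dist T (step_path T (Suc n) (V n \<omega>)) (Y \<omega>) < 1 / real (Suc m)"
        unfolding eventually_sequentially by blast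
      define n where "n = max n0 n1"
      have "Y \<omega> \<in> S.mball (step_path T (Suc n) (V n \<omega>)) (1 / real (Suc m))"
        using n1[of n] Yin[OF \<omega>] Zin by (simp add: S.in_mball n_def)
      then show "\<omega> \<in> Y -` U \<inter> space M" using F[of n] \<omega> by (auto simp: F_def n_def)
    qed
    also have "\<dots> \<in> sets M"
    proof (intro sets.sets_Collect_countable_Ex sets.sets_Collect_countable_All)
      fix m n0 n
      have "V n -` F m n \<inter> space M \<in> sets M" by (rule measurable_sets[OF Vm]) simp
      then have "{\<omega> \<in> space M. V n \<omega> \<in> F m n} \<in> sets M" by (simp add: vimage_def Int_def conj_commute)
      then show "{\<omega> \<in> space M. n0 \<le> n \<longrightarrow> V n \<omega> \<in> F m n} \<in> sets M" by (cases "n0 \<le> n") simp_all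
    qed
    finally show ?thesis .
  qed
  then have "Y \<in> measurable M (sigma (skorokhod_space T) {U. openin S.mtopology U})"
    using Yin openin_subset[of S.mtopology] by (intro measurable_measure_of) auto
  then show ?thesis by (simp add: borel_of_def topspace_skorokhod skorokhod_topology_def Y_def[abs_def])
qed

lemma expectation_step_path_tendsto:
  fixes X :: "real \<Rightarrow> 'w \<Rightarrow> nat" and \<phi> :: "(real \<Rightarrow> nat) \<Rightarrow> real"
  assumes "prob_space M" and T: "T > 0"
    and cadlag: "\<And>\<omega>. \<omega> \<in> space M \<Longrightarrow> cadlag_on {0..} (\<lambda>t. X t \<omega>)"
    and meas: "\<And>t. t \<ge> 0 \<Longrightarrow> X t \<in> measurable M (count_space UNIV)"
    and cont: "continuous_map (skorokhod_topology T) euclideanreal \<phi>"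
    and bnd: "\<And>x. x \<in> skorokhod_space T \<Longrightarrow> \<bar>\<phi> x\<bar> \<le> b"
  shows "(\<lambda>n. \<integral>\<omega>. \<phi> (step_path T (Suc n) (grid_values (T / real (Suc n)) (Suc n) (\<lambda>t. X t \<omega>))) \<partial>M)
           \<longlonglongrightarrow> (\<integral>\<omega>. \<phi> (restrict (\<lambda>t. X t \<omega>) {0..T}) \<partial>M)"
proof -
  interpret prob_space M by fact
  have lim: "(\<lambda>n. \<phi> (step_path T (Suc n) (grid_values (T / real (Suc n)) (Suc n) (\<lambda>t. X t \<omega>))))
      \<longlonglongrightarrow> \<phi> (restrict (\<lambda>t. X t \<omega>) {0..T})" if "\<omega> \<in> space M" for \<omega>
    using continuous_map_limit[OF cont step_path_approximation[OF T cadlag[OF that]]] by (simp add: o_def)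
  have "(\<lambda>\<omega>. grid_values (T / real (Suc n)) (Suc n) (\<lambda>t. X t \<omega>)) \<in> measurable M (count_space UNIV)" for n
    by (rule measurable_grid_values[OF meas]) (use T in auto)
  then have m: "(\<lambda>\<omega>. \<phi> (step_path T (Suc n) (grid_values (T / real (Suc n)) (Suc n) (\<lambda>t. X t \<omega>)))) \<in> borel_measurable M" for n
    by (rule measurable_compose) simp
  show ?thesis
  proof (rule integral_dominated_convergence[where w = "\<lambda>_. b"])
    show "(\<lambda>\<omega>. \<phi> (restrict (\<lambda>t. X t \<omega>) {0..T})) \<in> borel_measurable M"
      by (rule borel_measurable_LIMSEQ_real[OF lim m])
    show "AE \<omega> in M. norm (\<phi> (step_path T (Suc n) (grid_values (T / real (Suc n)) (Suc n) (\<lambda>t. X t \<omega>)))) \<le> b" for n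
      by (rule AE_I2) (simp, rule bnd, rule step_path_in_skorokhod_space[OF T], simp)
  qed (use lim m in auto)
qed


section \<open>Markov semigroups with a bounded generator\<close>

lemma integrable_pmf_bounded:
  fixes f :: "'s \<Rightarrow> real"
  assumes "\<And>y. y \<in> set_pmf p \<Longrightarrow> \<bar>f y\<bar> \<le> c"
  shows "integrable (measure_pmf p) f"
  by (rule measure_pmf.integrable_const_bound[where B = c]) (auto simp: AE_measure_pmf_iff assms)

lemma abs_expectation_pmf_le:
  fixes f :: "'s \<Rightarrow> real"
  assumes "\<And>y. y \<in> set_pmf p \<Longrightarrow> \<bar>f y\<bar> \<le> c"
  shows "\<bar>measure_pmf.expectation p f\<bar> \<le> c"
proof -
  have "\<bar>measure_pmf.expectation p f\<bar> \<le> measure_pmf.expectation p (\<lambda>y. \<bar>f y\<bar>)"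
    by (rule integral_abs_bound)
  also have "\<dots> \<le> measure_pmf.expectation p (\<lambda>_. c)"
    using assms by (intro integral_mono_AE) (auto simp: AE_measure_pmf_iff intro!: integrable_pmf_bounded[where c = c])
  finally show ?thesis by simp
qed

lemma expectation_bind_pmf:
  fixes f :: "'s \<Rightarrow> real"
  assumes "\<And>y. \<bar>f y\<bar> \<le> c"
  shows "measure_pmf.expectation (bind_pmf p \<kappa>) f = measure_pmf.expectation p (\<lambda>x. measure_pmf.expectation (\<kappa> x) f)"
  unfolding measure_pmf_bind
proof (rule integral_bind[where B = c and B' = 1 and K = "count_space UNIV"])
  show "(\<lambda>x. measure_pmf (\<kappa> x)) \<in> measurable (measure_pmf p) (subprob_algebra (count_space UNIV))"
    by (subst measurable_cong_sets[OF sets_measure_pmf_count_space refl]) (rule measurable_measure_pmf)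
  show "finite_measure (measure_pmf p)" by unfold_locales
  show "AE x in measure_pmf p. emeasure (measure_pmf (\<kappa> x)) (space (measure_pmf (\<kappa> x))) \<le> ennreal 1"
    by (simp add: measure_pmf.emeasure_space_1)
qed (use assms in auto)

text \<open>The bound says that the operator norm of \<open>L\<close> on bounded functions is at most \<open>\<Lambda>\<close>. Test functions are
  bounded on the whole type and not just on \<open>S\<close>, which spares side conditions on the kernels.\<close>

locale bounded_generator =
  fixes S :: "'s set" and P :: "real \<Rightarrow> 's \<Rightarrow> 's pmf" and L :: "('s \<Rightarrow> real) \<Rightarrow> 's \<Rightarrow> real" and \<Lambda> :: real
  assumes semigroup: "markov_semigroup S P" and generator: "has_generator S P L"
    and L_bound: "\<And>f c x. (\<And>y. \<bar>f y\<bar> \<le> c) \<Longrightarrow> x \<in> S \<Longrightarrow> \<bar>L f x\<bar> \<le> \<Lambda> * c"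
begin

lemma P_closed: "x \<in> S \<Longrightarrow> t \<ge> 0 \<Longrightarrow> y \<in> set_pmf (P t x) \<Longrightarrow> y \<in> S"
  using semigroup unfolding markov_semigroup_def by blast

lemma expectation_add:
  fixes f :: "'s \<Rightarrow> real"
  assumes "\<And>y. \<bar>f y\<bar> \<le> c" "x \<in> S" "s \<ge> 0" "t \<ge> 0"
  shows "measure_pmf.expectation (P (s + t) x) f =
    measure_pmf.expectation (P s x) (\<lambda>y. measure_pmf.expectation (P t y) f)"
  using semigroup assms(2-) unfolding markov_semigroup_def
      by (simp add: expectation_bind_pmf[where f = f and c = c, OF assms(1)])

lemma short_time:
  fixes f :: "'s \<Rightarrow> real"
  assumes f: "\<And>y. \<bar>f y\<bar> \<le> c" and "e > 0"
  shows "\<exists>d>0. \<forall>s y. 0 < s \<longrightarrow> s < d \<longrightarrow> y \<in> S \<longrightarrow>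
    \<bar>measure_pmf.expectation (P s y) f - f y - s * L f y\<bar> \<le> e * s"
proof -
  have "bounded (f ` S)" using f by (auto intro!: boundedI[where B = c])
  then have "uniform_limit S (\<lambda>h x. (measure_pmf.expectation (P h x) f - f x) / h) (L f) (at_right 0)"
    using generator unfolding has_generator_def by blast
  then have "\<forall>\<^sub>F h in at_right 0. \<forall>x\<in>S. dist ((measure_pmf.expectation (P h x) f - f x) / h) (L f x) < e"
    using \<open>e > 0\<close> unfolding uniform_limit_iff by blast
  then obtain d where d: "d > 0" "\<And>h x. 0 < h \<Longrightarrow> h < d \<Longrightarrow> x \<in> S \<Longrightarrow>
      dist ((measure_pmf.expectation (P h x) f - f x) / h) (L f x) < e"
    unfolding eventually_at_right_field by auto
  show ?thesis
  proof (intro exI[of _ d] conjI allI impI d(1))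
    fix s y assume s: "0 < s" "s < d" "y \<in> S"
    have "\<bar>(measure_pmf.expectation (P s y) f - f y) / s - L f y\<bar> * s \<le> e * s"
      using d(2)[OF s] s by (intro mult_right_mono) (auto simp: dist_real_def)
    moreover have "((measure_pmf.expectation (P s y) f - f y) / s - L f y) * s =
        measure_pmf.expectation (P s y) f - f y - s * L f y" using s by (simp add: field_simps)
    ultimately show "\<bar>measure_pmf.expectation (P s y) f - f y - s * L f y\<bar> \<le> e * s"
      using s by (metis abs_mult abs_of_pos)
  qed
qed

text \<open>The mean value inequality for \<open>t \<mapsto> E f(X\<^sub>t)\<close>, whose derivative is \<open>E L f(X\<^sub>t)\<close>. Since the definition of the generator
  controls increments from the right only, uniformly in the starting point, the increment over \<open>[0, h]\<close> is cut into
  equal pieces of length below the threshold of \<open>short_time\<close>.\<close>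

lemma mean_value:
  fixes f :: "'s \<Rightarrow> real"
  assumes f: "\<And>y. \<bar>f y\<bar> \<le> c" and x: "x \<in> S" and h: "h \<ge> 0"
    and a: "\<And>t. 0 \<le> t \<Longrightarrow> t \<le> h \<Longrightarrow> \<bar>measure_pmf.expectation (P t x) (L f) - a\<bar> \<le> b"
  shows "\<bar>measure_pmf.expectation (P h x) f - f x - h * a\<bar> \<le> h * b"
proof (cases "h = 0")
  case True
  then show ?thesis using semigroup x by (simp add: markov_semigroup_def)
next
  case False
  with h have h: "h > 0" by simp
  show ?thesis
  proof (rule field_le_epsilon)
    fix e' :: real assume "e' > 0"
    define e where "e = e' / h"
    have e: "e > 0" using \<open>e' > 0\<close> h by (simp add: e_def)
    obtain d where d0: "d > 0" and "\<forall>s y. 0 < s \<longrightarrow> s < d \<longrightarrow> y \<in> S \<longrightarrow>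
        \<bar>measure_pmf.expectation (P s y) f - f y - s * L f y\<bar> \<le> e * s"
      using short_time[where f = f and c = c, OF f e] by blast
    then have d2: "\<bar>measure_pmf.expectation (P s y) f - f y - s * L f y\<bar> \<le> e * s"
      if "0 < s" "s < d" "y \<in> S" for s y using that by blast
    note d = d0 d2
    obtain n :: nat where n: "h / d < real n" using reals_Archimedean2 by blast
    have n0: "n > 0" using n h d(1) by (metis divide_pos_pos gr0I less_asym of_nat_0)
    define s where "s = h / n"
    have s: "0 < s" "s < d" using h d(1) n n0 by (auto simp: s_def field_simps)
    define u where "u t = measure_pmf.expectation (P t x) f" for t
    have step: "\<bar>u (t + s) - u t - s * a\<bar> \<le> s * (b + e)" if t: "0 \<le> t" "t \<le> h" for t
    proof -
      define G where "G = measure_pmf.expectation (P t x) (L f)"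
      have bnd: "\<bar>f y\<bar> \<le> c" "\<bar>s * L f y\<bar> \<le> s * (\<Lambda> * c)" "\<bar>measure_pmf.expectation (P s y) f\<bar> \<le> c"
        if "y \<in> set_pmf (P t x)" for y
        using f L_bound[where f = f and c = c, OF f P_closed[OF x t(1) that]] s abs_expectation_pmf_le[where f = f
            and c = c, OF f]
        by (auto simp: abs_mult intro!: mult_left_mono)
      have int: "integrable (measure_pmf (P t x)) f" "integrable (measure_pmf (P t x)) (\<lambda>y. s * L f y)"
        "integrable (measure_pmf (P t x)) (\<lambda>y. measure_pmf.expectation (P s y) f)"
        by (rule integrable_pmf_bounded, erule bnd)+
      have "u (t + s) - u t - s * G = measure_pmf.expectation (P t x) (\<lambda>y. measure_pmf.expectation (P s y) f) -
          measure_pmf.expectation (P t x) f - measure_pmf.expectation (P t x) (\<lambda>y. s * L f y)"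
        using expectation_add[where f = f and c = c and x = x and s = t and t = s, OF f x] s t by (simp add: u_def G_def)
      also have "\<dots> = measure_pmf.expectation (P t x) (\<lambda>y. measure_pmf.expectation (P s y) f - f y - s * L f y)"
        by (simp only: Bochner_Integration.integral_diff[OF Bochner_Integration.integrable_diff[OF int(3,1)] int(2)]
            Bochner_Integration.integral_diff[OF int(3,1)])
      finally have "\<bar>u (t + s) - u t - s * G\<bar> \<le> e * s"
        using d(2)[OF s P_closed[OF x t(1)]] by (simp add: abs_expectation_pmf_le)
      moreover have "\<bar>s * G - s * a\<bar> \<le> s * b"
        using a[OF t] s by (simp add: G_def abs_mult flip: right_diff_distrib)
      ultimately show ?thesis by (simp add: algebra_simps)
    qed
    have "\<bar>u (real k * s) - u 0 - real k * s * a\<bar> \<le> real k * s * (b + e)" if "k \<le> n" for k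
      using that
    proof (induction k)
      case (Suc k)
      have "real k * s \<le> real n * s" using Suc.prems s by (intro mult_right_mono) auto
      then have "real k * s \<le> h" using n0 by (simp add: s_def)
      then have "\<bar>u (real k * s + s) - u (real k * s) - s * a\<bar> \<le> s * (b + e)" using s by (intro step) auto
      moreover have "real (Suc k) * s = real k * s + s" by (simp add: algebra_simps)
      moreover have "\<bar>u (real k * s) - u 0 - real k * s * a\<bar> \<le> real k * s * (b + e)" using Suc by simp
      ultimately show ?case by (simp only: distrib_right abs_le_iff) linarith
    qed simp
    from this[of n] have "\<bar>u h - u 0 - h * a\<bar> \<le> h * (b + e)" using n0 by (simp add: s_def)
    moreover have "u 0 = f x" using semigroup x by (simp add: markov_semigroup_def u_def)
    moreover have "h * (b + e) = h * b + e'" using h by (simp add: e_def algebra_simps)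
    ultimately show "\<bar>measure_pmf.expectation (P h x) f - f x - h * a\<bar> \<le> h * b + e'" by (simp add: u_def)
  qed
qed

text \<open>Applied to \<open>L f\<close>, the mean value inequality shows that \<open>E L f(X\<^sub>t)\<close> stays within \<open>t \<Lambda>\<^sup>2 c\<close> of its initial value;
  applied once more, to \<open>f\<close>, it gives the quadratic remainder. The remainder is uniform in \<open>f\<close>, which makes this a
  statement about total variation.\<close>

lemma taylor:
  fixes f :: "'s \<Rightarrow> real"
  assumes f: "\<And>y. \<bar>f y\<bar> \<le> c" and x: "x \<in> S" and h: "h \<ge> 0"
  shows "\<bar>measure_pmf.expectation (P h x) f - f x - h * L f x\<bar> \<le> h\<^sup>2 * \<Lambda>\<^sup>2 * c"
proof -
  have incr: "\<bar>measure_pmf.expectation (P t x) g - g x\<bar> \<le> t * (\<Lambda> * c')"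
    if "\<And>y. \<bar>g y\<bar> \<le> c'" "t \<ge> 0" for g :: "'s \<Rightarrow> real" and c' t
  proof -
    have "\<bar>measure_pmf.expectation (P s x) (L g) - 0\<bar> \<le> \<Lambda> * c'" if "0 \<le> s" for s
      using abs_expectation_pmf_le[of "P s x" "L g" "\<Lambda> * c'"] L_bound[where f = g and c = c'] P_closed[OF x that]
        \<open>\<And>y. \<bar>g y\<bar> \<le> c'\<close> by simp
    then have "\<bar>measure_pmf.expectation (P t x) g - g x - t * 0\<bar> \<le> t * (\<Lambda> * c')"
      by (intro mean_value[where c = c']) (use that x in auto)
    then show ?thesis by simp
  qed
  define g where "g y = (if y \<in> S then L f y else 0)" for y
  have c0: "0 \<le> \<Lambda> * c" using L_bound[where f = f and c = c, OF f x] by (rule order_trans[OF abs_ge_zero])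
  have g: "\<bar>g y\<bar> \<le> \<Lambda> * c" for y using L_bound[where f = f and c = c, OF f] c0 by (simp add: g_def)
  have "\<bar>measure_pmf.expectation (P h x) f - f x - h * L f x\<bar> \<le> h * (h * (\<Lambda> * (\<Lambda> * c)))"
  proof (rule mean_value[where f = f and c = c, OF f x h])
    fix t assume t: "0 \<le> t" "t \<le> h"
    have "measure_pmf.expectation (P t x) (L f) = measure_pmf.expectation (P t x) g"
      using P_closed[OF x t(1)] by (intro integral_cong_AE) (auto simp: AE_measure_pmf_iff g_def)
    moreover have "g x = L f x" using x by (simp add: g_def)
    moreover have "\<bar>measure_pmf.expectation (P t x) g - g x\<bar> \<le> t * (\<Lambda> * (\<Lambda> * c))" by (rule incr[where g = g, OF g t(1)])
    moreover have "0 \<le> \<Lambda> * (\<Lambda> * c)" using L_bound[where f = g and c = "\<Lambda> * c", OF g x] by (rule order_trans[OF abs_ge_zero])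
    then have "t * (\<Lambda> * (\<Lambda> * c)) \<le> h * (\<Lambda> * (\<Lambda> * c))" using t by (intro mult_right_mono)
    ultimately show "\<bar>measure_pmf.expectation (P t x) (L f) - L f x\<bar> \<le> h * (\<Lambda> * (\<Lambda> * c))" by simp
  qed
  then show ?thesis by (simp add: power2_eq_square algebra_simps)
qed

end

lemma (in prob_space) discrete_law_pmf:
  fixes Z :: "'a \<Rightarrow> 'c"
  assumes C: "countable C" "Z \<in> measurable M (count_space C)"
  shows "\<exists>p. (\<forall>z. pmf p z = measure M {\<omega> \<in> space M. Z \<omega> = z}) \<and>
       (\<forall>g::'c \<Rightarrow> real. measure_pmf.expectation p g = (\<integral>\<omega>. g (Z \<omega>) \<partial>M)) \<and> set_pmf p \<subseteq> C"
proof -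
  have Z: "Z \<in> measurable M (count_space UNIV)"
  proof (rule measurableI)
    fix U :: "'c set"
    have "Z -` (U \<inter> C) \<inter> space M \<in> sets M" by (rule measurable_sets[OF C(2)]) auto
    moreover have "Z -` (U \<inter> C) \<inter> space M = Z -` U \<inter> space M" using measurable_space[OF C(2)] by auto
    ultimately show "Z -` U \<inter> space M \<in> sets M" by simp
  qed simp
  define D where "D = distr M (count_space UNIV) Z"
  interpret D: prob_space D unfolding D_def by (rule prob_space_distr[OF Z])
  have setsD: "sets D = UNIV" by (simp add: D_def)
  have D1: "measure D {z} = measure M {\<omega> \<in> space M. Z \<omega> = z}" for z
    by (subst D_def, subst measure_distr[OF Z]) (auto intro!: arg_cong[where f = "measure M"])
  have "AE z in D. measure D {z} \<noteq> 0"
  proof -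
    have "AE z in D. z \<in> C" unfolding D_def using measurable_space[OF C(2)]
      by (subst AE_distr_iff[OF Z]) auto
    moreover have "AE z in D. z \<in> C \<longrightarrow> measure D {z} \<noteq> 0"
    proof -
      have "{z \<in> C. measure D {z} = 0} \<in> null_sets D"
      proof -
        have "(\<Union>z\<in>{z \<in> C. measure D {z} = 0}. {z}) \<in> null_sets D"
          by (rule null_sets_UN') (use C(1) in \<open>auto simp: null_sets_def D.emeasure_eq_measure setsD\<close>)
        then show ?thesis by simp
      qed
      then show ?thesis by (rule AE_I') auto
    qed
    ultimately show ?thesis by eventually_elim simp
  qed
  then have Dp: "measure_pmf (Abs_pmf D) = D"
    by (intro Abs_pmf_inverse) (auto simp: D.prob_space_axioms, simp add: D_def)
  show ?thesis
  proof (intro exI[of _ "Abs_pmf D"] conjI allI)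
    show "pmf (Abs_pmf D) z = measure M {\<omega> \<in> space M. Z \<omega> = z}" for z
      by (simp add: pmf.rep_eq Dp D1)
    show "measure_pmf.expectation (Abs_pmf D) g = (\<integral>\<omega>. g (Z \<omega>) \<partial>M)" for g :: "'c \<Rightarrow> real"
      by (simp only: Dp) (simp only: D_def, rule integral_distr[OF Z], simp)
    show "set_pmf (Abs_pmf D) \<subseteq> C"
    proof
      fix z assume "z \<in> set_pmf (Abs_pmf D)"
      then have "measure M {\<omega> \<in> space M. Z \<omega> = z} \<noteq> 0" by (simp add: set_pmf_iff pmf.rep_eq Dp D1)
      then have "{\<omega> \<in> space M. Z \<omega> = z} \<noteq> {}" by (metis measure_empty)
      then show "z \<in> C" using measurable_space[OF C(2)] by auto
    qed
  qed
qed

text \<open>A discrete joint law given through its atoms by a kernel is integrated iteratively.\<close>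

lemma expectation_disintegration:
  fixes F :: "'a \<Rightarrow> 'b \<Rightarrow> real"
  assumes "prob_space M"
    and A: "countable A" "X \<in> measurable M (count_space A)"
    and B: "countable B" "Y \<in> measurable M (count_space B)"
    and \<kappa>: "\<And>x. x \<in> A \<Longrightarrow> set_pmf (\<kappa> x) \<subseteq> B"
    and joint: "\<And>x y. x \<in> A \<Longrightarrow> y \<in> B \<Longrightarrow> measure M {\<omega> \<in> space M. X \<omega> = x \<and> Y \<omega> = y} =
        measure M {\<omega> \<in> space M. X \<omega> = x} * pmf (\<kappa> x) y"
    and F: "\<And>x y. \<bar>F x y\<bar> \<le> c"
  shows "(\<integral>\<omega>. F (X \<omega>) (Y \<omega>) \<partial>M) = (\<integral>\<omega>. measure_pmf.expectation (\<kappa> (X \<omega>)) (F (X \<omega>)) \<partial>M)"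
proof -
  interpret prob_space M by fact
  obtain p where p: "\<And>x. pmf p x = measure M {\<omega> \<in> space M. X \<omega> = x}"
    "\<And>g::_ \<Rightarrow> real. measure_pmf.expectation p g = (\<integral>\<omega>. g (X \<omega>) \<partial>M)" "set_pmf p \<subseteq> A"
    using discrete_law_pmf[OF A] by blast
  have "(\<lambda>\<omega>. (X \<omega>, Y \<omega>)) \<in> measurable M (count_space (A \<times> B))"
    using A B by (subst pair_measure_countable[symmetric]) auto
  note XY = this
  have cAB: "countable (A \<times> B)" using A(1) B(1) by (rule countable_SIGMA)
  obtain q where q: "\<And>z. pmf q z = measure M {\<omega> \<in> space M. (X \<omega>, Y \<omega>) = z}"
    "\<And>g::_ \<Rightarrow> real. measure_pmf.expectation q g = (\<integral>\<omega>. g (X \<omega>, Y \<omega>) \<partial>M)" "set_pmf q \<subseteq> A \<times> B"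
    using discrete_law_pmf[OF cAB XY] by blast
  have "q = bind_pmf p (\<lambda>x. map_pmf (Pair x) (\<kappa> x))"
  proof (rule pmf_eqI)
    fix z :: "'a \<times> 'b"
    obtain x y where z: "z = (x, y)" by (cases z)
    have pm: "pmf (map_pmf (Pair x') (\<kappa> x')) (x, y) = (if x' = x then pmf (\<kappa> x) y else 0)" for x'
    proof (cases "x' = x")
      case True
      have "inj (Pair x)" by (auto simp: inj_def)
      then show ?thesis using True pmf_map_inj'[of "Pair x" "\<kappa> x" y] by simp
    next
      case False
      then have "(x, y) \<notin> set_pmf (map_pmf (Pair x') (\<kappa> x'))" by auto
      then have "pmf (map_pmf (Pair x') (\<kappa> x')) (x, y) = 0" by (simp only: set_pmf_iff not_not)
      then show ?thesis using False by simp
    qed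
    have "pmf (bind_pmf p (\<lambda>x. map_pmf (Pair x) (\<kappa> x))) (x, y) =
        measure_pmf.expectation p (\<lambda>x'. pmf (\<kappa> x) y * indicator {x} x')"
      unfolding pmf_bind pm by (rule Bochner_Integration.integral_cong) (auto simp: indicator_def)
    also have "\<dots> = pmf (\<kappa> x) y * pmf p x"
      by (simp add: pmf.rep_eq)
    also have "\<dots> = pmf q (x, y)"
    proof (cases "x \<in> A \<and> y \<in> B")
      case True
      then show ?thesis using joint[of x y] by (simp add: p q)
    next
      case False
      then have "(x, y) \<notin> set_pmf q" using q(3) by auto
      then have 1: "pmf q (x, y) = 0" by (simp add: set_pmf_iff)
      have "x \<notin> set_pmf p \<or> y \<notin> set_pmf (\<kappa> x)" using False p(3) \<kappa> by blast
      then show ?thesis by (subst 1) (auto simp: set_pmf_iff)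
    qed
    finally show "pmf q z = pmf (bind_pmf p (\<lambda>x. map_pmf (Pair x) (\<kappa> x))) z" by (simp add: z)
  qed
  then have "measure_pmf.expectation q (\<lambda>(x, y). F x y) =
      measure_pmf.expectation p (\<lambda>x. measure_pmf.expectation (map_pmf (Pair x) (\<kappa> x)) (\<lambda>(x, y). F x y))"
    using F by (simp only:) (rule expectation_bind_pmf[where c = c], auto)
  then show ?thesis by (simp add: q p)
qed


section \<open>Counts of a Poisson random measure\<close>

text \<open>On a set of infinite mass \<open>measure\<close> is \<open>0\<close>; for sets of finite intensity this happens with probability \<open>0\<close>.\<close>

definition point_count :: "'e measure \<Rightarrow> 'e set \<Rightarrow> nat" where
  "point_count m E = nat \<lfloor>measure m E\<rfloor>"

text \<open>The Poisson weights add up to \<open>1\<close>, so almost surely the mass is one of the finite values that they charge.\<close>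

lemma poisson_point_count:
  assumes "prob_space M" and prm: "poisson_random_measure M \<nu> R"
    and E: "E \<in> sets \<nu>" "emeasure \<nu> E < \<infinity>"
  shows "AE \<omega> in M. emeasure (R \<omega>) E < \<infinity>"
    and "(\<lambda>\<omega>. point_count (R \<omega>) E) \<in> measurable M (count_space UNIV)"
    and "measure M {\<omega> \<in> space M. point_count (R \<omega>) E = k} = exp (- measure \<nu> E) * measure \<nu> E ^ k / fact k"
proof -
  interpret prob_space M by fact
  define m where "m = measure \<nu> E"
  have meas[measurable]: "(\<lambda>\<omega>. emeasure (R \<omega>) E) \<in> borel_measurable M"
    using prm E unfolding poisson_random_measure_def by blast
  define S where "S k = {\<omega> \<in> space M. emeasure (R \<omega>) E = of_nat k}" for k :: nat
  have S: "S k \<in> sets M" for k unfolding S_def by measurable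
  have PS: "measure M (S k) = exp (- m) * m ^ k / fact k" for k
    using prm E unfolding poisson_random_measure_def S_def m_def by blast
  have "(\<lambda>k. measure M (S k)) sums measure M (\<Union>k. S k)"
  proof (rule finite_measure_UNION)
    show "range S \<subseteq> sets M" using S by auto
    show "disjoint_family S" by (auto simp: disjoint_family_on_def S_def)
  qed
  moreover have "(\<lambda>k. measure M (S k)) sums (exp (- m) * exp m)"
    using sums_mult[OF exp_converges[of m], of "exp (- m)"] by (simp add: PS field_simps)
  ultimately have "measure M (\<Union>k. S k) = exp (- m) * exp m" by (rule sums_unique2)
  then have "measure M (\<Union>k. S k) = 1" by (simp add: exp_minus)
  then have ae: "AE \<omega> in M. \<omega> \<in> (\<Union>k. S k)" by (rule AE_prob_1)
  then show "AE \<omega> in M. emeasure (R \<omega>) E < \<infinity>"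
    by eventually_elim (auto simp: S_def ennreal_of_nat_eq_real_of_nat)
  have "(\<lambda>x::ennreal. nat \<lfloor>enn2real x\<rfloor>) \<in> measurable borel (count_space UNIV)" by measurable
  from measurable_compose[OF meas this]
  show pc: "(\<lambda>\<omega>. point_count (R \<omega>) E) \<in> measurable M (count_space UNIV)"
    by (simp add: point_count_def measure_def)
  have "measure M {\<omega> \<in> space M. point_count (R \<omega>) E = k} = measure M (S k)"
  proof (rule finite_measure_eq_AE)
    show "AE \<omega> in M. (\<omega> \<in> {\<omega> \<in> space M. point_count (R \<omega>) E = k}) = (\<omega> \<in> S k)"
      using ae by eventually_elim (auto simp: S_def point_count_def measure_def)
    show "{\<omega> \<in> space M. point_count (R \<omega>) E = k} \<in> sets M"
      using measurable_sets[OF pc, of "{k}"] by (simp add: vimage_def Int_def conj_commute)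
  qed (rule S)
  then show "measure M {\<omega> \<in> space M. point_count (R \<omega>) E = k} = exp (- measure \<nu> E) * measure \<nu> E ^ k / fact k"
    by (simp add: PS m_def)
qed

lemma one_minus_le_exp: "1 - (m::real) \<le> exp (- m)"
  using exp_ge_add_one_self[of "- m"] by simp

lemma poisson_tail:
  assumes "prob_space M" and prm: "poisson_random_measure M \<nu> R"
    and E: "E \<in> sets \<nu>" "emeasure \<nu> E < \<infinity>"
  shows "measure M {\<omega> \<in> space M. point_count (R \<omega>) E \<ge> 1} \<le> measure \<nu> E"
    and "measure M {\<omega> \<in> space M. point_count (R \<omega>) E \<ge> 2} \<le> (measure \<nu> E)\<^sup>2"
proof -
  interpret prob_space M by fact
  define m where "m = measure \<nu> E"
  have m: "m \<ge> 0" by (simp add: m_def)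
  note pc[measurable] = poisson_point_count(2)[OF assms]
  have P: "measure M {\<omega> \<in> space M. point_count (R \<omega>) E = k} = exp (- m) * m ^ k / fact k" for k
    using poisson_point_count(3)[OF assms] by (simp add: m_def)
  have "measure M {\<omega> \<in> space M. point_count (R \<omega>) E \<ge> 1} = 1 - measure M {\<omega> \<in> space M. \<not> point_count (R \<omega>) E \<ge> 1}"
    by (subst prob_neg) auto
  also have "{\<omega> \<in> space M. \<not> point_count (R \<omega>) E \<ge> 1} = {\<omega> \<in> space M. point_count (R \<omega>) E = 0}" by auto
  finally show "measure M {\<omega> \<in> space M. point_count (R \<omega>) E \<ge> 1} \<le> measure \<nu> E"
    using one_minus_le_exp[of m] P[of 0] by (simp add: m_def)
  have "measure M {\<omega> \<in> space M. point_count (R \<omega>) E \<ge> 2} = 1 - measure M {\<omega> \<in> space M. \<not> point_count (R \<omega>) E \<ge> 2}"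
    by (subst prob_neg) auto
  also have "{\<omega> \<in> space M. \<not> point_count (R \<omega>) E \<ge> 2} =
      {\<omega> \<in> space M. point_count (R \<omega>) E = 0} \<union> {\<omega> \<in> space M. point_count (R \<omega>) E = 1}" by auto
  also have "measure M \<dots> = exp (- m) + exp (- m) * m"
    using P[of 0] P[of 1] by (subst finite_measure_Union) auto
  also have "1 - (exp (- m) + exp (- m) * m) \<le> m\<^sup>2"
  proof -
    have "(1 - m) * (1 + m) \<le> exp (- m) * (1 + m)" using one_minus_le_exp m by (intro mult_right_mono) auto
    then show ?thesis by (simp add: algebra_simps power2_eq_square)
  qed
  finally show "measure M {\<omega> \<in> space M. point_count (R \<omega>) E \<ge> 2} \<le> (measure \<nu> E)\<^sup>2" by (simp add: m_def)
qed

lemma sets_halfline_intensity: "sets (halfline_intensity lam) = sets borel"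
  by (simp add: halfline_intensity_def)

lemma sets_quadrant_intensity: "sets quadrant_intensity = sets borel"
  by (simp add: quadrant_intensity_def)

lemma halfline_intensity_interval:
  assumes "0 \<le> s" "s \<le> t" "0 \<le> lam"
  shows "emeasure (halfline_intensity lam) {s<..t} = ennreal (lam * (t - s))"
proof -
  have "emeasure (halfline_intensity lam) {s<..t} = (\<integral>\<^sup>+x. ennreal lam * indicator {s<..t} x \<partial>lborel)"
    unfolding halfline_intensity_def
    using assms by (subst emeasure_density) (auto intro!: nn_integral_cong simp: indicator_def)
  also have "\<dots> = ennreal lam * ennreal (t - s)" using assms by (simp add: nn_integral_cmult)
  finally show ?thesis using assms by (simp add: ennreal_mult)
qed

lemma rectangle_borel: "{a..b::real} \<times> {s<..t::real} \<in> sets borel"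
  by (rule borel_Times) auto

lemma quadrant_intensity_rectangle:
  assumes "0 \<le> s" "s \<le> t" "0 \<le> a" "a \<le> b"
  shows "emeasure quadrant_intensity ({a..b} \<times> {s<..t}) = ennreal ((b - a) * (t - s))"
proof -
  have q: "{0::real..} \<times> {0::real..} \<in> sets borel" by (rule borel_Times) auto
  have sub: "{a..b} \<times> {s<..t} \<subseteq> {0..} \<times> {0..}" using assms by auto
  have "emeasure quadrant_intensity ({a..b} \<times> {s<..t}) =
      (\<integral>\<^sup>+x. indicator ({0..} \<times> {0..}) x * indicator ({a..b} \<times> {s<..t}) x \<partial>lborel)"
    unfolding quadrant_intensity_def
    using rectangle_borel q by (intro emeasure_density) auto
  also have "\<dots> = (\<integral>\<^sup>+x. indicator ({a..b} \<times> {s<..t}) x \<partial>lborel)"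
    by (simp only: indicator_inter_arith[symmetric] Int_absorb1[OF sub])
  also have "\<dots> = emeasure (lborel \<Otimes>\<^sub>M lborel) ({a..b} \<times> {s<..t})"
    using rectangle_borel by (simp add: lborel_prod)
  also have "\<dots> = emeasure lborel {a..b} * emeasure lborel {s<..t}"
    by (rule lborel.emeasure_pair_measure_Times) auto
  also have "\<dots> = ennreal (b - a) * ennreal (t - s)" using assms by simp
  finally show ?thesis using assms by (simp add: ennreal_mult)
qed

text \<open>The last grid point strictly before \<open>z\<close>.\<close>

lemma grid_before_tendsto_left:
  "filterlim (\<lambda>n. (of_int \<lceil>real (Suc n) * z\<rceil> - 1) / real (Suc n)) (at_left z) sequentially"
proof (rule tendsto_imp_filterlim_at_left)
  have lt: "(of_int \<lceil>real (Suc n) * z\<rceil> - 1) / real (Suc n) < z" for n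
  proof -
    have "of_int \<lceil>real (Suc n) * z\<rceil> - 1 < real (Suc n) * z" by linarith
    then show ?thesis by (simp add: field_simps del: of_nat_Suc)
  qed
  have ge: "z - 1 / real (Suc n) \<le> (of_int \<lceil>real (Suc n) * z\<rceil> - 1) / real (Suc n)" for n
  proof -
    have "real (Suc n) * z \<le> of_int \<lceil>real (Suc n) * z\<rceil>" by linarith
    then show ?thesis by (simp add: field_simps del: of_nat_Suc)
  qed
  show "\<forall>\<^sub>F n in sequentially. (of_int \<lceil>real (Suc n) * z\<rceil> - 1) / real (Suc n) < z" using lt by simp
  have "(\<lambda>n. 1 / real (Suc n)) \<longlonglongrightarrow> 0" by (rule LIMSEQ_Suc[OF lim_1_over_n])
  then have "(\<lambda>n. z - 1 / real (Suc n)) \<longlonglongrightarrow> z - 0" by (intro tendsto_intros)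
  then have "(\<lambda>n. z - 1 / real (Suc n)) \<longlonglongrightarrow> z" by simp
  then show "(\<lambda>n. (of_int \<lceil>real (Suc n) * z\<rceil> - 1) / real (Suc n)) \<longlonglongrightarrow> z"
    by (rule tendsto_sandwich[rotated 2, OF _ tendsto_const]) (use ge less_imp_le[OF lt] in \<open>simp_all del: of_nat_Suc\<close>)
qed

text \<open>A left limit is the limit of the values at the last grid points before \<open>z\<close>, which are step functions of \<open>z\<close>.
  The value \<open>0\<close> is set where no left limit is available.\<close>

lemma borel_measurable_left_limit:
  fixes f g :: "real \<Rightarrow> real"
  assumes "\<And>z. z > 0 \<Longrightarrow> (f \<longlongrightarrow> g z) (at_left z)"
  shows "(\<lambda>z. if z > 0 then g z else 0) \<in> borel_measurable borel"
proof (rule borel_measurable_LIMSEQ_real)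
  define f' where "f' n z = (if z > 0 then f ((of_int \<lceil>real (Suc n) * z\<rceil> - 1) / real (Suc n)) else 0)" for n z
  show "(\<lambda>n. f' n z) \<longlonglongrightarrow> (if z > 0 then g z else 0)" for z
    using filterlim_compose[OF assms grid_before_tendsto_left] by (auto simp: f'_def)
  have "(\<lambda>z. f ((of_int \<lceil>real (Suc n) * z\<rceil> - 1) / real (Suc n))) \<in> borel_measurable borel" for n
    by (rule measurable_compose[of "\<lambda>z. \<lceil>real (Suc n) * z\<rceil>" borel "count_space UNIV"
          "\<lambda>k. f ((of_int k - 1) / real (Suc n))"]) measurable
  then show "f' n \<in> borel_measurable borel" for n
    unfolding f'_def by measurable
qed

text \<open>Transition operator of a birth-death chain; truncated subtraction keeps an empty queue at \<open>0\<close> when a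
  departure is due.\<close>

definition birth_death_step :: "real \<Rightarrow> real \<Rightarrow> (nat \<Rightarrow> real) \<Rightarrow> nat \<Rightarrow> real" where
  "birth_death_step a b g x = (1 - a - b) * g x + a * g (x + 1) + b * g (x - 1)"

lemma expectation_pmf_finite_part:
  fixes G :: "'c \<Rightarrow> real"
  assumes F: "finite F" and G: "\<And>z. \<bar>G z\<bar> \<le> 1"
  shows "\<bar>measure_pmf.expectation p G - (\<Sum>z\<in>F. pmf p z * G z)\<bar> \<le> 1 - (\<Sum>z\<in>F. pmf p z)"
proof -
  have int: "integrable (measure_pmf p) f" if "\<And>z. \<bar>f z\<bar> \<le> 1" for f :: "'c \<Rightarrow> real"
    by (rule measure_pmf.integrable_const_bound[where B = 1]) (use that in auto)
  have "measure_pmf.expectation p (\<lambda>z. G z * indicator F z) = (\<Sum>z\<in>F. G z * indicator F z * pmf p z)"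
    by (rule integral_measure_pmf_real[OF F]) (auto simp: indicator_def split: if_splits)
  then have 1: "measure_pmf.expectation p (\<lambda>z. G z * indicator F z) = (\<Sum>z\<in>F. pmf p z * G z)"
    by (simp add: mult.commute)
  have 2: "measure_pmf.expectation p (\<lambda>z. 1 - indicator F z) = 1 - (\<Sum>z\<in>F. pmf p z)"
    using measure_pmf.prob_space measure_measure_pmf_finite[OF F, of p]
    by (subst Bochner_Integration.integral_diff) (auto intro: int)
  have "measure_pmf.expectation p G - measure_pmf.expectation p (\<lambda>z. G z * indicator F z) =
      measure_pmf.expectation p (\<lambda>z. G z - G z * indicator F z)"
    by (rule Bochner_Integration.integral_diff[symmetric]) (auto intro!: int simp: G indicator_def)
  also have "\<bar>\<dots>\<bar> \<le> measure_pmf.expectation p (\<lambda>z. \<bar>G z - G z * indicator F z\<bar>)" by (rule integral_abs_bound)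
  also have "\<dots> \<le> measure_pmf.expectation p (\<lambda>z. 1 - indicator F z)"
    by (rule integral_mono) (auto intro!: int simp: G indicator_def)
  finally show ?thesis by (simp add: 1 2)
qed

text \<open>Independent Poisson counts with small means \<open>a\<close> and \<open>b\<close> show one birth, one death or neither, up to an event of
  probability \<open>O((a + b)\<^sup>2)\<close>.\<close>

lemma poisson_pair_step:
  fixes G :: "nat \<times> nat \<Rightarrow> real"
  assumes a: "0 < a" and b: "0 < b" and G: "\<And>z. \<bar>G z\<bar> \<le> 1"
  shows "\<bar>measure_pmf.expectation (pair_pmf (poisson_pmf a) (poisson_pmf b)) G -
    ((1 - a - b) * G (0, 0) + a * G (1, 0) + b * G (0, 1))\<bar> \<le> 3 * (a + b)\<^sup>2"
proof -
  define s where "s = a + b"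
  define e where "e = exp (- s)"
  have s: "s > 0" using a b by (simp add: s_def)
  let ?p = "pair_pmf (poisson_pmf a) (poisson_pmf b)"
  let ?F = "{(0, 0), (1, 0), (0, 1)} :: (nat \<times> nat) set"
  have p: "pmf ?p (0, 0) = e" "pmf ?p (1, 0) = e * a" "pmf ?p (0, 1) = e * b"
    "pmf ?p (Suc 0, 0) = e * a" "pmf ?p (0, Suc 0) = e * b"
    using a b by (simp_all add: pmf_pair e_def s_def exp_add exp_diff exp_minus field_simps)
  have "\<bar>measure_pmf.expectation ?p G - (\<Sum>z\<in>?F. pmf ?p z * G z)\<bar> \<le> 1 - (\<Sum>z\<in>?F. pmf ?p z)"
    by (rule expectation_pmf_finite_part[OF _ G]) simp
  then have 1: "\<bar>measure_pmf.expectation ?p G - (e * G (0, 0) + e * a * G (1, 0) + e * b * G (0, 1))\<bar> \<le> 1 - e * (1 + s)"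
    by (simp add: p s_def algebra_simps)
  have e: "1 - s \<le> e" "e \<le> 1" using one_minus_le_exp[of s] s by (simp_all add: e_def)
  \<comment> \<open>From \<open>exp s \<ge> 1 + s\<close> and \<open>(1 + s) (1 - s + s\<^sup>2) = 1 + s^3\<close>.\<close>
  have e2: "e \<le> 1 - s + s\<^sup>2"
  proof -
    have "1 + s \<le> exp s" by (rule exp_ge_add_one_self)
    then have "e * (1 + s) \<le> 1" using s by (simp add: e_def exp_minus field_simps)
    also have "1 \<le> (1 - s + s\<^sup>2) * (1 + s)"
      using s by (simp add: algebra_simps power2_eq_square)
    finally show ?thesis using s by simp
  qed
  have "(1 - s) * (1 + s) \<le> e * (1 + s)" using e s by (intro mult_right_mono) auto
  then have 2: "1 - e * (1 + s) \<le> s\<^sup>2" by (simp add: algebra_simps power2_eq_square)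
  have "\<bar>(e - (1 - s)) * G (0, 0)\<bar> \<le> s\<^sup>2 * 1"
    unfolding abs_mult using G e e2 by (intro mult_mono) auto
  moreover have "\<bar>(e - 1) * a * G (1, 0)\<bar> \<le> s * a * 1"
    unfolding abs_mult using G e a s by (intro mult_mono) auto
  moreover have "\<bar>(e - 1) * b * G (0, 1)\<bar> \<le> s * b * 1"
    unfolding abs_mult using G e b s by (intro mult_mono) auto
  moreover have "s * a + s * b = s\<^sup>2" by (simp add: s_def power2_eq_square algebra_simps)
  moreover have "(e * G (0, 0) + e * a * G (1, 0) + e * b * G (0, 1)) - ((1 - a - b) * G (0, 0) + a * G (1, 0) + b * G (0, 1))
     = (e - (1 - s)) * G (0, 0) + (e - 1) * a * G (1, 0) + (e - 1) * b * G (0, 1)"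
    by (simp add: s_def algebra_simps)
  ultimately show ?thesis using 1 2 unfolding s_def[symmetric] by (simp only: abs_le_iff) linarith
qed


section \<open>A queue driven by Poisson points\<close>

lemma halfline_intensity_initial_interval:
  assumes "0 \<le> t" "0 \<le> lam"
  shows "emeasure (halfline_intensity lam) {0..t} = ennreal (lam * t)"
proof -
  have "emeasure (halfline_intensity lam) {0..t} = (\<integral>\<^sup>+x. ennreal lam * indicator {0..t} x \<partial>lborel)"
    unfolding halfline_intensity_def
    using assms by (subst emeasure_density) (auto intro!: nn_integral_cong simp: indicator_def)
  also have "\<dots> = ennreal lam * ennreal t" using assms by (simp add: nn_integral_cmult)
  finally show ?thesis using assms by (simp add: ennreal_mult)
qed

lemma measure_eq_point_count:
  assumes "emeasure m E = ennreal_of_enat k" "emeasure m E < \<infinity>"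
  shows "measure m E = real (point_count m E)"
proof -
  obtain n where "k = enat n" using assms by (cases k) auto
  then have "emeasure m E = ennreal (real n)" using assms by (simp add: ennreal_of_nat_eq_real_of_nat)
  then have "measure m E = real n" by (simp add: measure_def)
  then show ?thesis by (simp add: point_count_def)
qed

lemma cadlag_left_limit:
  assumes "cadlag_on {0..} x" "z > 0"
  shows "\<exists>l. (x \<longlongrightarrow> l) (at_left z)"
proof -
  obtain l where "(x \<longlongrightarrow> l) (at z within {0..} \<inter> {..z})"
    using assms unfolding cadlag_on_def by force
  moreover have "at z within {0..} \<inter> {..z} = at_left z"
  proof (rule at_within_nhd[of z "{0<..}"])
    show "({0..} \<inter> {..z}) \<inter> {0<..} - {z} = {..<z} \<inter> {0<..} - {z}" by auto
  qed (use assms in auto)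
  ultimately show ?thesis by auto
qed

text \<open>One queue \<open>X\<close> whose departures are thinned from a Poisson measure by the deterministic rate \<open>mu\<close>. The last
  assumption is the independence of initial value, arrivals and departures, on products of events.\<close>

locale queue_equation = prob_space M for M :: "'w measure" +
  fixes A :: "'w \<Rightarrow> real measure" and D :: "'w \<Rightarrow> (real \<times> real) measure"
    and X :: "real \<Rightarrow> 'w \<Rightarrow> nat" and lam B :: real and mu :: "real \<Rightarrow> real"
  assumes lam_pos: "0 < lam" and B_pos: "0 < B"
    and prm_A: "poisson_random_measure M (halfline_intensity lam) A"
    and prm_D: "poisson_random_measure M quadrant_intensity D"
    and X_meas: "\<And>t. t \<ge> 0 \<Longrightarrow> X t \<in> measurable M (count_space UNIV)"
    and X_cadlag: "\<And>\<omega>. \<omega> \<in> space M \<Longrightarrow> cadlag_on {0..} (\<lambda>t. X t \<omega>)"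
    and mu_bounds: "\<And>z. z \<ge> 0 \<Longrightarrow> 0 < mu z \<and> mu z \<le> B"
    and mu_left: "\<And>z. z > 0 \<Longrightarrow> \<exists>l. (mu \<longlongrightarrow> l) (at_left z)"
    and equation: "AE \<omega> in M. \<forall>t\<ge>0. real (X t \<omega>) = real (X 0 \<omega>) + measure (A \<omega>) {0..t} -
          (\<integral>(u, z). indicator ({0..} \<times> {0<..t}) (u, z) *
                    of_bool (Lim (at_left z) (\<lambda>s. X s \<omega>) > 0) *
                    of_bool (u \<le> Lim (at_left z) mu) \<partial>(D \<omega>))"
    and independent: "\<And>S V W. V \<in> random_measure_events M (halfline_intensity lam) A \<Longrightarrow>
          W \<in> random_measure_events M quadrant_intensity D \<Longrightarrow>
          prob ((X 0 -` S \<inter> space M) \<inter> V \<inter> W) = prob (X 0 -` S \<inter> space M) * prob V * prob W"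
begin

definition muL :: "real \<Rightarrow> real" where "muL z = Lim (at_left z) mu"
definition XL :: "'w \<Rightarrow> real \<Rightarrow> nat" where "XL \<omega> z = Lim (at_left z) (\<lambda>s. X s \<omega>)"
text \<open>All points that can cause a departure in \<open>(s, t]\<close>, whatever the rate.\<close>

definition strip :: "real \<Rightarrow> real \<Rightarrow> (real \<times> real) set" where "strip s t = {0..B} \<times> {s<..t}"
definition served :: "'w \<Rightarrow> real \<Rightarrow> real \<Rightarrow> (real \<times> real) set" where
  "served \<omega> s t = {(u, z). 0 \<le> u \<and> u \<le> muL z \<and> s < z \<and> z \<le> t \<and> XL \<omega> z > 0}"

definition regular :: "'w \<Rightarrow> bool" where
  "regular \<omega> \<longleftrightarrow> \<omega> \<in> space M \<and> (\<forall>n::nat. emeasure (A \<omega>) {0..real n} < \<infinity>) \<and>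
     (\<forall>n::nat. emeasure (D \<omega>) (strip 0 (real n)) < \<infinity>) \<and>
     (\<forall>t\<ge>0. real (X t \<omega>) = real (X 0 \<omega>) + measure (A \<omega>) {0..t} -
          (\<integral>(u, z). indicator ({0..} \<times> {0<..t}) (u, z) *
                    of_bool (Lim (at_left z) (\<lambda>s. X s \<omega>) > 0) *
                    of_bool (u \<le> Lim (at_left z) mu) \<partial>(D \<omega>)))"

text \<open>Outside one null set all counts on bounded time intervals are finite and the equation holds. On the remaining
  event the analysis of the paths is deterministic.\<close>

lemma AE_regular: "AE \<omega> in M. regular \<omega>"
proof -
  have "AE \<omega> in M. \<forall>n::nat. emeasure (A \<omega>) {0..real n} < \<infinity>"
    unfolding AE_all_countable
    by (intro allI poisson_point_count(1)[OF prob_space_axioms prm_A])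
       (use lam_pos in \<open>auto simp: sets_halfline_intensity halfline_intensity_initial_interval\<close>)
  moreover have "AE \<omega> in M. \<forall>n::nat. emeasure (D \<omega>) (strip 0 (real n)) < \<infinity>"
    unfolding AE_all_countable strip_def
    by (intro allI poisson_point_count(1)[OF prob_space_axioms prm_D])
       (use B_pos in \<open>auto simp: sets_quadrant_intensity rectangle_borel quadrant_intensity_rectangle\<close>)
  ultimately show ?thesis using equation AE_space unfolding regular_def
    by eventually_elim blast
qed

lemma XL_tendsto:
  assumes "\<omega> \<in> space M" "z > 0"
  shows "\<forall>\<^sub>F s in at_left z. X s \<omega> = XL \<omega> z"
proof -
  obtain l where l: "((\<lambda>t. X t \<omega>) \<longlongrightarrow> l) (at_left z)"
    using cadlag_left_limit[OF X_cadlag[OF assms(1)] assms(2)] by (elim exE) (rule that)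
  then have "XL \<omega> z = l" unfolding XL_def by (intro tendsto_Lim) simp
  then show ?thesis using l by (simp add: tendsto_discrete)
qed

lemma muL_tendsto: "z > 0 \<Longrightarrow> (mu \<longlongrightarrow> muL z) (at_left z)"
  using mu_left[of z] unfolding muL_def by (auto simp: tendsto_Lim)

lemma eventually_at_left_nonneg: "z > 0 \<Longrightarrow> \<forall>\<^sub>F s in at_left z. (s::real) \<ge> 0"
  unfolding eventually_at_left_field by (intro exI[of _ 0]) auto

lemma muL_bounds:
  assumes "z > 0"
  shows "0 \<le> muL z" "muL z \<le> B"
proof -
  show "0 \<le> muL z"
    by (rule tendsto_lowerbound[OF muL_tendsto[OF assms]])
       (use eventually_at_left_nonneg[OF assms] mu_bounds in \<open>auto elim!: eventually_mono intro: less_imp_le\<close>)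
  show "muL z \<le> B"
    by (rule tendsto_upperbound[OF muL_tendsto[OF assms]])
       (use eventually_at_left_nonneg[OF assms] mu_bounds in \<open>auto elim!: eventually_mono\<close>)
qed

text \<open>The integral in the equation is \<open>0\<close> by convention for integrands that are not measurable, so this is what
  allows it to be read as a count of served points.\<close>

lemma served_borel:
  assumes "\<omega> \<in> space M" "s \<ge> 0"
  shows "served \<omega> s t \<in> sets borel"
proof -
  have 1[measurable]: "(\<lambda>z. if z > 0 then muL z else 0) \<in> borel_measurable borel"
    by (rule borel_measurable_left_limit[OF muL_tendsto])
  have "((\<lambda>s. of_bool (X s \<omega> > 0) :: real) \<longlongrightarrow> of_bool (XL \<omega> z > 0)) (at_left z)" if "z > 0" for z
    by (rule tendsto_eventually) (use XL_tendsto[OF assms(1) that] in \<open>auto elim: eventually_mono\<close>)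
  then have 2[measurable]: "(\<lambda>z. if z > 0 then of_bool (XL \<omega> z > 0) else 0 :: real) \<in> borel_measurable borel"
    by (rule borel_measurable_left_limit)
  have "{p \<in> space (borel \<Otimes>\<^sub>M borel). 0 \<le> fst p \<and> fst p \<le> (if snd p > 0 then muL (snd p) else 0) \<and> s < snd p \<and> snd p \<le> t \<and>
      (if snd p > 0 then of_bool (XL \<omega> (snd p) > 0) else 0 :: real) > 0} \<in> sets (borel \<Otimes>\<^sub>M borel)"
    by measurable
  also have "{p \<in> space (borel \<Otimes>\<^sub>M borel). 0 \<le> fst p \<and> fst p \<le> (if snd p > 0 then muL (snd p) else 0) \<and> s < snd p \<and> snd p \<le>
      t \<and>
      (if snd p > 0 then of_bool (XL \<omega> (snd p) > 0) else 0 :: real) > 0} = served \<omega> s t"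
    using assms by (auto simp: served_def space_pair_measure)
  finally show ?thesis unfolding borel_prod .
qed

lemma served_subset_strip: "s \<ge> 0 \<Longrightarrow> served \<omega> s t \<subseteq> strip s t"
proof
  fix p assume s: "s \<ge> 0" and p: "p \<in> served \<omega> s t"
  obtain u z where uz: "p = (u, z)" by (cases p)
  have *: "0 \<le> u" "u \<le> muL z" "s < z" "z \<le> t" using p by (simp_all add: uz served_def)
  then have "muL z \<le> B" using s by (intro muL_bounds) simp
  then show "p \<in> strip s t" using * by (simp add: uz strip_def)
qed

lemma D_count:
  assumes "regular \<omega>" and E: "E \<in> sets borel" "E \<subseteq> strip s t" "0 \<le> s"
  shows "emeasure (D \<omega>) E < \<infinity>" "measure (D \<omega>) E = real (point_count (D \<omega>) E)"
proof -
  have \<omega>: "\<omega> \<in> space M" using assms(1) by (simp add: regular_def)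
  have sets: "sets (D \<omega>) = sets borel" and ex: "\<exists>k. emeasure (D \<omega>) E = ennreal_of_enat k"
    using prm_D \<omega> E(1) unfolding poisson_random_measure_def by (auto simp: sets_quadrant_intensity)
  obtain n :: nat where n: "t \<le> real n" using real_arch_simple by blast
  have "strip s t \<subseteq> strip 0 (real n)" unfolding strip_def
    by (intro Sigma_mono subset_refl) (use E n in \<open>auto simp: subset_eq\<close>)
  then have "E \<subseteq> strip 0 (real n)" using E by blast
  moreover have "strip 0 (real n) \<in> sets (D \<omega>)" by (simp add: strip_def sets rectangle_borel)
  ultimately have "emeasure (D \<omega>) E \<le> emeasure (D \<omega>) (strip 0 (real n))" by (rule emeasure_mono)
  then show fin: "emeasure (D \<omega>) E < \<infinity>" using assms(1) by (auto simp: regular_def intro: le_less_trans)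
  show "measure (D \<omega>) E = real (point_count (D \<omega>) E)" using ex measure_eq_point_count fin by blast
qed

lemma D_count_Un:
  assumes "regular \<omega>" and E: "E \<in> sets borel" "E \<subseteq> strip s t" "0 \<le> s"
    and F: "F \<in> sets borel" "F \<subseteq> strip s t"
  shows "point_count (D \<omega>) (E \<union> F) \<le> point_count (D \<omega>) E + point_count (D \<omega>) F"
    and "E \<subseteq> F \<Longrightarrow> point_count (D \<omega>) E \<le> point_count (D \<omega>) F"
    and "E \<inter> F = {} \<Longrightarrow> point_count (D \<omega>) (E \<union> F) = point_count (D \<omega>) E + point_count (D \<omega>) F"
proof -
  have \<omega>: "\<omega> \<in> space M" using assms(1) by (simp add: regular_def)
  have sets: "sets (D \<omega>) = sets borel"
    using prm_D \<omega> unfolding poisson_random_measure_def by (auto simp: sets_quadrant_intensity)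
  note cE = D_count[OF assms(1) E] and cF = D_count[OF assms(1) F E(3)]
    and cEF = D_count[OF assms(1) sets.Un[OF E(1) F(1)] Un_least[OF E(2) F(2)] E(3)]
  have m: "E \<in> sets (D \<omega>)" "F \<in> sets (D \<omega>)" using E F sets by auto
  have fm: "E \<in> fmeasurable (D \<omega>)" "F \<in> fmeasurable (D \<omega>)" using m cE(1) cF(1) by (auto simp: fmeasurable_def)
  have "measure (D \<omega>) (E \<union> F) \<le> measure (D \<omega>) E + measure (D \<omega>) F"
    using m by (rule measure_Un_le)
  then show "point_count (D \<omega>) (E \<union> F) \<le> point_count (D \<omega>) E + point_count (D \<omega>) F"
    using cE cF cEF by simp
  show "point_count (D \<omega>) E \<le> point_count (D \<omega>) F" if "E \<subseteq> F"
  proof -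
    have "measure (D \<omega>) E \<le> measure (D \<omega>) F" by (rule measure_mono_fmeasurable[OF that m(1) fm(2)])
    then show ?thesis using cE cF by simp
  qed
  show "point_count (D \<omega>) (E \<union> F) = point_count (D \<omega>) E + point_count (D \<omega>) F" if "E \<inter> F = {}"
  proof -
    have "measure (D \<omega>) (E \<union> F) = measure (D \<omega>) E + measure (D \<omega>) F"
      using m cE(1) cF(1) that by (intro measure_Union) auto
    then show ?thesis using cE cF cEF by simp
  qed
qed

lemma A_count:
  assumes "regular \<omega>" "0 \<le> s" "s \<le> t"
  shows "measure (A \<omega>) {0..t} = measure (A \<omega>) {0..s} + real (point_count (A \<omega>) {s<..t})"
    and "w \<le> t \<Longrightarrow> s \<le> w \<Longrightarrow> point_count (A \<omega>) {s<..w} \<le> point_count (A \<omega>) {s<..t}"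
proof -
  have \<omega>: "\<omega> \<in> space M" using assms(1) by (simp add: regular_def)
  have sets: "sets (A \<omega>) = sets borel" and ex: "\<exists>k. emeasure (A \<omega>) E = ennreal_of_enat k" if "E \<in> sets borel" for E
    using prm_A \<omega> that unfolding poisson_random_measure_def by (auto simp: sets_halfline_intensity)
  have sets: "sets (A \<omega>) = sets borel" using sets by blast
  obtain n :: nat where n: "t \<le> real n" using real_arch_simple by blast
  have fin: "emeasure (A \<omega>) E < \<infinity>" if "E \<subseteq> {0..t}" for E
  proof -
    have "emeasure (A \<omega>) E \<le> emeasure (A \<omega>) {0..real n}"
      by (rule emeasure_mono) (use that n sets in auto)
    then show ?thesis using assms(1) by (auto simp: regular_def intro: le_less_trans)
  qed
  have cnt: "measure (A \<omega>) {s<..w} = real (point_count (A \<omega>) {s<..w})" if "w \<le> t" for w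
  proof -
    have "emeasure (A \<omega>) {s<..w} < \<infinity>" by (rule fin) (use that assms in force)
    moreover obtain k where "emeasure (A \<omega>) {s<..w} = ennreal_of_enat k" using ex[of "{s<..w}"] by auto
    ultimately show ?thesis by (intro measure_eq_point_count)
  qed
  have finS: "emeasure (A \<omega>) {0..s} < \<infinity>" and finI: "emeasure (A \<omega>) {s<..t} < \<infinity>"
    by (rule fin, use assms in force)+
  have "measure (A \<omega>) ({0..s} \<union> {s<..t}) = measure (A \<omega>) {0..s} + measure (A \<omega>) {s<..t}"
    using finS finI sets by (intro measure_Union) auto
  moreover have "{0..s} \<union> {s<..t} = {0..t}" using assms by auto
  ultimately show "measure (A \<omega>) {0..t} = measure (A \<omega>) {0..s} + real (point_count (A \<omega>) {s<..t})"
    using cnt[of t] by simp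
  show "point_count (A \<omega>) {s<..w} \<le> point_count (A \<omega>) {s<..t}" if "w \<le> t" "s \<le> w"
  proof -
    have "measure (A \<omega>) {s<..w} \<le> measure (A \<omega>) {s<..t}"
      by (rule measure_mono_fmeasurable)
         (use finI that sets in \<open>auto simp: fmeasurable_def\<close>)
    then show ?thesis using cnt[of w] cnt[of t] that by simp
  qed
qed

text \<open>Stated for natural numbers, so that the analysis of cells with at most one point is a case distinction.\<close>

lemma increment:
  assumes "regular \<omega>" "0 \<le> s" "s \<le> t"
  shows "X t \<omega> + point_count (D \<omega>) (served \<omega> s t) = X s \<omega> + point_count (A \<omega>) {s<..t}"
proof -
  have \<omega>: "\<omega> \<in> space M" using assms(1) by (simp add: regular_def)
  have sets: "sets (D \<omega>) = sets borel"
    using prm_D \<omega> unfolding poisson_random_measure_def by (auto simp: sets_quadrant_intensity)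
  have X0: "real (X t \<omega>) = real (X 0 \<omega>) + measure (A \<omega>) {0..t} - real (point_count (D \<omega>) (served \<omega> 0 t))"
    if "t \<ge> 0" for t
  proof -
    have fn: "(\<lambda>p. case p of (u, z) \<Rightarrow> indicator ({0..} \<times> {0<..t}) (u, z) *
                    of_bool (Lim (at_left z) (\<lambda>s. X s \<omega>) > 0) *
                    of_bool (u \<le> Lim (at_left z) mu)) = (indicator (served \<omega> 0 t) :: _ \<Rightarrow> real)"
      by (rule ext) (auto simp: served_def indicator_def XL_def muL_def)
    have sp: "space (D \<omega>) = UNIV" using sets_eq_imp_space_eq[OF sets] by simp
    have cnt: "measure (D \<omega>) (served \<omega> 0 t) = real (point_count (D \<omega>) (served \<omega> 0 t))"
      by (rule D_count(2)[OF assms(1) served_borel[OF \<omega>] served_subset_strip]) simp_all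
    have "real (X t \<omega>) = real (X 0 \<omega>) + measure (A \<omega>) {0..t} -
          (\<integral>(u, z). indicator ({0..} \<times> {0<..t}) (u, z) *
                    of_bool (Lim (at_left z) (\<lambda>s. X s \<omega>) > 0) *
                    of_bool (u \<le> Lim (at_left z) mu) \<partial>(D \<omega>))"
      using assms(1) that unfolding regular_def by blast
    then show ?thesis by (simp only: fn Bochner_Integration.integral_indicator sp Int_UNIV_right cnt)
  qed
  have "served \<omega> 0 t = served \<omega> 0 s \<union> served \<omega> s t" "served \<omega> 0 s \<inter> served \<omega> s t = {}"
    using assms by (auto simp: served_def)
  moreover have "served \<omega> 0 s \<subseteq> strip 0 t" "served \<omega> s t \<subseteq> strip 0 t"
    using served_subset_strip[of 0 \<omega> s] served_subset_strip[of s \<omega> t] assms by (auto simp: strip_def)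
  ultimately have "point_count (D \<omega>) (served \<omega> 0 t) = point_count (D \<omega>) (served \<omega> 0 s) + point_count (D \<omega>) (served \<omega> s t)"
    using D_count_Un(3)[OF assms(1) served_borel[OF \<omega>] _ _ served_borel[OF \<omega>]] assms by simp
  then have "real (X t \<omega> + point_count (D \<omega>) (served \<omega> s t)) = real (X s \<omega> + point_count (A \<omega>) {s<..t})"
    using X0[of t] X0[of s] assms A_count(1)[OF assms] by simp
  then show ?thesis by (simp only: of_nat_eq_iff)
qed

lemma strip_borel: "strip s t \<in> sets borel"
  by (simp add: strip_def rectangle_borel)

lemma A_count_measurable:
  assumes "0 \<le> s" "s \<le> t"
  shows "(\<lambda>\<omega>. point_count (A \<omega>) {s<..t}) \<in> measurable M (count_space UNIV)"
  by (rule poisson_point_count(2)[OF prob_space_axioms prm_A])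
     (use assms lam_pos in \<open>auto simp: sets_halfline_intensity halfline_intensity_interval\<close>)

lemma D_count_measurable:
  assumes "0 \<le> s" "s \<le> t" "0 \<le> a" "a \<le> b"
  shows "(\<lambda>\<omega>. point_count (D \<omega>) ({a..b} \<times> {s<..t})) \<in> measurable M (count_space UNIV)"
  by (rule poisson_point_count(2)[OF prob_space_axioms prm_D])
     (use assms in \<open>auto simp: sets_quadrant_intensity quadrant_intensity_rectangle rectangle_borel\<close>)

lemma A_tail:
  assumes "0 \<le> s" "s \<le> t"
  shows "prob {\<omega> \<in> space M. point_count (A \<omega>) {s<..t} \<ge> 1} \<le> lam * (t - s)"
    and "prob {\<omega> \<in> space M. point_count (A \<omega>) {s<..t} \<ge> 2} \<le> (lam * (t - s))\<^sup>2"
proof -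
  have m: "measure (halfline_intensity lam) {s<..t} = lam * (t - s)"
    using assms lam_pos by (simp add: measure_def halfline_intensity_interval)
  show "prob {\<omega> \<in> space M. point_count (A \<omega>) {s<..t} \<ge> 1} \<le> lam * (t - s)"
    "prob {\<omega> \<in> space M. point_count (A \<omega>) {s<..t} \<ge> 2} \<le> (lam * (t - s))\<^sup>2"
    using poisson_tail[OF prob_space_axioms prm_A, of "{s<..t}"] assms lam_pos
    by (simp_all add: m sets_halfline_intensity halfline_intensity_interval)
qed

lemma D_tail:
  assumes "0 \<le> s" "s \<le> t" "0 \<le> a" "a \<le> b"
  shows "prob {\<omega> \<in> space M. point_count (D \<omega>) ({a..b} \<times> {s<..t}) \<ge> 1} \<le> (b - a) * (t - s)"
    and "prob {\<omega> \<in> space M. point_count (D \<omega>) ({a..b} \<times> {s<..t}) \<ge> 2} \<le> ((b - a) * (t - s))\<^sup>2"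
proof -
  have m: "measure quadrant_intensity ({a..b} \<times> {s<..t}) = (b - a) * (t - s)"
    using assms by (simp add: measure_def quadrant_intensity_rectangle)
  show "prob {\<omega> \<in> space M. point_count (D \<omega>) ({a..b} \<times> {s<..t}) \<ge> 1} \<le> (b - a) * (t - s)"
    "prob {\<omega> \<in> space M. point_count (D \<omega>) ({a..b} \<times> {s<..t}) \<ge> 2} \<le> ((b - a) * (t - s))\<^sup>2"
    using poisson_tail[OF prob_space_axioms prm_D, of "{a..b} \<times> {s<..t}"] assms
    by (simp_all add: m sets_quadrant_intensity quadrant_intensity_rectangle rectangle_borel)
qed

text \<open>A change needs an arrival or a point in the strip.\<close>

lemma change_probability:
  assumes "0 \<le> s" "s \<le> t"
  shows "prob {\<omega> \<in> space M. X t \<omega> \<noteq> X s \<omega>} \<le> (lam + B) * (t - s)"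
proof -
  define EA where "EA = {\<omega> \<in> space M. point_count (A \<omega>) {s<..t} \<ge> 1}"
  define ED where "ED = {\<omega> \<in> space M. point_count (D \<omega>) (strip s t) \<ge> 1}"
  note [measurable] = A_count_measurable[OF assms] D_count_measurable[OF assms order_refl less_imp_le[OF B_pos]]
  have [measurable]: "EA \<in> sets M" "ED \<in> sets M" unfolding EA_def ED_def strip_def by measurable
  have "prob {\<omega> \<in> space M. X t \<omega> \<noteq> X s \<omega>} \<le> prob (EA \<union> ED)"
  proof (rule finite_measure_mono_AE)
    show "AE \<omega> in M. \<omega> \<in> {\<omega> \<in> space M. X t \<omega> \<noteq> X s \<omega>} \<longrightarrow> \<omega> \<in> EA \<union> ED"
      using AE_regular
    proof eventually_elim
      case (elim \<omega>)
      then have \<omega>: "\<omega> \<in> space M" by (simp add: regular_def)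
      have "point_count (D \<omega>) (served \<omega> s t) \<le> point_count (D \<omega>) (strip s t)"
        by (rule D_count_Un(2)[OF elim served_borel[OF \<omega>] served_subset_strip _ strip_borel])
           (use assms served_subset_strip in auto)
      then show ?case using increment[OF elim assms] by (auto simp: EA_def ED_def)
    qed
  qed simp
  also have "\<dots> \<le> prob EA + prob ED" by (rule measure_Un_le) auto
  also have "\<dots> \<le> lam * (t - s) + (B - 0) * (t - s)"
    using A_tail(1)[OF assms] D_tail(1)[OF assms order_refl less_imp_le[OF B_pos]]
    unfolding EA_def ED_def strip_def by linarith
  finally show ?thesis by (simp add: algebra_simps)
qed

end


section \<open>The queue as a Markov chain on a time grid\<close>

lemma point_count_events:
  assumes prm: "poisson_random_measure M \<nu> R" and E: "E \<in> sets \<nu>"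
  shows "{\<omega> \<in> space M. P (point_count (R \<omega>) E)} \<in> random_measure_events M \<nu> R"
proof -
  define g where "g x = nat \<lfloor>enn2real x\<rfloor>" for x :: ennreal
  have "g \<in> measurable borel (count_space UNIV)" unfolding g_def[abs_def] by measurable
  then have "g -` {k. P k} \<inter> space borel \<in> sets borel" by (rule measurable_sets) simp
  then have gP: "g -` {k. P k} \<in> sets borel" by simp
  have "(\<lambda>\<omega>. emeasure (R \<omega>) E) -` (g -` {k. P k}) \<inter> space M \<in> random_measure_events M \<nu> R"
    unfolding random_measure_events_def by (rule sigma_sets.Basic) (use E gP in blast)
  also have "(\<lambda>\<omega>. emeasure (R \<omega>) E) -` (g -` {k. P k}) \<inter> space M = {\<omega> \<in> space M. P (point_count (R \<omega>) E)}"
    by (auto simp: g_def point_count_def measure_def)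
  finally show ?thesis .
qed

lemma random_measure_events_sigma_algebra:
  "sigma_algebra (space M) (random_measure_events M \<nu> R)"
  unfolding random_measure_events_def by (rule sigma_algebra_sigma_sets) auto

lemma point_counts_events:
  fixes m :: nat
  assumes prm: "poisson_random_measure M \<nu> R" and E: "\<And>j. j < m \<Longrightarrow> E j \<in> sets \<nu>"
  shows "{\<omega> \<in> space M. \<forall>j<m. point_count (R \<omega>) (E j) = a j} \<in> random_measure_events M \<nu> R"
proof -
  interpret S: sigma_algebra "space M" "random_measure_events M \<nu> R" by (rule random_measure_events_sigma_algebra)
  have "{\<omega> \<in> space M. \<forall>j\<in>{..<m}. point_count (R \<omega>) (E j) = a j} \<in> random_measure_events M \<nu> R"
    by (rule S.sets_Collect_finite_All) (auto intro!: point_count_events[OF prm] E)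
  then show ?thesis by (simp add: Ball_def)
qed

lemma poisson_counts_independent:
  fixes m :: nat
  assumes "prob_space M" and prm: "poisson_random_measure M \<nu> R"
    and E: "\<And>j. j < m \<Longrightarrow> E j \<in> sets \<nu>" "disjoint_family_on E {..<m}"
  shows "measure M {\<omega> \<in> space M. \<forall>j<m. point_count (R \<omega>) (E j) = a j} =
    (\<Prod>j<m. measure M {\<omega> \<in> space M. point_count (R \<omega>) (E j) = a j})"
proof (cases "m = 0")
  case True
  then show ?thesis using prob_space.prob_space[OF assms(1)] by simp
next
  case False
  interpret prob_space M by fact
  define g where "g x = nat \<lfloor>enn2real x\<rfloor>" for x :: ennreal
  have "g \<in> measurable borel (count_space UNIV)" unfolding g_def[abs_def] by measurable
  then have g: "g -` {k} \<in> sets borel" for k using measurable_sets[of g borel "count_space UNIV" "{k}"] by simp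
  have iv: "indep_vars (\<lambda>_. borel) (\<lambda>k \<omega>. emeasure (R \<omega>) (E k)) {..<m}"
    using prm E unfolding poisson_random_measure_def by blast
  have "prob (\<Inter>j\<in>{..<m}. (\<lambda>\<omega>. emeasure (R \<omega>) (E j)) -` (g -` {a j}) \<inter> space M) =
      (\<Prod>j<m. prob ((\<lambda>\<omega>. emeasure (R \<omega>) (E j)) -` (g -` {a j}) \<inter> space M))"
    by (rule indep_varsD[OF iv]) (use False g in auto)
  also have "(\<Inter>j\<in>{..<m}. (\<lambda>\<omega>. emeasure (R \<omega>) (E j)) -` (g -` {a j}) \<inter> space M) =
      {\<omega> \<in> space M. \<forall>j<m. point_count (R \<omega>) (E j) = a j}"
    using False by (auto simp: g_def point_count_def measure_def)
  finally have "prob {\<omega> \<in> space M. \<forall>j<m. point_count (R \<omega>) (E j) = a j} =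
      (\<Prod>j<m. prob ((\<lambda>\<omega>. emeasure (R \<omega>) (E j)) -` (g -` {a j}) \<inter> space M))" .
  moreover have "(\<lambda>\<omega>. emeasure (R \<omega>) (E j)) -` (g -` {a j}) \<inter> space M = {\<omega> \<in> space M. point_count (R \<omega>) (E j) = a j}" for j
    by (auto simp: g_def point_count_def measure_def)
  ultimately show ?thesis by (simp only:)
qed

text \<open>The pair consists of the numbers of arrivals and of potential departures in a cell.\<close>

definition queue_update :: "nat \<Rightarrow> nat \<times> nat \<Rightarrow> nat" where
  "queue_update x n = x + fst n - (if x > 0 then snd n else 0)"

locale lipschitz_queue = queue_equation +
  fixes Lc :: real
  assumes Lc: "0 \<le> Lc" and lipschitz: "\<And>s t. 0 \<le> s \<Longrightarrow> 0 \<le> t \<Longrightarrow> \<bar>mu s - mu t\<bar> \<le> Lc * \<bar>s - t\<bar>"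
begin

lemma muL_eq_mu:
  assumes "z > 0"
  shows "muL z = mu z"
proof -
  have "(mu \<longlongrightarrow> mu z) (at_left z)"
  proof (rule LIM_zero_cancel, rule Lim_null_comparison)
    show "\<forall>\<^sub>F s in at_left z. norm (mu s - mu z) \<le> Lc * \<bar>s - z\<bar>"
      using eventually_at_left_nonneg[OF assms] by eventually_elim (use lipschitz[of _ z] assms in auto)
    have "((\<lambda>s. Lc * \<bar>s - z\<bar>) \<longlongrightarrow> Lc * \<bar>z - z\<bar>) (at_left z)" by (intro tendsto_intros)
    then show "((\<lambda>s. Lc * \<bar>s - z\<bar>) \<longlongrightarrow> 0) (at_left z)" by simp
  qed
  then show ?thesis unfolding muL_def by (intro tendsto_Lim) simp_all
qed

text \<open>The region below the graph of the rate, with the rate frozen at the start of the cell.\<close>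

definition box :: "real \<Rightarrow> real \<Rightarrow> (real \<times> real) set" where "box s t = {0..mu s} \<times> {s<..t}"
text \<open>A neighbourhood of the frozen rate that contains the graph of the rate. The box and the region below the graph
  differ only inside it.\<close>

definition thin :: "real \<Rightarrow> real \<Rightarrow> (real \<times> real) set" where
  "thin s t = {max 0 (mu s - Lc * (t - s))..min B (mu s + Lc * (t - s))} \<times> {s<..t}"
definition good :: "'a \<Rightarrow> real \<Rightarrow> real \<Rightarrow> bool" where
  "good \<omega> s t \<longleftrightarrow> point_count (A \<omega>) {s<..t} + point_count (D \<omega>) (strip s t) \<le> 1 \<and> point_count (D \<omega>) (thin s t) = 0"
definition noise :: "real \<Rightarrow> nat \<Rightarrow> 'a \<Rightarrow> nat \<times> nat" where
  "noise h k \<omega> = (point_count (A \<omega>) {real k * h<..real (Suc k) * h}, point_count (D \<omega>) (box (real k * h) (real (Suc k) * h)))"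
definition chain :: "real \<Rightarrow> nat \<Rightarrow> 'a \<Rightarrow> nat" where
  "chain h k \<omega> = foldl queue_update (X 0 \<omega>) (map (\<lambda>j. noise h j \<omega>) [0..<k])"

lemma chain_0: "chain h 0 = X 0" by (rule ext) (simp add: chain_def)
lemma chain_Suc: "chain h (Suc k) \<omega> = queue_update (chain h k \<omega>) (noise h k \<omega>)" by (simp add: chain_def)

text \<open>In a good cell at most one point matters. If it is an arrival, nothing can depart. If it is a potential
  departure, then the queue is monotone on the cell, and it remains to see that the point is served exactly when the
  queue is nonempty at the start of the cell. The thin region contains no points, so freezing the rate is harmless.\<close>

lemma good_cell_increment:
  assumes reg: "regular \<omega>" and st: "0 \<le> s" "s \<le> t" and good: "good \<omega> s t"
  shows "X t \<omega> = queue_update (X s \<omega>) (point_count (A \<omega>) {s<..t}, point_count (D \<omega>) (box s t))"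
proof -
  have \<omega>: "\<omega> \<in> space M" using reg by (simp add: regular_def)
  have mus: "0 < mu s" "mu s \<le> B" using mu_bounds[OF st(1)] by auto
  have box: "box s t \<in> sets borel" "box s t \<subseteq> strip s t"
    using mus by (auto simp: box_def rectangle_borel strip_def)
  have thin: "thin s t \<in> sets borel" "thin s t \<subseteq> strip s t"
    by (auto simp: thin_def rectangle_borel strip_def)
  note bt = sets.Un[OF box(1) thin(1)] Un_least[OF box(2) thin(2)]
  have sw: "served \<omega> s w \<in> sets borel" "served \<omega> s w \<subseteq> strip s t" if "w \<le> t" for w
    using served_borel[OF \<omega> st(1)] served_subset_strip[OF st(1), of \<omega> w] that by (auto simp: strip_def)
  have mono: "point_count (D \<omega>) E \<le> point_count (D \<omega>) F" if "E \<subseteq> F" "E \<in> sets borel" "F \<in> sets borel" "F \<subseteq> strip s t" for E F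
    using D_count_Un(2)[OF reg that(2) _ st(1) that(3,4,1)] that by blast
  have strip: "strip s t \<in> sets borel" by (rule strip_borel)
  have near: "\<bar>muL z - mu s\<bar> \<le> Lc * (t - s)" if "s < z" "z \<le> t" for z
  proof -
    have "\<bar>mu z - mu s\<bar> \<le> Lc * \<bar>z - s\<bar>" using that st by (intro lipschitz) auto
    also have "\<dots> \<le> Lc * (t - s)" using that Lc by (intro mult_left_mono) auto
    finally show ?thesis using muL_eq_mu[of z] that st by simp
  qed
  have "served \<omega> s t \<subseteq> box s t \<union> thin s t"
  proof
    fix p assume p: "p \<in> served \<omega> s t"
    obtain u z where uz: "p = (u, z)" by (cases p)
    have *: "0 \<le> u" "u \<le> muL z" "s < z" "z \<le> t" using p by (simp_all add: uz served_def)
    show "p \<in> box s t \<union> thin s t"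
      using * near[OF *(3,4)] muL_bounds(2)[of z] st by (auto simp: uz box_def thin_def)
  qed
  then have "point_count (D \<omega>) (served \<omega> s t) \<le> point_count (D \<omega>) (box s t \<union> thin s t)"
    by (rule mono[OF _ sw(1)[OF order_refl] bt])
  also have "\<dots> \<le> point_count (D \<omega>) (box s t)"
    using D_count_Un(1)[OF reg box st(1) thin] good by (simp add: good_def)
  finally have upper: "point_count (D \<omega>) (served \<omega> s t) \<le> point_count (D \<omega>) (box s t)" .
  have bs: "point_count (D \<omega>) (box s t) \<le> point_count (D \<omega>) (strip s t)"
    by (rule mono[OF box(2,1) strip subset_refl])
  note inc = increment[OF reg st]
  consider (arrival) "point_count (D \<omega>) (strip s t) = 0" | (departure) "point_count (A \<omega>) {s<..t} = 0"
    "point_count (D \<omega>) (strip s t) \<le> 1" using good by (fastforce simp: good_def)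
  then show ?thesis
  proof cases
    case arrival
    then show ?thesis using inc upper bs by (simp add: queue_update_def)
  next
    case departure
    have incw: "X w \<omega> + point_count (D \<omega>) (served \<omega> s w) = X s \<omega>" if "s \<le> w" "w \<le> t" for w
      using increment[OF reg st(1) that(1)] A_count(2)[OF reg st that(2,1)] departure by simp
    show ?thesis
    proof (cases "X s \<omega> = 0")
      case True
      then show ?thesis using incw[of t] st departure by (simp add: queue_update_def)
    next
      case False
      have "point_count (D \<omega>) (served \<omega> s t) = point_count (D \<omega>) (box s t)"
      proof (cases "point_count (D \<omega>) (served \<omega> s t) = 0")
        case False
        then show ?thesis using upper bs departure by linarith
      next
        case True
        \<comment> \<open>Without a served point the queue stays positive, so every point of the box would be served.\<close>
        have const: "X w \<omega> = X s \<omega>" if "s \<le> w" "w \<le> t" for w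
        proof -
          have "served \<omega> s w \<subseteq> served \<omega> s t" using that by (auto simp: served_def)
          then have "point_count (D \<omega>) (served \<omega> s w) \<le> point_count (D \<omega>) (served \<omega> s t)"
            by (rule mono[OF _ sw(1)[OF that(2)] sw[OF order_refl]])
          then show ?thesis using incw[OF that] True by simp
        qed
        have pos: "XL \<omega> z > 0" if z: "s < z" "z \<le> t" for z
        proof -
          have "\<forall>\<^sub>F w in at_left z. X w \<omega> = XL \<omega> z" using XL_tendsto[OF \<omega>] z st by simp
          moreover have "\<forall>\<^sub>F w in at_left z. s \<le> w \<and> w \<le> t"
            unfolding eventually_at_left_field using z by (intro exI[of _ s]) auto
          ultimately have "\<forall>\<^sub>F w in at_left z. XL \<omega> z = X s \<omega>"
          proof eventually_elim
            case (elim w)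
            have "X w \<omega> = X s \<omega>" by (rule const) (use elim in blast)+
            then show ?case using elim(1) by (rule trans[OF sym, rotated])
          qed
          then have "XL \<omega> z = X s \<omega>" by simp
          then show ?thesis using \<open>X s \<omega> \<noteq> 0\<close> by simp
        qed
        have "box s t \<subseteq> served \<omega> s t \<union> thin s t"
        proof
          fix p assume p: "p \<in> box s t"
          obtain u z where uz: "p = (u, z)" by (cases p)
          have *: "0 \<le> u" "u \<le> mu s" "s < z" "z \<le> t" using p by (simp_all add: uz box_def)
          have **: "\<bar>muL z - mu s\<bar> \<le> Lc * (t - s)" by (rule near[OF *(3,4)])
          have "0 \<le> Lc * (t - s)" using Lc st by simp
          then show "p \<in> served \<omega> s t \<union> thin s t"
            using * ** pos[OF *(3,4)] mus by (cases "u \<le> muL z") (auto simp: uz served_def thin_def)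
        qed
        then have "point_count (D \<omega>) (box s t) \<le> point_count (D \<omega>) (served \<omega> s t \<union> thin s t)"
          by (rule mono[OF _ box(1) sets.Un[OF sw(1)[OF order_refl] thin(1)] Un_least[OF sw(2)[OF order_refl] thin(2)]])
        also have "\<dots> \<le> 0"
          using D_count_Un(1)[OF reg sw[OF order_refl] st(1) thin] True good by (simp add: good_def)
        finally show ?thesis using True by simp
      qed
      then show ?thesis using incw[of t] st departure False by (simp add: queue_update_def)
    qed
  qed
qed

lemma thin_bounds:
  assumes "0 \<le> s" "s \<le> t"
  shows "0 \<le> max 0 (mu s - Lc * (t - s))" "max 0 (mu s - Lc * (t - s)) \<le> min B (mu s + Lc * (t - s))"
    "min B (mu s + Lc * (t - s)) - max 0 (mu s - Lc * (t - s)) \<le> 2 * Lc * (t - s)"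
proof -
  have "0 \<le> Lc * (t - s)" using Lc assms by simp
  then show "0 \<le> max 0 (mu s - Lc * (t - s))" "max 0 (mu s - Lc * (t - s)) \<le> min B (mu s + Lc * (t - s))"
    "min B (mu s + Lc * (t - s)) - max 0 (mu s - Lc * (t - s)) \<le> 2 * Lc * (t - s)"
    using mu_bounds[OF assms(1)] B_pos by (auto simp: max_def min_def)
qed

definition bad_const :: real where "bad_const = lam\<^sup>2 + B\<^sup>2 + lam * B + 2 * Lc"

lemma bad_const_nonneg: "bad_const \<ge> 0"
  using lam_pos B_pos Lc by (simp add: bad_const_def)

lemma good_measurable:
  assumes "0 \<le> s" "s \<le> t"
  shows "{\<omega> \<in> space M. \<not> good \<omega> s t} \<in> sets M"
proof -
  note [measurable] = A_count_measurable[OF assms] D_count_measurable[OF assms order_refl less_imp_le[OF B_pos]]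
    D_count_measurable[OF assms thin_bounds(1,2)[OF assms]]
  have "good \<omega> s t \<longleftrightarrow> ((point_count (A \<omega>) {s<..t} = 0 \<and> point_count (D \<omega>) (strip s t) \<le> 1) \<or>
      (point_count (A \<omega>) {s<..t} \<le> 1 \<and> point_count (D \<omega>) (strip s t) = 0)) \<and> point_count (D \<omega>) (thin s t) = 0" for \<omega>
    by (auto simp: good_def)
  then show ?thesis unfolding strip_def thin_def by (simp only:) measurable
qed

text \<open>Two points have probability \<open>O(h\<^sup>2)\<close>, and so has a single point in the thin region, whose area is \<open>O(h\<^sup>2)\<close>.\<close>

lemma bad_cell_probability:
  assumes "0 \<le> s" "s \<le> t"
  shows "prob {\<omega> \<in> space M. \<not> good \<omega> s t} \<le> bad_const * (t - s)\<^sup>2"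
proof -
  note [measurable] = A_count_measurable[OF assms] D_count_measurable[OF assms order_refl less_imp_le[OF B_pos]]
    D_count_measurable[OF assms thin_bounds(1,2)[OF assms]]
  define EA where "EA n = {\<omega> \<in> space M. point_count (A \<omega>) {s<..t} \<ge> n}" for n
  define ED where "ED n = {\<omega> \<in> space M. point_count (D \<omega>) (strip s t) \<ge> n}" for n
  define ET where "ET = {\<omega> \<in> space M. point_count (D \<omega>) (thin s t) \<ge> 1}"
  have [measurable]: "EA n \<in> sets M" "ED n \<in> sets M" "ET \<in> sets M" for n
    unfolding EA_def ED_def ET_def strip_def thin_def by measurable
  have "prob {\<omega> \<in> space M. \<not> good \<omega> s t} \<le> prob ((EA 2 \<union> ED 2) \<union> ((EA 1 \<inter> ED 1) \<union> ET))"
  proof (rule finite_measure_mono)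
    show "{\<omega> \<in> space M. \<not> good \<omega> s t} \<subseteq> (EA 2 \<union> ED 2) \<union> ((EA 1 \<inter> ED 1) \<union> ET)"
      by (auto simp: good_def EA_def ED_def ET_def)
  qed auto
  also have "\<dots> \<le> (prob (EA 2) + prob (ED 2)) + (prob (EA 1 \<inter> ED 1) + prob ET)"
    by (intro order_trans[OF measure_Un_le] add_mono order_refl) auto
  also have "prob (EA 1 \<inter> ED 1) = prob (EA 1) * prob (ED 1)"
  proof -
    have "EA 1 \<in> random_measure_events M (halfline_intensity lam) A"
      unfolding EA_def by (rule point_count_events[OF prm_A]) (simp add: sets_halfline_intensity)
    moreover have "ED 1 \<in> random_measure_events M quadrant_intensity D"
      unfolding ED_def by (rule point_count_events[OF prm_D]) (simp add: sets_quadrant_intensity strip_borel)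
    ultimately have "prob ((X 0 -` UNIV \<inter> space M) \<inter> EA 1 \<inter> ED 1) = prob (X 0 -` UNIV \<inter> space M) * prob (EA 1) * prob (ED 1)"
      by (rule independent)
    moreover have "space M \<inter> EA 1 = EA 1" by (auto simp: EA_def)
    ultimately show ?thesis by (simp add: prob_space)
  qed
  also have "(prob (EA 2) + prob (ED 2)) + (prob (EA 1) * prob (ED 1) + prob ET) \<le>
      ((lam * (t - s))\<^sup>2 + ((B - 0) * (t - s))\<^sup>2) + (lam * (t - s) * ((B - 0) * (t - s)) + 2 * Lc * (t - s) * (t - s))"
  proof (intro add_mono mult_mono)
    show "prob ET \<le> 2 * Lc * (t - s) * (t - s)"
      unfolding ET_def thin_def
      by (rule order_trans[OF D_tail(1)[OF assms thin_bounds(1,2)[OF assms]]], rule mult_right_mono[OF thin_bounds(3)[OF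
          assms]])
         (use assms in simp)
  qed (use A_tail[OF assms] D_tail[OF assms order_refl less_imp_le[OF B_pos]] assms lam_pos in
        \<open>auto simp: EA_def ED_def strip_def\<close>)
  also have "\<dots> = bad_const * (t - s)\<^sup>2" by (simp add: bad_const_def power2_eq_square algebra_simps)
  finally show ?thesis .
qed

lemma noise_measurable:
  assumes "h > 0"
  shows "noise h k \<in> measurable M (count_space UNIV)"
proof -
  have kh: "0 \<le> real k * h" "real k * h \<le> real (Suc k) * h" using assms by (auto intro: mult_right_mono)
  have "0 \<le> mu (real k * h)" using mu_bounds[OF kh(1)] by simp
  note * = A_count_measurable[OF kh] D_count_measurable[OF kh order_refl this]
  have "noise h k \<in> measurable M (count_space UNIV \<Otimes>\<^sub>M count_space UNIV)"
    unfolding noise_def[abs_def] box_def using * by (rule measurable_Pair)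
  moreover have "count_space UNIV \<Otimes>\<^sub>M count_space UNIV = (count_space UNIV :: (nat \<times> nat) measure)"
    by (simp add: pair_measure_countable)
  ultimately show ?thesis by simp
qed

lemma noise_list_measurable:
  assumes "h > 0"
  shows "(\<lambda>\<omega>. (X 0 \<omega>, map (\<lambda>j. noise h j \<omega>) [0..<k])) \<in> measurable M (count_space UNIV)"
proof -
  have "(\<lambda>\<omega>. map (\<lambda>j. noise h j \<omega>) [0..<k]) \<in> measurable M (count_space (lists UNIV))"
    by (rule measurable_map_list) (auto intro: noise_measurable[OF assms])
  then have "(\<lambda>\<omega>. (X 0 \<omega>, map (\<lambda>j. noise h j \<omega>) [0..<k])) \<in> measurable M (count_space UNIV \<Otimes>\<^sub>M count_space UNIV)"
    using X_meas[of 0] by (intro measurable_Pair) auto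
  moreover have "count_space UNIV \<Otimes>\<^sub>M count_space UNIV = (count_space UNIV :: (nat \<times> (nat \<times> nat) list) measure)"
    by (subst pair_measure_countable) auto
  ultimately show ?thesis by simp
qed

lemma chain_measurable:
  assumes "h > 0"
  shows "chain h k \<in> measurable M (count_space UNIV)"
  unfolding chain_def[abs_def]
  using measurable_compose[OF noise_list_measurable[OF assms, of k], of "\<lambda>(x, l). foldl queue_update x l" "count_space UNIV"]
  by simp

text \<open>There are \<open>n\<close> cells, each bad with probability \<open>O(h\<^sup>2)\<close>; without bad cells the chain is the queue at all grid times.\<close>

lemma chain_deviation:
  assumes h: "h > 0"
  shows "prob {\<omega> \<in> space M. \<exists>k\<le>n. chain h k \<omega> \<noteq> X (real k * h) \<omega>} \<le> real n * (bad_const * h\<^sup>2)"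
proof -
  have kh: "0 \<le> real k * h" "real k * h \<le> real (Suc k) * h" "real (Suc k) * h - real k * h = h" for k
    using h by (auto intro: mult_right_mono simp: algebra_simps)
  define Bad where "Bad k = {\<omega> \<in> space M. \<not> good \<omega> (real k * h) (real (Suc k) * h)}" for k
  have Bad: "Bad k \<in> sets M" for k unfolding Bad_def by (rule good_measurable[OF kh(1,2)])
  have "prob {\<omega> \<in> space M. \<exists>k\<le>n. chain h k \<omega> \<noteq> X (real k * h) \<omega>} \<le> prob (\<Union>k\<in>{..<n}. Bad k)"
  proof (rule finite_measure_mono_AE)
    show "AE \<omega> in M. \<omega> \<in> {\<omega> \<in> space M. \<exists>k\<le>n. chain h k \<omega> \<noteq> X (real k * h) \<omega>} \<longrightarrow> \<omega> \<in> (\<Union>k\<in>{..<n}. Bad k)"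
      using AE_regular
    proof eventually_elim
      case (elim \<omega>)
      have \<omega>: "\<omega> \<in> space M" using elim by (simp add: regular_def)
      have "chain h k \<omega> = X (real k * h) \<omega>" if "k \<le> n" and ok: "\<omega> \<notin> (\<Union>k\<in>{..<n}. Bad k)" for k
        using that(1)
      proof (induction k)
        case 0 then show ?case by (simp add: chain_0)
      next
        case (Suc k)
        then have "good \<omega> (real k * h) (real (Suc k) * h)" using ok \<omega> by (auto simp: Bad_def)
        from good_cell_increment[OF elim kh(1,2) this] show ?case
          using Suc by (simp add: chain_Suc noise_def)
      qed
      then show ?case by blast
    qed
    show "(\<Union>k\<in>{..<n}. Bad k) \<in> sets M" using Bad by auto
  qed
  also have "\<dots> \<le> (\<Sum>k<n. prob (Bad k))" by (rule finite_measure_subadditive_finite) (use Bad in auto)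
  also have "\<dots> \<le> (\<Sum>k<n. bad_const * h\<^sup>2)"
    by (rule sum_mono) (simp only: Bad_def, rule order_trans[OF bad_cell_probability[OF kh(1,2)]], simp only: kh(3)
        order_refl)
  finally show ?thesis by simp
qed

text \<open>Counts over disjoint cells are independent, and so are arrivals, departures and the initial value. Hence the noise
  of a cell is independent of the past and consists of two independent Poisson variables.\<close>

lemma noise_joint:
  assumes h: "h > 0"
  shows "prob {\<omega> \<in> space M. (X 0 \<omega>, map (\<lambda>j. noise h j \<omega>) [0..<k]) = w \<and> noise h k \<omega> = y} =
    prob {\<omega> \<in> space M. (X 0 \<omega>, map (\<lambda>j. noise h j \<omega>) [0..<k]) = w} *
    pmf (pair_pmf (poisson_pmf (lam * h)) (poisson_pmf (mu (real k * h) * h))) y"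
proof -
  obtain x l where w: "w = (x, l)" by (cases w)
  obtain a d where y: "y = (a, d)" by (cases y)
  have kh: "0 \<le> real k * h" "real k * h \<le> real (Suc k) * h" "real (Suc k) * h - real k * h = h" for k
    using h by (auto intro: mult_right_mono simp: algebra_simps)
  show ?thesis
  proof (cases "length l = k")
    case False
    then have e1: "{\<omega> \<in> space M. (X 0 \<omega>, map (\<lambda>j. noise h j \<omega>) [0..<k]) = w} = {}"
      and e2: "{\<omega> \<in> space M. (X 0 \<omega>, map (\<lambda>j. noise h j \<omega>) [0..<k]) = w \<and> noise h k \<omega> = y} = {}"
      by (auto simp: w)
    show ?thesis unfolding e1 e2 by simp
  next
    case True
    \<comment> \<open>The past noise and the present value in one list, so that the first \<open>k\<close> and the first \<open>Suc k\<close> cells are treated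
      alike.\<close>
    define l' where "l' = l @ [y]"
    define I where "I j = {real j * h<..real (Suc j) * h}" for j
    define R where "R j = box (real j * h) (real (Suc j) * h)" for j
    define V where "V m = {\<omega> \<in> space M. \<forall>j<m. point_count (A \<omega>) (I j) = fst (l' ! j)}" for m
    define W where "W m = {\<omega> \<in> space M. \<forall>j<m. point_count (D \<omega>) (R j) = snd (l' ! j)}" for m
    have IR: "I j \<in> sets (halfline_intensity lam)" "R j \<in> sets quadrant_intensity" for j
      by (auto simp: I_def R_def box_def sets_halfline_intensity sets_quadrant_intensity rectangle_borel)
    have disj: "I i \<inter> I j = {}" if "i < j" for i j
    proof -
      have "real (Suc i) * h \<le> real j * h" using that h by (intro mult_right_mono) auto
      then show ?thesis by (auto simp: I_def)
    qed
    have dI: "disjoint_family_on I {..<m}" for m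
      unfolding disjoint_family_on_def using disj by (metis Int_commute linorder_neqE_nat)
    have dR: "disjoint_family_on R {..<m}" for m
      using dI[of m] by (fastforce simp: disjoint_family_on_def R_def box_def I_def)
    have P: "prob (({\<omega> \<in> space M. X 0 \<omega> = x}) \<inter> V m \<inter> W m) = prob {\<omega> \<in> space M. X 0 \<omega> = x} * prob (V m) * prob (W m)" for m
    proof -
      have "V m \<in> random_measure_events M (halfline_intensity lam) A"
        unfolding V_def by (rule point_counts_events[OF prm_A IR(1)])
      moreover have "W m \<in> random_measure_events M quadrant_intensity D"
        unfolding W_def by (rule point_counts_events[OF prm_D IR(2)])
      ultimately have "prob ((X 0 -` {x} \<inter> space M) \<inter> V m \<inter> W m) = prob (X 0 -` {x} \<inter> space M) * prob (V m) * prob (W m)"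
        by (rule independent)
      moreover have "X 0 -` {x} \<inter> space M = {\<omega> \<in> space M. X 0 \<omega> = x}" by auto
      ultimately show ?thesis by simp
    qed
    have eI: "emeasure (halfline_intensity lam) (I k) = ennreal (lam * h)"
      using halfline_intensity_interval[OF kh(1)[of k] kh(2)[of k], of lam] lam_pos unfolding I_def kh(3) by simp
    then have mI: "measure (halfline_intensity lam) (I k) = lam * h" "emeasure (halfline_intensity lam) (I k) < \<infinity>"
      using lam_pos h by (simp_all add: measure_def)
    have "emeasure quadrant_intensity (R k) = ennreal ((mu (real k * h) - 0) * h)"
      using quadrant_intensity_rectangle[OF kh(1)[of k] kh(2)[of k], of 0 "mu (real k * h)"] mu_bounds[OF kh(1), of k]
      unfolding R_def box_def kh(3) by simp
    then have mR: "measure quadrant_intensity (R k) = mu (real k * h) * h" "emeasure quadrant_intensity (R k) < \<infinity>"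
      using mu_bounds[OF kh(1), of k] h by (simp_all add: measure_def)
    have l'k: "l' ! k = y" using True by (simp add: l'_def nth_append)
    have VS: "prob (V (Suc k)) = prob (V k) * pmf (poisson_pmf (lam * h)) a"
    proof -
      have "prob (V (Suc k)) = prob (V k) * prob {\<omega> \<in> space M. point_count (A \<omega>) (I k) = fst (l' ! k)}"
        unfolding V_def by (simp only: poisson_counts_independent[OF prob_space_axioms prm_A IR(1) dI] prod.lessThan_Suc)
      then show ?thesis
        using poisson_point_count(3)[OF prob_space_axioms prm_A IR(1) mI(2), of a] lam_pos h
        by (simp add: l'k y mI poisson_pmf.rep_eq)
    qed
    have WS: "prob (W (Suc k)) = prob (W k) * pmf (poisson_pmf (mu (real k * h) * h)) d"
    proof -
      have "prob (W (Suc k)) = prob (W k) * prob {\<omega> \<in> space M. point_count (D \<omega>) (R k) = snd (l' ! k)}"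
        unfolding W_def by (simp only: poisson_counts_independent[OF prob_space_axioms prm_D IR(2) dR] prod.lessThan_Suc)
      then show ?thesis
        using poisson_point_count(3)[OF prob_space_axioms prm_D IR(2) mR(2), of d] mu_bounds[OF kh(1), of k] h
        by (simp add: l'k y mR poisson_pmf.rep_eq)
    qed
    have hist: "map (\<lambda>j. noise h j \<omega>) [0..<k] = l \<longleftrightarrow>
        (\<forall>j<k. point_count (A \<omega>) (I j) = fst (l' ! j)) \<and> (\<forall>j<k. point_count (D \<omega>) (R j) = snd (l' ! j))" for \<omega>
    proof -
      have "map (\<lambda>j. noise h j \<omega>) [0..<k] = l \<longleftrightarrow> (\<forall>j<k. noise h j \<omega> = l ! j)"
        by (subst list_eq_iff_nth_eq) (simp add: True)
      also have "\<dots> \<longleftrightarrow> (\<forall>j<k. noise h j \<omega> = l' ! j)" by (simp add: l'_def nth_append True)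
      finally show ?thesis by (auto simp: noise_def I_def R_def prod_eq_iff)
    qed
    have now: "noise h k \<omega> = y \<longleftrightarrow> point_count (A \<omega>) (I k) = fst (l' ! k) \<and> point_count (D \<omega>) (R k) = snd (l' ! k)" for \<omega>
      by (auto simp: l'k noise_def I_def R_def prod_eq_iff)
    have "{\<omega> \<in> space M. (X 0 \<omega>, map (\<lambda>j. noise h j \<omega>) [0..<k]) = w} = ({\<omega> \<in> space M. X 0 \<omega> = x}) \<inter> V k \<inter> W k"
      unfolding w prod.inject hist V_def W_def by blast
    moreover have "{\<omega> \<in> space M. (X 0 \<omega>, map (\<lambda>j. noise h j \<omega>) [0..<k]) = w \<and> noise h k \<omega> = y} =
        ({\<omega> \<in> space M. X 0 \<omega> = x}) \<inter> V (Suc k) \<inter> W (Suc k)"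
      unfolding w prod.inject hist now V_def W_def less_Suc_eq by blast
    ultimately show ?thesis by (simp add: P VS WS pmf_pair y)
  qed
qed

lemma chain_step:
  fixes F :: "nat list \<Rightarrow> real"
  assumes h: "h > 0" and F: "\<And>w. \<bar>F w\<bar> \<le> 1"
  shows "\<bar>expectation (\<lambda>\<omega>. F (map (\<lambda>j. chain h j \<omega>) [0..<Suc (Suc k)])) -
    expectation (\<lambda>\<omega>. birth_death_step (lam * h) (mu (real k * h) * h)
       (\<lambda>x. F (map (\<lambda>j. chain h j \<omega>) [0..<Suc k] @ [x])) (chain h k \<omega>))\<bar> \<le> 3 * ((lam + B) * h)\<^sup>2"
proof -
  define Hist where "Hist \<omega> = (X 0 \<omega>, map (\<lambda>j. noise h j \<omega>) [0..<k])" for \<omega>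
  define path where "path w = map (\<lambda>j. foldl queue_update (fst w) (take j (snd w))) [0..<Suc k]"
      for w :: "nat \<times> (nat \<times> nat) list"
  define G where "G w y = F (path w @ [queue_update (foldl queue_update (fst w) (snd w)) y])" for w y
  define p where "p = pair_pmf (poisson_pmf (lam * h)) (poisson_pmf (mu (real k * h) * h))"
  define b where "b = mu (real k * h) * h"
  have mu: "0 < mu (real k * h)" "mu (real k * h) \<le> B" using mu_bounds[of "real k * h"] h by auto
  have b: "0 < b" "b \<le> B * h" using mu h by (auto simp: b_def)
  have a: "0 < lam * h" using lam_pos h by simp
  have take_map: "take j (map (\<lambda>j. noise h j \<omega>) [0..<k]) = map (\<lambda>j. noise h j \<omega>) [0..<j]" if "j \<le> k" for j \<omega>
    using that by (simp add: take_map)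
  have path: "path (Hist \<omega>) = map (\<lambda>j. chain h j \<omega>) [0..<Suc k]" for \<omega>
    unfolding path_def Hist_def by (rule map_cong) (auto simp: chain_def take_map simp del: upt_Suc)
  have last: "foldl queue_update (fst (Hist \<omega>)) (snd (Hist \<omega>)) = chain h k \<omega>" for \<omega>
    by (simp add: Hist_def chain_def)
  have Hm: "Hist \<in> measurable M (count_space UNIV)"
    unfolding Hist_def[abs_def] by (rule noise_list_measurable[OF h])
  have "expectation (\<lambda>\<omega>. G (Hist \<omega>) (noise h k \<omega>)) = expectation (\<lambda>\<omega>. measure_pmf.expectation p (G (Hist \<omega>)))"
  proof (rule expectation_disintegration[where \<kappa> = "\<lambda>_. p" and A = UNIV and B = UNIV and c = 1])
    show "prob {\<omega> \<in> space M. Hist \<omega> = w \<and> noise h k \<omega> = y} = prob {\<omega> \<in> space M. Hist \<omega> = w} * pmf p y" for w y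
      unfolding Hist_def p_def by (rule noise_joint[OF h])
  qed (use Hm noise_measurable[OF h] F in \<open>auto simp: G_def prob_space_axioms\<close>)
  moreover have "G (Hist \<omega>) (noise h k \<omega>) = F (map (\<lambda>j. chain h j \<omega>) [0..<Suc (Suc k)])" for \<omega>
    unfolding G_def path last by (simp add: chain_Suc[symmetric])
  ultimately have 1: "expectation (\<lambda>\<omega>. F (map (\<lambda>j. chain h j \<omega>) [0..<Suc (Suc k)])) =
      expectation (\<lambda>\<omega>. measure_pmf.expectation p (G (Hist \<omega>)))" by simp
  define S where "S w = birth_death_step (lam * h) b (\<lambda>x. F (path w @ [x])) (foldl queue_update (fst w) (snd w))" for w
  have GS: "\<bar>measure_pmf.expectation p (G w) - S w\<bar> \<le> 3 * ((lam + B) * h)\<^sup>2" for w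
  proof -
    define x where "x = foldl queue_update (fst w) (snd w)"
    have "\<bar>measure_pmf.expectation p (G w) - ((1 - lam * h - b) * G w (0, 0) + lam * h * G w (1, 0) + b * G w (0, 1))\<bar>
        \<le> 3 * (lam * h + b)\<^sup>2"
      unfolding p_def b_def by (rule poisson_pair_step) (use a b F in \<open>auto simp: b_def G_def\<close>)
    also have "(1 - lam * h - b) * G w (0, 0) + lam * h * G w (1, 0) + b * G w (0, 1) = S w"
      by (simp add: G_def S_def birth_death_step_def queue_update_def x_def[symmetric])
    also have "3 * (lam * h + b)\<^sup>2 \<le> 3 * ((lam + B) * h)\<^sup>2"
      using a b by (intro mult_left_mono power_mono) (auto simp: algebra_simps)
    finally show ?thesis .
  qed
  have Sb: "\<bar>S w\<bar> \<le> 1 + 3 * ((lam + B) * h)\<^sup>2" for w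
    using GS[of w] abs_expectation_pmf_le[of p "G w" 1] F by (auto simp: G_def)
  have int1: "integrable M (\<lambda>\<omega>. S (Hist \<omega>))"
    by (rule integrable_const_bound[where B = "1 + 3 * ((lam + B) * h)\<^sup>2"])
       (use Sb measurable_compose[OF Hm, of S borel] in auto)
  have int2: "integrable M (\<lambda>\<omega>. measure_pmf.expectation p (G (Hist \<omega>)))"
    by (rule integrable_const_bound[where B = 1])
       (use abs_expectation_pmf_le[of p "G _" 1] F measurable_compose[OF Hm, of "\<lambda>w. measure_pmf.expectation p (G w)"
           borel] in \<open>auto simp: G_def\<close>)
  have "\<bar>expectation (\<lambda>\<omega>. measure_pmf.expectation p (G (Hist \<omega>))) - expectation (\<lambda>\<omega>. S (Hist \<omega>))\<bar> =
      \<bar>expectation (\<lambda>\<omega>. measure_pmf.expectation p (G (Hist \<omega>)) - S (Hist \<omega>))\<bar>"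
    by (simp only: Bochner_Integration.integral_diff[OF int2 int1])
  also have "\<dots> \<le> expectation (\<lambda>\<omega>. \<bar>measure_pmf.expectation p (G (Hist \<omega>)) - S (Hist \<omega>)\<bar>)"
    by (rule integral_abs_bound)
  also have "\<dots> \<le> expectation (\<lambda>_. 3 * ((lam + B) * h)\<^sup>2)"
    by (rule integral_mono) (use int1 int2 GS in auto)
  also have "\<dots> = 3 * ((lam + B) * h)\<^sup>2" by (simp add: prob_space)
  finally show ?thesis unfolding 1 by (simp only: S_def path last b_def)
qed

end


section \<open>The generator of the replica system\<close>

lemma (in prob_space) integrable_discrete:
  fixes G :: "'s \<Rightarrow> real"
  assumes "Z \<in> measurable M (count_space C)" "\<And>z. z \<in> C \<Longrightarrow> \<bar>G z\<bar> \<le> c"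
  shows "integrable M (\<lambda>\<omega>. G (Z \<omega>))"
proof (rule integrable_const_bound[where B = c])
  show "AE \<omega> in M. norm (G (Z \<omega>)) \<le> c"
    using measurable_space[OF assms(1)] assms(2) by (intro AE_I2) auto
  show "(\<lambda>\<omega>. G (Z \<omega>)) \<in> borel_measurable M"
    by (rule measurable_compose[OF assms(1)]) simp
qed

lemma (in prob_space) expectation_diff_le:
  fixes f g :: "'a \<Rightarrow> real"
  assumes "integrable M f" "integrable M g" "\<And>\<omega>. \<omega> \<in> space M \<Longrightarrow> \<bar>f \<omega> - g \<omega>\<bar> \<le> c"
  shows "\<bar>expectation f - expectation g\<bar> \<le> c"
proof -
  have "\<bar>expectation f - expectation g\<bar> = \<bar>expectation (\<lambda>\<omega>. f \<omega> - g \<omega>)\<bar>"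
    using assms by (simp add: Bochner_Integration.integral_diff)
  also have "\<dots> \<le> expectation (\<lambda>\<omega>. \<bar>f \<omega> - g \<omega>\<bar>)" by (rule integral_abs_bound)
  also have "\<dots> \<le> expectation (\<lambda>_. c)"
    using assms by (intro integral_mono) auto
  finally show ?thesis by (simp add: prob_space)
qed

text \<open>Conditionally on the history up to the grid time \<open>k h\<close> the next value has the law \<open>P h\<close> started from the present
  value, and the second-order expansion applies with the history as a parameter.\<close>

lemma markov_chain_step:
  fixes F :: "'s list \<Rightarrow> 's \<Rightarrow> real" and M :: "'w measure" and k :: nat and h :: real
  assumes "prob_space M" and mc: "markov_chain_with_generator M S X L"
    and S: "countable S" "S \<noteq> {}"
    and L_bound: "\<And>f c x. (\<And>y. \<bar>f y\<bar> \<le> c) \<Longrightarrow> x \<in> S \<Longrightarrow> \<bar>L f x\<bar> \<le> \<Lambda> * c"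
    and h: "h \<ge> 0" and F: "\<And>w y. \<bar>F w y\<bar> \<le> c"
  defines "hist \<equiv> \<lambda>\<omega>. map (\<lambda>j. X (real j * h) \<omega>) [0..<Suc k]"
  shows "\<bar>(\<integral>\<omega>. F (hist \<omega>) (X (real (Suc k) * h) \<omega>) \<partial>M) -
     (\<integral>\<omega>. F (hist \<omega>) (X (real k * h) \<omega>) + h * L (F (hist \<omega>)) (X (real k * h) \<omega>) \<partial>M)\<bar> \<le> h\<^sup>2 * \<Lambda>\<^sup>2 * c"
proof -
  interpret prob_space M by fact
  obtain P where P: "markov_semigroup S P" "has_generator S P L"
    and markov: "\<And>n \<tau> x y h. (\<forall>i\<le>n. 0 \<le> \<tau> i \<and> x i \<in> S) \<and> (\<forall>i<n. \<tau> i \<le> \<tau> (Suc i)) \<and> y \<in> S \<and> 0 \<le> h \<Longrightarrow>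
           measure M {\<omega>\<in>space M. (\<forall>i\<le>n. X (\<tau> i) \<omega> = x i) \<and> X (\<tau> n + h) \<omega> = y} =
           measure M {\<omega>\<in>space M. \<forall>i\<le>n. X (\<tau> i) \<omega> = x i} * pmf (P h (x n)) y"
    using mc unfolding markov_chain_with_generator_def by blast
  have X: "X t \<in> measurable M (count_space S)" if "t \<ge> 0" for t
    using mc that unfolding markov_chain_with_generator_def by blast
  interpret bounded_generator S P L \<Lambda>
    by unfold_locales (use P L_bound in auto)
  have histm: "hist \<in> measurable M (count_space (lists S))"
    unfolding hist_def by (rule measurable_map_list[OF S(1)]) (use h X in auto)
  have histne: "hist \<omega> \<noteq> []" for \<omega> by (simp add: hist_def)
  have last: "last (hist \<omega>) = X (real k * h) \<omega>" for \<omega> by (simp add: hist_def)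
  obtain x0 where x0: "x0 \<in> S" using S by blast
  define top where "top w = (if w = [] then x0 else last w)" for w
  have top_hist: "top (hist \<omega>) = X (real k * h) \<omega>" for \<omega> by (simp add: top_def histne last)
  have top_S: "top w \<in> S" if "w \<in> lists S" for w
    using that x0 last_in_set[of w] by (auto simp: top_def in_lists_conv_set)
  have joint: "prob {\<omega> \<in> space M. hist \<omega> = w \<and> X (real (Suc k) * h) \<omega> = y} =
      prob {\<omega> \<in> space M. hist \<omega> = w} * pmf (P h (top w)) y" if w: "w \<in> lists S" and y: "y \<in> S" for w y
  proof (cases "length w = Suc k")
    case False
    then have e1: "{\<omega> \<in> space M. hist \<omega> = w} = {}" and e2: "{\<omega> \<in> space M. hist \<omega> = w \<and> X (real (Suc k) * h) \<omega> = y} = {}"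
      by (auto simp: hist_def simp del: upt_Suc)
    show ?thesis unfolding e1 e2 by simp
  next
    case True
    have eq: "hist \<omega> = w \<longleftrightarrow> (\<forall>i\<le>k. X (real i * h) \<omega> = w ! i)" for \<omega>
      unfolding hist_def by (subst list_eq_iff_nth_eq) (auto simp: True less_Suc_eq_le simp del: upt_Suc)
    have "w \<noteq> []" using True by auto
    then have topw: "top w = w ! k" using True by (simp add: top_def last_conv_nth)
    have wS: "w ! i \<in> S" if "i \<le> k" for i using w True that nth_mem[of i w] by (auto simp: in_lists_conv_set)
    have "prob {\<omega> \<in> space M. (\<forall>i\<le>k. X (real i * h) \<omega> = w ! i) \<and> X (real k * h + h) \<omega> = y} =
        prob {\<omega> \<in> space M. \<forall>i\<le>k. X (real i * h) \<omega> = w ! i} * pmf (P h (w ! k)) y"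
      by (rule markov[of k "\<lambda>i. real i * h"]) (use wS y h in \<open>auto intro: mult_right_mono\<close>)
    moreover have "real (Suc k) * h = real k * h + h" by (simp add: algebra_simps)
    ultimately show ?thesis by (simp only: eq topw)
  qed
  have 1: "expectation (\<lambda>\<omega>. F (hist \<omega>) (X (real (Suc k) * h) \<omega>)) =
      expectation (\<lambda>\<omega>. measure_pmf.expectation (P h (top (hist \<omega>))) (F (hist \<omega>)))"
  proof (rule expectation_disintegration[where A = "lists S" and B = S and c = c and \<kappa> = "\<lambda>w. P h (top w)"])
    show "set_pmf (P h (top w)) \<subseteq> S" if "w \<in> lists S" for w
      using P_closed[OF top_S[OF that] h] by blast
  qed (use histm X h joint F S in \<open>auto simp: prob_space_axioms\<close>)
  have c0: "0 \<le> c" using F[of "[]" x0] by linarith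
  have b1: "\<bar>measure_pmf.expectation (P h (top w)) (F w)\<bar> \<le> c" for w
    by (rule abs_expectation_pmf_le) (rule F)
  have b2: "\<bar>F w (top w) + h * L (F w) (top w)\<bar> \<le> c + h * (\<Lambda> * c)" if "w \<in> lists S" for w
  proof -
    have "\<bar>h * L (F w) (top w)\<bar> \<le> h * (\<Lambda> * c)"
      using L_bound[where f = "F w" and c = c, OF F top_S[OF that]] h by (simp add: abs_mult mult_left_mono)
    then show ?thesis using F[of w "top w"] by linarith
  qed
  have "\<bar>expectation (\<lambda>\<omega>. measure_pmf.expectation (P h (top (hist \<omega>))) (F (hist \<omega>))) -
      expectation (\<lambda>\<omega>. F (hist \<omega>) (top (hist \<omega>)) + h * L (F (hist \<omega>)) (top (hist \<omega>)))\<bar> \<le> h\<^sup>2 * \<Lambda>\<^sup>2 * c"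
  proof (rule expectation_diff_le)
    show "integrable M (\<lambda>\<omega>. measure_pmf.expectation (P h (top (hist \<omega>))) (F (hist \<omega>)))"
      by (rule integrable_discrete[OF histm, of "\<lambda>w. measure_pmf.expectation (P h (top w)) (F w)", OF b1])
    show "integrable M (\<lambda>\<omega>. F (hist \<omega>) (top (hist \<omega>)) + h * L (F (hist \<omega>)) (top (hist \<omega>)))"
      by (rule integrable_discrete[OF histm, of "\<lambda>w. F w (top w) + h * L (F w) (top w)", OF b2])
    fix \<omega> assume "\<omega> \<in> space M"
    then have "top (hist \<omega>) \<in> S" using measurable_space[OF histm] top_S by simp
    from taylor[where f = "F (hist \<omega>)" and c = c, OF F this h]
    show "\<bar>measure_pmf.expectation (P h (top (hist \<omega>))) (F (hist \<omega>)) -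
        (F (hist \<omega>) (top (hist \<omega>)) + h * L (F (hist \<omega>)) (top (hist \<omega>)))\<bar> \<le> h\<^sup>2 * \<Lambda>\<^sup>2 * c"
      by (simp add: algebra_simps)
  qed
  then show ?thesis unfolding 1 by (simp only: top_hist)
qed

definition shannon_rate :: "real \<Rightarrow> real \<Rightarrow> real" where
  "shannon_rate B y = B * log 2 (1 + 1 / (1 + y))"

lemma shannon_rate_bounds:
  assumes "B > 0" "y \<ge> 0"
  shows "0 < shannon_rate B y" "shannon_rate B y \<le> B"
proof -
  have p: "0 < 1 / (1 + y)" "1 / (1 + y) \<le> 1" using assms by simp_all
  have "log 2 1 < log 2 (1 + 1 / (1 + y))" using p by (subst log_less_cancel_iff) linarith+
  then show "0 < shannon_rate B y" using assms by (simp add: shannon_rate_def)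
  have "log 2 (1 + 1 / (1 + y)) \<le> log 2 2" using p by (subst log_le_cancel_iff) linarith+
  then show "shannon_rate B y \<le> B" using assms by (simp add: shannon_rate_def)
qed

lemma ln_lipschitz_1:
  assumes "1 \<le> a" "1 \<le> (b::real)"
  shows "\<bar>ln a - ln b\<bar> \<le> \<bar>a - b\<bar>"
proof -
  have *: "ln a - ln b \<le> \<bar>a - b\<bar>" if "1 \<le> a" "1 \<le> b" for a b :: real
  proof -
    have "ln a - ln b = ln (a / b)" using that by (simp add: ln_div)
    also have "\<dots> \<le> a / b - 1" using that by (intro ln_le_minus_one) auto
    also have "\<dots> = (a - b) / b" using that by (simp add: field_simps)
    also have "\<dots> \<le> \<bar>a - b\<bar> / b" using that by (intro divide_right_mono) auto
    also have "\<dots> \<le> \<bar>a - b\<bar> / 1" using that by (intro divide_left_mono) auto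
    finally show ?thesis by simp
  qed
  show ?thesis by (rule abs_leI) (use *[OF assms] *[OF assms(2,1)] in \<open>simp_all add: abs_minus_commute\<close>)
qed

text \<open>The rate is a multiple of \<open>ln (2 + y) - ln (1 + y)\<close>.\<close>

lemma shannon_rate_lipschitz:
  assumes "B > 0" "x \<ge> 0" "y \<ge> 0"
  shows "\<bar>shannon_rate B x - shannon_rate B y\<bar> \<le> 2 * B / ln 2 * \<bar>x - y\<bar>"
proof -
  have eq: "shannon_rate B x = B / ln 2 * (ln (2 + x) - ln (1 + x))" if "x \<ge> 0" for x
  proof -
    have "1 + 1 / (1 + x) = (2 + x) / (1 + x)" using that by (simp add: field_simps)
    then show ?thesis using that by (simp add: shannon_rate_def log_def ln_div)
  qed
  have "shannon_rate B x - shannon_rate B y =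
      B / ln 2 * ((ln (2 + x) - ln (2 + y)) - (ln (1 + x) - ln (1 + y)))"
    by (simp add: eq assms right_diff_distrib)
  also have "\<bar>\<dots>\<bar> \<le> B / ln 2 * (2 * \<bar>x - y\<bar>)"
    unfolding abs_mult
  proof (intro mult_mono)
    have "\<bar>ln (2 + x) - ln (2 + y)\<bar> \<le> \<bar>x - y\<bar>" "\<bar>ln (1 + x) - ln (1 + y)\<bar> \<le> \<bar>x - y\<bar>"
      using ln_lipschitz_1[of "2 + x" "2 + y"] ln_lipschitz_1[of "1 + x" "1 + y"] assms by simp_all
    then show "\<bar>ln (2 + x) - ln (2 + y) - (ln (1 + x) - ln (1 + y))\<bar> \<le> 2 * \<bar>x - y\<bar>"
      by (intro order_trans[OF abs_triangle_ineq4]) simp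
  qed (use assms in auto)
  finally show ?thesis by (simp add: algebra_simps)
qed

lemma path_loss_nonneg:
  assumes "path_loss l" "r \<ge> 0"
  shows "l r \<ge> 0"
  using assms unfolding path_loss_def by (elim exE conjE disjE) (auto simp: powr_ge_zero)

lemma torus_dist_nonneg:
  assumes "i \<in> {1..N}" "j \<in> {1..N}"
  shows "torus_dist N i j \<ge> 0"
  using assms by (auto simp: torus_dist_def)

lemma birth_death_step_bound:
  assumes "0 \<le> a" "0 \<le> b" "a + b \<le> 1" "\<And>x. \<bar>g x\<bar> \<le> 1"
  shows "\<bar>birth_death_step a b g x\<bar> \<le> 1"
proof -
  have "\<bar>birth_death_step a b g x\<bar> \<le> \<bar>(1 - a - b) * g x\<bar> + \<bar>a * g (x + 1)\<bar> + \<bar>b * g (x - 1)\<bar>"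
    unfolding birth_death_step_def by linarith
  also have "\<dots> \<le> (1 - a - b) * 1 + a * 1 + b * 1"
    unfolding abs_mult using assms by (intro add_mono mult_mono) auto
  finally show ?thesis by simp
qed

lemma birth_death_step_rate_change:
  "birth_death_step a b g x - birth_death_step a b' g x = (b' - b) * (g x - g (x - 1))"
  by (simp add: birth_death_step_def algebra_simps)

lemma replica_rate_eq:
  assumes "K \<ge> 1"
  shows "replica_rate N B l K i q =
    shannon_rate B (\<Sum>j\<in>{1..N} - {i}. l (torus_dist N i j) * ((\<Sum>r\<in>{1..K}. of_bool (q (r, j) > 0)) / real K))"
proof -
  have "1 / real K * (\<Sum>k\<in>{1..K}. \<Sum>j\<in>{1..N} - {i}. of_bool (q (k, j) > 0) * l (torus_dist N i j)) =
     (\<Sum>j\<in>{1..N} - {i}. l (torus_dist N i j) * ((\<Sum>r\<in>{1..K}. of_bool (q (r, j) > 0)) / real K))"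
    by (subst sum.swap) (simp add: sum_distrib_left sum_distrib_right sum_divide_distrib mult.commute)
  then show ?thesis by (simp add: replica_rate_def shannon_rate_def)
qed

lemma mf_rate_eq: "mf_rate M N B l q z = shannon_rate B (measure M {\<omega> \<in> space M. q 1 1 z \<omega> > 0} * xi N l)"
  by (simp add: mf_rate_def shannon_rate_def)

locale queue_parameters =
  fixes N K :: nat and B lam :: real and l :: "real \<Rightarrow> real"
  assumes N: "N \<ge> 2" and K: "K \<ge> 1" and B: "B > 0" and lam: "lam > 0" and l: "path_loss l"
begin

lemma loss_nonneg: "i \<in> {1..N} \<Longrightarrow> j \<in> {1..N} \<Longrightarrow> 0 \<le> l (torus_dist N i j)"
  using path_loss_nonneg[OF l torus_dist_nonneg] .

lemma xi_nonneg: "0 \<le> xi N l"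
  unfolding xi_def by (rule sum_nonneg) (use loss_nonneg N in auto)

lemma loss_le_xi:
  assumes "i \<in> {1..N}" "j \<in> {1..N} - {i}"
  shows "l (torus_dist N i j) \<le> xi N l"
  unfolding xi_translation_invariant[OF assms(1), of l, symmetric]
  by (rule member_le_sum) (use assms loss_nonneg in auto)

definition replica_mean :: "(nat \<Rightarrow> real) \<Rightarrow> nat \<Rightarrow> (nat \<times> nat \<Rightarrow> nat) \<Rightarrow> real" where
  "replica_mean f j q = (\<Sum>r\<in>{1..K}. f (q (r, j))) / real K"

definition busy :: "nat \<Rightarrow> real" where "busy x = of_bool (x > 0)"

lemma replica_mean_bound:
  assumes "\<And>x. \<bar>f x\<bar> \<le> c"
  shows "\<bar>replica_mean f j q\<bar> \<le> c"
proof -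
  have "\<bar>\<Sum>r\<in>{1..K}. f (q (r, j))\<bar> \<le> (\<Sum>r\<in>{1..K}. \<bar>f (q (r, j))\<bar>)" by (rule sum_abs)
  also have "\<dots> \<le> (\<Sum>r\<in>{1..K}. c)" by (rule sum_mono) (rule assms)
  also have "\<dots> = real K * c" by simp
  finally show ?thesis using K unfolding replica_mean_def abs_divide by (simp add: field_simps)
qed

lemma busy_bound: "\<bar>busy x\<bar> \<le> 1" by (simp add: busy_def)
lemma replica_mean_busy_nonneg: "0 \<le> replica_mean busy j q" unfolding replica_mean_def busy_def
    by (intro divide_nonneg_nonneg sum_nonneg) auto

lemma replica_rate_eq_shannon:
  "replica_rate N B l K i q = shannon_rate B (\<Sum>j\<in>{1..N} - {i}. l (torus_dist N i j) * replica_mean busy j q)"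
  unfolding replica_rate_eq[OF K] replica_mean_def busy_def by simp

lemma replica_rate_bounds:
  assumes "i \<in> {1..N}"
  shows "0 < replica_rate N B l K i q" "replica_rate N B l K i q \<le> B"
proof -
  have "0 \<le> (\<Sum>j\<in>{1..N} - {i}. l (torus_dist N i j) * replica_mean busy j q)"
    by (intro sum_nonneg mult_nonneg_nonneg replica_mean_busy_nonneg) (use loss_nonneg assms in auto)
  then show "0 < replica_rate N B l K i q" "replica_rate N B l K i q \<le> B"
    unfolding replica_rate_eq_shannon using shannon_rate_bounds[OF B] by auto
qed

text \<open>Lipschitz constant of the service rate as a function of the busy fraction.\<close>

definition load_lipschitz :: real where "load_lipschitz = 2 * B / ln 2 * xi N l"

lemma load_lipschitz_nonneg: "0 \<le> load_lipschitz" unfolding load_lipschitz_def using B xi_nonneg by simp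

text \<open>By translation invariance of the torus, \<open>p * xi\<close> is the interference at position \<open>i\<close> when every other
  position is busy with probability \<open>p\<close>.\<close>

lemma replica_rate_deviation:
  assumes i: "i \<in> {1..N}" and p: "0 \<le> p"
  shows "\<bar>replica_rate N B l K i q - shannon_rate B (p * xi N l)\<bar> \<le> load_lipschitz * (\<Sum>j\<in>{1..N}. \<bar>replica_mean busy j q - p\<bar>)"
proof -
  have "p * xi N l = (\<Sum>j\<in>{1..N} - {i}. l (torus_dist N i j) * p)"
    by (simp add: xi_translation_invariant[OF i, of l, symmetric] sum_distrib_left mult.commute)
  then have 1: "\<bar>replica_rate N B l K i q - shannon_rate B (p * xi N l)\<bar> \<le>
      2 * B / ln 2 * \<bar>(\<Sum>j\<in>{1..N} - {i}. l (torus_dist N i j) * replica_mean busy j q) - (\<Sum>j\<in>{1..N} - {i}. l (torus_dist N i j)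
          * p)\<bar>"
    unfolding replica_rate_eq_shannon
    by (simp only:) (intro shannon_rate_lipschitz[OF B] sum_nonneg mult_nonneg_nonneg replica_mean_busy_nonneg p;
        use loss_nonneg i in auto)
  have "(\<Sum>j\<in>{1..N} - {i}. l (torus_dist N i j) * replica_mean busy j q) - (\<Sum>j\<in>{1..N} - {i}. l (torus_dist N i j) * p)
      = (\<Sum>j\<in>{1..N} - {i}. l (torus_dist N i j) * (replica_mean busy j q - p))"
    by (simp add: sum_subtractf right_diff_distrib)
  also have "\<bar>\<dots>\<bar> \<le> (\<Sum>j\<in>{1..N} - {i}. \<bar>l (torus_dist N i j) * (replica_mean busy j q - p)\<bar>)" by (rule sum_abs)
  also have "\<dots> \<le> (\<Sum>j\<in>{1..N} - {i}. xi N l * \<bar>replica_mean busy j q - p\<bar>)"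
    unfolding abs_mult by (intro sum_mono mult_right_mono) (use loss_nonneg loss_le_xi[OF i] i in auto)
  also have "\<dots> \<le> (\<Sum>j\<in>{1..N}. xi N l * \<bar>replica_mean busy j q - p\<bar>)"
    by (intro sum_mono2) (use xi_nonneg in auto)
  also have "\<dots> = xi N l * (\<Sum>j\<in>{1..N}. \<bar>replica_mean busy j q - p\<bar>)" by (simp add: sum_distrib_left)
  finally have 2: "\<bar>(\<Sum>j\<in>{1..N} - {i}. l (torus_dist N i j) * replica_mean busy j q) - (\<Sum>j\<in>{1..N} -
      {i}. l (torus_dist N i j) * p)\<bar>
      \<le> xi N l * (\<Sum>j\<in>{1..N}. \<bar>replica_mean busy j q - p\<bar>)" .
  have "0 \<le> 2 * B / ln 2" using B by simp
  from order_trans[OF 1 mult_left_mono[OF 2 this]] show ?thesis by (simp only: load_lipschitz_def mult.assoc)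
qed

abbreviation sites :: "(nat \<times> nat) set" where "sites \<equiv> {1..K} \<times> {1..N}"
abbreviation rate :: "nat \<Rightarrow> (nat \<times> nat \<Rightarrow> nat) \<Rightarrow> real" where "rate \<equiv> replica_rate N B l K"
abbreviation gen :: "((nat \<times> nat \<Rightarrow> nat) \<Rightarrow> real) \<Rightarrow> (nat \<times> nat \<Rightarrow> nat) \<Rightarrow> real" where
  "gen \<equiv> replica_generator N B lam l K"

definition total_rate :: real where "total_rate = 2 * (real K * real N * (lam + B))"

text \<open>At an empty queue truncated subtraction gives \<open>q(z := q z - 1) = q\<close>, so the difference absorbs the indicator.\<close>

lemma gen_eq: "gen f q = lam * (\<Sum>z\<in>sites. f (q(z := q z + 1)) - f q) -
    (\<Sum>z\<in>sites. rate (snd z) q * (f q - f (q(z := q z - 1))))"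
proof -
  have "(case z of (r, i) \<Rightarrow> rate i q * (f q - f (q((r, i) := q (r, i) - 1))) * of_bool (q (r, i) > 0)) =
      rate (snd z) q * (f q - f (q(z := q z - 1)))" for z
  proof (cases "q z > 0")
    case True then show ?thesis by (cases z) simp
  next
    case False
    then have "q(z := q z - 1) = q" by (simp add: fun_upd_idem)
    then show ?thesis using False by (cases z) simp
  qed
  then have b: "(\<Sum>(r, i)\<in>sites. rate i q * (f q - f (q((r, i) := q (r, i) - 1))) * of_bool (q (r, i) > 0)) =
      (\<Sum>z\<in>sites. rate (snd z) q * (f q - f (q(z := q z - 1))))" by (intro sum.cong refl)
  have a: "(\<Sum>(r, i)\<in>sites. f (q((r, i) := q (r, i) + 1)) - f q) = (\<Sum>z\<in>sites. f (q(z := q z + 1)) - f q)"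
    by (rule sum.cong) auto
  show ?thesis unfolding replica_generator_def a b ..
qed

lemma gen_bound:
  assumes "\<And>q. \<bar>f q\<bar> \<le> c"
  shows "\<bar>gen f q\<bar> \<le> total_rate * c"
proof -
  have d: "\<bar>f q - f q'\<bar> \<le> 2 * c" for q q' using assms[of q] assms[of q'] by linarith
  have "\<bar>\<Sum>z\<in>sites. f (q(z := q z + 1)) - f q\<bar> \<le> (\<Sum>z\<in>sites. 2 * c)"
    by (rule order_trans[OF sum_abs]) (intro sum_mono d)
  then have 1: "\<bar>lam * (\<Sum>z\<in>sites. f (q(z := q z + 1)) - f q)\<bar> \<le> lam * (real K * real N * (2 * c))"
    using lam by (simp add: abs_mult)
  have "\<bar>\<Sum>z\<in>sites. rate (snd z) q * (f q - f (q(z := q z - 1)))\<bar> \<le> (\<Sum>z\<in>sites. B * (2 * c))"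
  proof (rule order_trans[OF sum_abs], rule sum_mono)
    fix z assume "z \<in> sites"
    then have "snd z \<in> {1..N}" by auto
    then show "\<bar>rate (snd z) q * (f q - f (q(z := q z - 1)))\<bar> \<le> B * (2 * c)"
      unfolding abs_mult using replica_rate_bounds[of "snd z" q] d[of q "q(z := q z - 1)"] by (intro mult_mono) auto
  qed
  then have 2: "\<bar>\<Sum>z\<in>sites. rate (snd z) q * (f q - f (q(z := q z - 1)))\<bar> \<le> real K * real N * (B * (2 * c))" by simp
  show ?thesis unfolding gen_eq total_rate_def using 1 2 by (simp add: algebra_simps)
qed

lemma gen_coordinate:
  assumes "r \<in> {1..K}" "i \<in> {1..N}"
  shows "g (q (r, i)) + h * gen (\<lambda>q. g (q (r, i))) q = birth_death_step (lam * h) (rate i q * h) g (q (r, i))"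
proof -
  have "(\<Sum>z\<in>sites. g ((q(z := q z + 1)) (r, i)) - g (q (r, i))) =
      (\<Sum>z\<in>sites. if z = (r, i) then g (q (r, i) + 1) - g (q (r, i)) else 0)"
    by (rule sum.cong) auto
  also have "\<dots> = g (q (r, i) + 1) - g (q (r, i))" using assms by (subst sum.delta) auto
  finally have 1: "(\<Sum>z\<in>sites. g ((q(z := q z + 1)) (r, i)) - g (q (r, i))) = g (q (r, i) + 1) - g (q (r, i))" .
  have "(\<Sum>z\<in>sites. rate (snd z) q * (g (q (r, i)) - g ((q(z := q z - 1)) (r, i)))) =
      (\<Sum>z\<in>sites. if z = (r, i) then rate i q * (g (q (r, i)) - g (q (r, i) - 1)) else 0)"
    by (rule sum.cong) auto
  also have "\<dots> = rate i q * (g (q (r, i)) - g (q (r, i) - 1))" using assms by (subst sum.delta) auto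
  finally have 2: "(\<Sum>z\<in>sites. rate (snd z) q * (g (q (r, i)) - g ((q(z := q z - 1)) (r, i)))) =
      rate i q * (g (q (r, i)) - g (q (r, i) - 1))" .
  show ?thesis unfolding gen_eq 1 2 by (simp add: birth_death_step_def algebra_simps)
qed

lemma replica_mean_update:
  assumes "z \<in> sites"
  shows "replica_mean f j (q(z := v)) - replica_mean f j q = (if snd z = j then (f v - f (q z)) / real K else 0)"
proof -
  define r where "r = fst z"
  define i where "i = snd z"
  have r: "r \<in> {1..K}" using assms by (auto simp: r_def)
  have "replica_mean f j (q(z := v)) - replica_mean f j q = (\<Sum>r'\<in>{1..K}. f ((q(z := v)) (r', j)) - f (q (r', j))) / real K"
    by (simp add: replica_mean_def sum_subtractf diff_divide_distrib)
  also have "(\<Sum>r'\<in>{1..K}. f ((q(z := v)) (r', j)) - f (q (r', j))) =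
      (\<Sum>r'\<in>{1..K}. if r' = r then (if i = j then f v - f (q z) else 0) else 0)"
    by (rule sum.cong) (auto simp: r_def i_def prod_eq_iff)
  also have "\<dots> = (if i = j then f v - f (q z) else 0)" using r by (subst sum.delta) auto
  finally have e: "replica_mean f j (q(z := v)) - replica_mean f j q = (if i = j then f v - f (q z) else 0) / real K" .
  show ?thesis unfolding e i_def by simp
qed

lemma sum_sites_row:
  assumes "j \<in> {1..N}"
  shows "(\<Sum>z\<in>sites. if snd z = j then G z else (0::real)) = (\<Sum>r\<in>{1..K}. G (r, j))"
proof -
  have "(\<Sum>z\<in>sites. if snd z = j then G z else 0) = (\<Sum>r\<in>{1..K}. \<Sum>i\<in>{1..N}. if i = j then G (r, i) else 0)"
    by (subst sum.cartesian_product, rule sum.cong) auto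
  also have "\<dots> = (\<Sum>r\<in>{1..K}. G (r, j))" using assms by (intro sum.cong) auto
  finally show ?thesis .
qed

text \<open>To first order the generator moves an empirical mean like the birth-death chain with the present rate at
  the position.\<close>

lemma gen_empirical:
  assumes j: "j \<in> {1..N}"
  shows "replica_mean f j q - c + h * gen (\<lambda>q. replica_mean f j q - c) q =
      replica_mean (birth_death_step (lam * h) (rate j q * h) f) j q - c"
proof -
  have "(\<Sum>z\<in>sites. (replica_mean f j (q(z := q z + 1)) - c) - (replica_mean f j q - c)) =
      (\<Sum>z\<in>sites. if snd z = j then (f (q z + 1) - f (q z)) / real K else 0)"
    by (rule sum.cong) (simp_all add: replica_mean_update del: One_nat_def)
  then have 1: "(\<Sum>z\<in>sites. (replica_mean f j (q(z := q z + 1)) - c) - (replica_mean f j q - c)) =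
      (\<Sum>r\<in>{1..K}. (f (q (r, j) + 1) - f (q (r, j))) / real K)" by (simp only: sum_sites_row[OF j])
  have "(\<Sum>z\<in>sites. rate (snd z) q * ((replica_mean f j q - c) - (replica_mean f j (q(z := q z - 1)) - c))) =
      (\<Sum>z\<in>sites. if snd z = j then rate j q * ((f (q z) - f (q z - 1)) / real K) else 0)"
  proof (rule sum.cong)
    fix z assume z: "z \<in> sites"
    have "(replica_mean f j q - c) - (replica_mean f j (q(z := q z - 1)) - c) = - (replica_mean f j (q(z :=
        q z - 1)) - replica_mean f j q)" by simp
    also have "\<dots> = (if snd z = j then (f (q z) - f (q z - 1)) / real K else 0)"
      unfolding replica_mean_update[OF z] by (simp add: minus_divide_left)
    finally show "rate (snd z) q * ((replica_mean f j q - c) - (replica_mean f j (q(z := q z - 1)) - c)) =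
        (if snd z = j then rate j q * ((f (q z) - f (q z - 1)) / real K) else 0)" by simp
  qed simp
  then have 2: "(\<Sum>z\<in>sites. rate (snd z) q * ((replica_mean f j q - c) - (replica_mean f j (q(z := q z - 1)) - c))) =
      (\<Sum>r\<in>{1..K}. rate j q * ((f (q (r, j)) - f (q (r, j) - 1)) / real K))" by (simp only: sum_sites_row[OF j])
  have "replica_mean (birth_death_step (lam * h) (rate j q * h) f) j q =
      (\<Sum>r\<in>{1..K}. f (q (r, j)) / real K + h * (lam * ((f (q (r, j) + 1) - f (q (r, j))) / real K)) -
         h * (rate j q * ((f (q (r, j)) - f (q (r, j) - 1)) / real K)))"
    unfolding replica_mean_def sum_divide_distrib
    by (rule sum.cong) (use K in \<open>simp_all add: birth_death_step_def field_simps del: One_nat_def\<close>)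
  then show ?thesis unfolding gen_eq 1 2
    by (simp add: replica_mean_def sum.distrib sum_subtractf sum_distrib_left sum_divide_distrib right_diff_distrib del:
        One_nat_def)
qed

text \<open>The excess of the generator of a square over the chain rule is the quadratic variation: each of the \<open>K\<close> queues at
  position \<open>j\<close> jumps at rate at most \<open>lam + B\<close> and changes the empirical mean by at most \<open>2 / K\<close>.\<close>

lemma gen_square:
  fixes c :: real
  assumes j: "j \<in> {1..N}" and f: "\<And>x. \<bar>f x\<bar> \<le> 1"
  defines "\<Phi> \<equiv> \<lambda>q. replica_mean f j q - c"
  shows "gen (\<lambda>q. (\<Phi> q)\<^sup>2) q \<le> 2 * \<Phi> q * gen \<Phi> q + 4 * (lam + B) / real K"
proof -
  define G where "G v z = (if snd z = j then ((f v - f (q z)) / real K)\<^sup>2 else 0)" for v and z :: "nat \<times> nat"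
  have G: "G v z \<le> (if snd z = j then 4 / (real K)\<^sup>2 else 0)" for v z
  proof -
    have "\<bar>f v - f (q z)\<bar> \<le> 2" using f[of v] f[of "q z"] by linarith
    then have "(f v - f (q z))\<^sup>2 \<le> 2\<^sup>2" by (intro power2_le_iff_abs_le[THEN iffD2]) auto
    then show ?thesis using K by (auto simp: G_def power_divide intro!: divide_right_mono)
  qed
  have sq: "(\<Phi> (q(z := v)))\<^sup>2 - (\<Phi> q)\<^sup>2 = 2 * \<Phi> q * (\<Phi> (q(z := v)) - \<Phi> q) + G v z" if "z \<in> sites" for z v
  proof -
    have "\<Phi> (q(z := v)) - \<Phi> q = (if snd z = j then (f v - f (q z)) / real K else 0)"
      using replica_mean_update[OF that, of f j q v] by (simp add: \<Phi>_def)
    then have "(\<Phi> (q(z := v)) - \<Phi> q)\<^sup>2 = G v z" by (simp add: G_def)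
    then show ?thesis by (simp add: power2_eq_square algebra_simps)
  qed
  have 1: "(\<Sum>z\<in>sites. (\<Phi> (q(z := q z + 1)))\<^sup>2 - (\<Phi> q)\<^sup>2) =
      2 * \<Phi> q * (\<Sum>z\<in>sites. \<Phi> (q(z := q z + 1)) - \<Phi> q) + (\<Sum>z\<in>sites. G (q z + 1) z)"
    unfolding sum_distrib_left sum.distrib[symmetric] by (rule sum.cong) (simp_all add: sq del: One_nat_def)
  have 2: "(\<Sum>z\<in>sites. rate (snd z) q * ((\<Phi> q)\<^sup>2 - (\<Phi> (q(z := q z - 1)))\<^sup>2)) =
      2 * \<Phi> q * (\<Sum>z\<in>sites. rate (snd z) q * (\<Phi> q - \<Phi> (q(z := q z - 1)))) - (\<Sum>z\<in>sites. rate (snd z) q * G (q z - 1) z)"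
    unfolding sum_distrib_left sum_subtractf[symmetric]
  proof (rule sum.cong)
    fix z assume z: "z \<in> sites"
    have "(\<Phi> q)\<^sup>2 - (\<Phi> (q(z := q z - 1)))\<^sup>2 = 2 * \<Phi> q * (\<Phi> q - \<Phi> (q(z := q z - 1))) - G (q z - 1) z"
      using sq[OF z, of "q z - 1"] by (simp add: algebra_simps)
    then show "rate (snd z) q * ((\<Phi> q)\<^sup>2 - (\<Phi> (q(z := q z - 1)))\<^sup>2) =
        2 * \<Phi> q * (rate (snd z) q * (\<Phi> q - \<Phi> (q(z := q z - 1)))) - rate (snd z) q * G (q z - 1) z"
      by (simp only:) (simp add: algebra_simps)
  qed simp
  have row: "(\<Sum>z\<in>sites. if snd z = j then 4 / (real K)\<^sup>2 else 0) = 4 / real K"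
    using K by (subst sum_sites_row[OF j, of "\<lambda>_. 4 / (real K)\<^sup>2"]) (simp add: power2_eq_square)
  have "(\<Sum>z\<in>sites. G (q z + 1) z) \<le> 4 / real K"
    unfolding row[symmetric] by (intro sum_mono G)
  then have 3: "lam * (\<Sum>z\<in>sites. G (q z + 1) z) \<le> lam * (4 / real K)" using lam by (intro mult_left_mono) auto
  have "(\<Sum>z\<in>sites. rate (snd z) q * G (q z - 1) z) \<le> (\<Sum>z\<in>sites. B * (if snd z = j then 4 / (real K)\<^sup>2 else 0))"
  proof (rule sum_mono)
    fix z assume "z \<in> sites"
    then have "snd z \<in> {1..N}" by auto
    then show "rate (snd z) q * G (q z - 1) z \<le> B * (if snd z = j then 4 / (real K)\<^sup>2 else 0)"
      using replica_rate_bounds[of "snd z" q] G[of "q z - 1" z] B by (intro mult_mono) (auto simp: G_def)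
  qed
  also have "\<dots> = B * (4 / real K)" by (simp only: sum_distrib_left[symmetric] row)
  finally have 4: "(\<Sum>z\<in>sites. rate (snd z) q * G (q z - 1) z) \<le> B * (4 / real K)" .
  have "gen (\<lambda>q. (\<Phi> q)\<^sup>2) q = 2 * \<Phi> q * gen \<Phi> q + lam * (\<Sum>z\<in>sites. G (q z + 1) z) + (\<Sum>z\<in>sites. rate (snd z) q * G (q z -
      1) z)"
    unfolding gen_eq 1 2 by (simp add: algebra_simps)
  then show ?thesis using 3 4 by (simp add: algebra_simps add_divide_distrib)
qed

end


section \<open>Comparing the replica system with a mean-field chain\<close>

locale replica_chain = prob_space M + queue_parameters N K B lam l
  for M :: "'w measure" and N K :: nat and B lam :: real and l :: "real \<Rightarrow> real" +
  fixes Q :: "real \<Rightarrow> 'w \<Rightarrow> nat \<times> nat \<Rightarrow> nat"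
  assumes system: "replica_system M N B lam l K Q"
begin

lemma chain: "markov_chain_with_generator M (replica_states N K) Q gen"
  using system by (simp add: replica_system_def)

lemma Q_meas: "t \<ge> 0 \<Longrightarrow> Q t \<in> measurable M (count_space (replica_states N K))"
  using chain by (simp add: markov_chain_with_generator_def)

lemma states: "countable (replica_states N K)" "replica_states N K \<noteq> {}"
  unfolding replica_states_def by (auto intro!: countable_PiE simp: PiE_eq_empty_iff)

lemma Q_integrable:
  fixes G :: "(nat \<times> nat \<Rightarrow> nat) \<Rightarrow> real"
  assumes "t \<ge> 0" "\<And>q. \<bar>G q\<bar> \<le> c"
  shows "integrable M (\<lambda>\<omega>. G (Q t \<omega>))"
  by (rule integrable_discrete[OF Q_meas[OF assms(1)]]) (rule assms(2))

lemma step: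
  fixes F :: "(nat \<times> nat \<Rightarrow> nat) list \<Rightarrow> (nat \<times> nat \<Rightarrow> nat) \<Rightarrow> real"
  assumes "h \<ge> 0" "\<And>w y. \<bar>F w y\<bar> \<le> c"
  shows "\<bar>expectation (\<lambda>\<omega>. F (map (\<lambda>j. Q (real j * h) \<omega>) [0..<Suc k]) (Q (real (Suc k) * h) \<omega>)) -
     expectation (\<lambda>\<omega>. F (map (\<lambda>j. Q (real j * h) \<omega>) [0..<Suc k]) (Q (real k * h) \<omega>) +
       h * gen (F (map (\<lambda>j. Q (real j * h) \<omega>) [0..<Suc k])) (Q (real k * h) \<omega>))\<bar> \<le> h\<^sup>2 * total_rate\<^sup>2 * c"
  by (rule markov_chain_step[where \<Lambda> = total_rate and c = c, OF prob_space_axioms chain states])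
     (use assms gen_bound in auto)

end

text \<open>Here \<open>e k f\<close> is the expectation of \<open>f\<close> at step \<open>k\<close> of a chain with death rates \<open>m k\<close>. The chain
  obeys the birth-death dynamics up to \<open>c1 * h\<^sup>2\<close> per step, and \<open>m k\<close> is up to \<open>c2 * h\<close> the rate that belongs to the busy
  probability \<open>e k busy\<close> of the chain itself.\<close>

locale mean_field_comparison = replica_chain +
  fixes h c1 c2 :: real and n :: nat and e :: "nat \<Rightarrow> (nat \<Rightarrow> real) \<Rightarrow> real" and m :: "nat \<Rightarrow> real"
  assumes h: "0 < h" "h \<le> 1" "(lam + B) * h \<le> 1"
    and e_bound: "\<And>k f. (\<And>x. \<bar>f x\<bar> \<le> 1) \<Longrightarrow> \<bar>e k f\<bar> \<le> 1"
    and e_busy: "\<And>k. 0 \<le> e k busy"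
    and m: "\<And>k. 0 < m k" "\<And>k. m k \<le> B"
    and c12: "0 \<le> c1" "0 \<le> c2"
    and e_step: "\<And>k f. (\<And>x. \<bar>f x\<bar> \<le> 1) \<Longrightarrow> \<bar>e (Suc k) f - e k (birth_death_step (lam * h) (m k * h) f)\<bar> \<le> c1 * h\<^sup>2"
    and m_rate: "\<And>k. k \<le> n \<Longrightarrow> \<bar>m k - shannon_rate B (e k busy * xi N l)\<bar> \<le> c2 * h"
    and initial: "\<And>j f. j \<in> {1..N} \<Longrightarrow> (\<And>x. \<bar>f x\<bar> \<le> 1) \<Longrightarrow> expectation (\<lambda>\<omega>. (replica_mean f j (Q 0 \<omega>) - e 0 f)\<^sup>2) \<le> 1 / real K"
begin

lemma rate_second_moment:
  assumes k: "k \<le> n" and i: "i \<in> {1..N}"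
    and W: "\<And>j. j \<in> {1..N} \<Longrightarrow> expectation (\<lambda>\<omega>. (replica_mean busy j (Q (real k * h) \<omega>) - e k busy)\<^sup>2) \<le> W"
  shows "expectation (\<lambda>\<omega>. (rate i (Q (real k * h) \<omega>) - m k)\<^sup>2) \<le> 2 * load_lipschitz\<^sup>2 * (real N)\<^sup>2 * W + 2 * c2\<^sup>2 * h\<^sup>2"
proof -
  define S where "S q = (\<Sum>j\<in>{1..N}. (replica_mean busy j q - e k busy)\<^sup>2)" for q
  have kh: "0 \<le> real k * h" using h by simp
  have sq1: "(replica_mean busy j q - e k busy)\<^sup>2 \<le> 4" for j q
  proof -
    have "\<bar>replica_mean busy j q - e k busy\<bar> \<le> 2"
      using replica_mean_bound[where f = busy and c = 1 and j = j and q = q] e_bound[where k = k and f = busy] busy_bound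
          by fastforce
    then have "(replica_mean busy j q - e k busy)\<^sup>2 \<le> 2\<^sup>2" by (intro power2_le_iff_abs_le[THEN iffD2]) auto
    then show ?thesis by simp
  qed
  have pointwise: "(rate i q - m k)\<^sup>2 \<le> 2 * load_lipschitz\<^sup>2 * real N * S q + 2 * c2\<^sup>2 * h\<^sup>2" for q
  proof -
    define \<rho> where "\<rho> = shannon_rate B (e k busy * xi N l)"
    have "(\<Sum>j\<in>{1..N}. \<bar>replica_mean busy j q - e k busy\<bar>)\<^sup>2 \<le> (\<Sum>j\<in>{1..N}. \<bar>replica_mean busy j q -
        e k busy\<bar>\<^sup>2) * real (card {1..N})"
      by (rule sum_squared_le_sum_of_squares)
    then have cs: "(\<Sum>j\<in>{1..N}. \<bar>replica_mean busy j q - e k busy\<bar>)\<^sup>2 \<le> real N * S q" by (simp add: S_def mult.commute)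
    have "\<bar>rate i q - \<rho>\<bar> \<le> load_lipschitz * (\<Sum>j\<in>{1..N}. \<bar>replica_mean busy j q - e k busy\<bar>)"
      unfolding \<rho>_def by (rule replica_rate_deviation[OF i e_busy])
    then have "(rate i q - \<rho>)\<^sup>2 \<le> (load_lipschitz * (\<Sum>j\<in>{1..N}. \<bar>replica_mean busy j q - e k busy\<bar>))\<^sup>2"
      using power_mono[of "\<bar>rate i q - \<rho>\<bar>" _ 2] by simp
    also have "\<dots> \<le> load_lipschitz\<^sup>2 * (real N * S q)" unfolding power_mult_distrib by (rule mult_left_mono[OF cs]) simp
    finally have 1: "(rate i q - \<rho>)\<^sup>2 \<le> load_lipschitz\<^sup>2 * (real N * S q)" .
    have "(m k - \<rho>)\<^sup>2 \<le> (c2 * h)\<^sup>2"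
      using power_mono[OF m_rate[OF k], of 2] by (simp add: \<rho>_def)
    moreover have "(rate i q - m k)\<^sup>2 \<le> 2 * (rate i q - \<rho>)\<^sup>2 + 2 * (m k - \<rho>)\<^sup>2"
      using sum_squares_bound[of "rate i q - \<rho>" "\<rho> - m k"] by (simp add: power2_eq_square algebra_simps)
    ultimately show ?thesis using 1 by (simp add: power_mult_distrib algebra_simps)
  qed
  have bS: "\<bar>S q\<bar> \<le> real N * 4" for q
  proof -
    have "S q \<le> (\<Sum>j\<in>{1..N}. 4)" unfolding S_def by (rule sum_mono[OF sq1])
    moreover have "0 \<le> S q" unfolding S_def by (rule sum_nonneg) simp
    ultimately show ?thesis by simp
  qed
  have br: "\<bar>(rate i q - m k)\<^sup>2\<bar> \<le> 2 * load_lipschitz\<^sup>2 * real N * (real N * 4) + 2 * c2\<^sup>2 * h\<^sup>2" for q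
  proof -
    have "2 * load_lipschitz\<^sup>2 * real N * S q \<le> 2 * load_lipschitz\<^sup>2 * real N * (real N * 4)"
      using bS[of q] by (intro mult_left_mono) auto
    then show ?thesis using pointwise[of q] by (simp only: abs_power2)
  qed
  have intS: "integrable M (\<lambda>\<omega>. S (Q (real k * h) \<omega>))" by (rule Q_integrable[OF kh bS])
  have "expectation (\<lambda>\<omega>. (rate i (Q (real k * h) \<omega>) - m k)\<^sup>2) \<le>
      expectation (\<lambda>\<omega>. 2 * load_lipschitz\<^sup>2 * real N * S (Q (real k * h) \<omega>) + 2 * c2\<^sup>2 * h\<^sup>2)"
    by (rule integral_mono[OF Q_integrable[OF kh, where G = "\<lambda>q. (rate i q - m k)\<^sup>2", OF br]])
       (use intS pointwise in auto)
  also have "\<dots> = 2 * load_lipschitz\<^sup>2 * real N * expectation (\<lambda>\<omega>. S (Q (real k * h) \<omega>)) + 2 * c2\<^sup>2 * h\<^sup>2"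
    using intS by (simp add: prob_space)
  also have "expectation (\<lambda>\<omega>. S (Q (real k * h) \<omega>)) =
      (\<Sum>j\<in>{1..N}. expectation (\<lambda>\<omega>. (replica_mean busy j (Q (real k * h) \<omega>) - e k busy)\<^sup>2))"
    unfolding S_def
    by (rule Bochner_Integration.integral_sum, rule Q_integrable[OF kh, where c = 4]) (use sq1 in simp)
  also have "2 * load_lipschitz\<^sup>2 * real N * \<dots> \<le> 2 * load_lipschitz\<^sup>2 * real N * (\<Sum>j\<in>{1..N}. W)"
    by (intro mult_left_mono sum_mono W) auto
  finally show ?thesis by (simp add: power2_eq_square algebra_simps)
qed

definition growth :: real where "growth = 1 + 32 * load_lipschitz\<^sup>2 * (real N)\<^sup>2"
definition remainder_const :: real where "remainder_const = 4 * total_rate\<^sup>2 + 32 * c2\<^sup>2 + 4 * c1\<^sup>2"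
definition increment_bound :: real where "increment_bound = 4 * (lam + B) * h / real K + remainder_const * h\<^sup>2"
text \<open>An explicit supersolution of the recursion \<open>w\<^sub>k\<^sub>+\<^sub>1 = (1 + growth * h) w\<^sub>k + increment_bound\<close> with
  \<open>w\<^sub>0 = 1/K\<close>.\<close>

definition variance_bound :: "nat \<Rightarrow> real" where
  "variance_bound k = (1 + growth * h) ^ k * (1 / real K + real k * increment_bound)"

lemma bounds_nonneg: "0 \<le> growth" "0 \<le> remainder_const" "0 \<le> increment_bound"
  using h lam B K by (auto simp: growth_def remainder_const_def increment_bound_def)

lemma variance_bound_Suc: "(1 + growth * h) * variance_bound k + increment_bound \<le> variance_bound (Suc k)"
proof -
  have "1 \<le> (1 + growth * h) ^ Suc k" using bounds_nonneg h by (intro one_le_power) simp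
  then have "1 * increment_bound \<le> (1 + growth * h) ^ Suc k * increment_bound" using bounds_nonneg
      by (intro mult_right_mono) auto
  moreover have "variance_bound (Suc k) = (1 + growth * h) * variance_bound k + (1 + growth * h) ^ Suc k * increment_bound"
    by (simp add: variance_bound_def algebra_simps add_divide_distrib)
  ultimately show ?thesis by simp
qed

text \<open>One step of the Gronwall argument: with \<open>\<Phi>\<close> the deviation at time \<open>(k + 1) h\<close>, \<open>gen_square\<close> gives
  \<open>E \<Phi>\<^sup>2 \<le> E (\<Phi> + h L \<Phi>)\<^sup>2 + O(h/K) + O(h\<^sup>2)\<close> with the right-hand side taken at time \<open>k h\<close>. Here \<open>\<Phi> + h L \<Phi>\<close> is the deviation
      \<open>\<alpha>\<close> for the function \<open>g\<close> obtained from
  \<open>f\<close> by one birth-death step, which is again bounded by \<open>1\<close>, plus \<open>h\<close> times an error \<open>\<beta>\<close> that is controlled by the error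
  of the rate, and therefore by the induction hypothesis for \<open>f = busy\<close>.\<close>

lemma empirical_variance:
  assumes "k \<le> n" "j \<in> {1..N}" "\<And>x. \<bar>f x\<bar> \<le> 1"
  shows "expectation (\<lambda>\<omega>. (replica_mean f j (Q (real k * h) \<omega>) - e k f)\<^sup>2) \<le> variance_bound k"
  using assms
proof (induction k arbitrary: j f)
  case 0
  then show ?case using initial[of j f] by (simp add: variance_bound_def)
next
  case (Suc k)
  define V where "V = variance_bound k"
  note k = Suc.prems(1) and j = Suc.prems(2) and f = Suc.prems(3)
  have IH: "expectation (\<lambda>\<omega>. (replica_mean g i (Q (real k * h) \<omega>) - e k g)\<^sup>2) \<le> V"
    if "i \<in> {1..N}" "\<And>x. \<bar>g x\<bar> \<le> 1" for i g
    unfolding V_def by (rule Suc.IH) (use k that in auto)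
  have kh: "0 \<le> real k * h" using h by simp
  define c where "c = e (Suc k) f"
  define \<Phi> where "\<Phi> q = replica_mean f j q - c" for q
  have cb: "\<bar>c\<bar> \<le> 1" unfolding c_def by (rule e_bound) (rule f)
  have \<Phi>b: "\<bar>\<Phi> q\<bar> \<le> 2" for q
    using replica_mean_bound[where f = f and c = 1 and j = j and q = q, OF f] cb by (simp add: \<Phi>_def)
  have \<Phi>2: "\<bar>(\<Phi> q)\<^sup>2\<bar> \<le> 4" for q
    using power_mono[OF \<Phi>b[of q], of 2] by simp
  define g where "g = birth_death_step (lam * h) (m k * h) f"
  have "(lam + m k) * h \<le> (lam + B) * h" using h m by (intro mult_right_mono) auto
  then have "lam * h + m k * h \<le> 1" using h(3) by (simp add: algebra_simps)
  then have g: "\<bar>g x\<bar> \<le> 1" for x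
    unfolding g_def by (intro birth_death_step_bound) (use h lam m f in \<open>auto simp: less_imp_le\<close>)
  define \<alpha> where "\<alpha> q = replica_mean g j q - e k g" for q
  have \<alpha>b: "\<bar>(\<alpha> q)\<^sup>2\<bar> \<le> 4" for q
  proof -
    have "\<bar>e k g\<bar> \<le> 1" by (rule e_bound) (rule g)
    then have "\<bar>\<alpha> q\<bar> \<le> 2" using replica_mean_bound[where f = g and c = 1 and j = j and q = q, OF g] by (simp add: \<alpha>_def)
    then show ?thesis using power_mono[of "\<bar>\<alpha> q\<bar>" 2 2] by simp
  qed
  have rb: "0 < rate j q" "rate j q \<le> B" for q using replica_rate_bounds[OF j] by auto
  have rdb: "\<bar>(rate j q - m k)\<^sup>2\<bar> \<le> (2 * B)\<^sup>2" for q
  proof -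
    have "\<bar>rate j q - m k\<bar> \<le> 2 * B" using rb[of q] m[of k] B by linarith
    then show ?thesis using power_mono[of "\<bar>rate j q - m k\<bar>" "2 * B" 2] by simp
  qed
  define R where "R q = (1 + h) * (\<alpha> q)\<^sup>2 + 2 * h * (8 * (rate j q - m k)\<^sup>2 + 2 * c1\<^sup>2 * h\<^sup>2) + 4 * (lam + B) * h / real K"
      for q
  have pointwise: "(\<Phi> q)\<^sup>2 + h * gen (\<lambda>q. (\<Phi> q)\<^sup>2) q \<le> R q" for q
  proof -
    \<comment> \<open>The error of the first-order step, relative to \<open>h\<close>: wrong rate and error of the mean-field chain.\<close>
    define \<beta> where "\<beta> = (\<Phi> q + h * gen \<Phi> q - \<alpha> q) / h"
    have replica_mean_diff: "replica_mean (birth_death_step (lam * h) (rate j q * h) f) j q - replica_mean g j q =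
        replica_mean (\<lambda>x. (m k * h - rate j q * h) * (f x - f (x - 1))) j q"
      unfolding replica_mean_def g_def by (simp only: diff_divide_distrib[symmetric] sum_subtractf[symmetric]
          birth_death_step_rate_change)
    have "\<bar>replica_mean (\<lambda>x. (m k * h - rate j q * h) * (f x - f (x - 1))) j q\<bar> \<le> \<bar>rate j q - m k\<bar> * h * 2"
    proof (rule replica_mean_bound)
      fix x
      have "\<bar>f x - f (x - 1)\<bar> \<le> 2" using f[of x] f[of "x - 1"] by linarith
      moreover have "\<bar>m k * h - rate j q * h\<bar> = \<bar>rate j q - m k\<bar> * h"
        using h by (simp add: left_diff_distrib[symmetric] abs_mult abs_minus_commute)
      ultimately show "\<bar>(m k * h - rate j q * h) * (f x - f (x - 1))\<bar> \<le> \<bar>rate j q - m k\<bar> * h * 2"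
        using h unfolding abs_mult by (intro mult_mono) auto
    qed
    moreover have "\<Phi> q + h * gen \<Phi> q = replica_mean (birth_death_step (lam * h) (rate j q * h) f) j q - c"
      unfolding \<Phi>_def[abs_def] by (rule gen_empirical[OF j])
    moreover have "\<bar>c - e k g\<bar> \<le> c1 * h\<^sup>2" unfolding c_def g_def by (rule e_step) (rule f)
    ultimately have "\<bar>\<Phi> q + h * gen \<Phi> q - \<alpha> q\<bar> \<le> \<bar>rate j q - m k\<bar> * h * 2 + c1 * h\<^sup>2"
      using replica_mean_diff unfolding \<alpha>_def by linarith
    also have "\<dots> = (2 * \<bar>rate j q - m k\<bar> + c1 * h) * h" by (simp add: power2_eq_square algebra_simps)
    finally have "\<bar>\<beta>\<bar> \<le> 2 * \<bar>rate j q - m k\<bar> + c1 * h"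
      using h by (simp add: \<beta>_def abs_divide pos_divide_le_eq)
    then have "\<beta>\<^sup>2 \<le> (2 * \<bar>rate j q - m k\<bar> + c1 * h)\<^sup>2" using power_mono[of "\<bar>\<beta>\<bar>" _ 2] by simp
    also have "\<dots> \<le> 8 * (rate j q - m k)\<^sup>2 + 2 * c1\<^sup>2 * h\<^sup>2"
      using sum_squares_bound[of "2 * \<bar>rate j q - m k\<bar>" "c1 * h"] by (simp add: power2_sum power_mult_distrib)
    finally have \<beta>2: "\<beta>\<^sup>2 \<le> 8 * (rate j q - m k)\<^sup>2 + 2 * c1\<^sup>2 * h\<^sup>2" .
    have ab: "\<Phi> q + h * gen \<Phi> q = \<alpha> q + h * \<beta>" using h by (simp add: \<beta>_def)
    have "(\<Phi> q)\<^sup>2 + h * gen (\<lambda>q. (\<Phi> q)\<^sup>2) q \<le> (\<Phi> q)\<^sup>2 + h * (2 * \<Phi> q * gen \<Phi> q + 4 * (lam + B) / real K)"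
      using gen_square[where f = f and c = c and q = q, OF j f] h unfolding \<Phi>_def[abs_def]
          by (intro add_left_mono mult_left_mono) auto
    also have "\<dots> \<le> (\<Phi> q + h * gen \<Phi> q)\<^sup>2 + 4 * (lam + B) * h / real K"
    proof -
      have "(\<Phi> q + h * gen \<Phi> q)\<^sup>2 = (\<Phi> q)\<^sup>2 + h * (2 * \<Phi> q * gen \<Phi> q) + (h * gen \<Phi> q)\<^sup>2"
        by (simp add: power2_eq_square algebra_simps)
      moreover have "h * (4 * (lam + B) / real K) = 4 * (lam + B) * h / real K" by simp
      moreover have "0 \<le> (h * gen \<Phi> q)\<^sup>2" by simp
      ultimately show ?thesis by (simp only: distrib_left)
    qed
    also have "(\<Phi> q + h * gen \<Phi> q)\<^sup>2 \<le> (1 + h) * (\<alpha> q)\<^sup>2 + 2 * h * \<beta>\<^sup>2"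
    proof -
      have "2 * (\<alpha> q * \<beta>) \<le> (\<alpha> q)\<^sup>2 + \<beta>\<^sup>2" using sum_squares_bound[of "\<alpha> q" \<beta>] by (simp add: mult.assoc)
      then have "h * (2 * (\<alpha> q * \<beta>)) \<le> h * ((\<alpha> q)\<^sup>2 + \<beta>\<^sup>2)" using h by (intro mult_left_mono) auto
      moreover have "h\<^sup>2 * \<beta>\<^sup>2 \<le> h * \<beta>\<^sup>2" using h by (intro mult_right_mono) (auto simp: power2_eq_square mult_left_le)
      moreover have "(\<alpha> q + h * \<beta>)\<^sup>2 = (\<alpha> q)\<^sup>2 + h * (2 * (\<alpha> q * \<beta>)) + h\<^sup>2 * \<beta>\<^sup>2"
          by (simp add: power2_eq_square algebra_simps)
      ultimately show ?thesis unfolding ab by (simp add: algebra_simps)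
    qed
    also have "2 * h * \<beta>\<^sup>2 \<le> 2 * h * (8 * (rate j q - m k)\<^sup>2 + 2 * c1\<^sup>2 * h\<^sup>2)" using \<beta>2 h by (intro mult_left_mono) auto
    finally show ?thesis by (simp add: R_def)
  qed
  have int: "integrable M (\<lambda>\<omega>. (\<alpha> (Q (real k * h) \<omega>))\<^sup>2)" "integrable M (\<lambda>\<omega>. (rate j (Q (real k * h) \<omega>) - m k)\<^sup>2)"
    by (rule Q_integrable[OF kh, where c = 4], rule \<alpha>b, rule Q_integrable[OF kh, where c = "(2 * B)\<^sup>2"], rule rdb)
  have intR: "integrable M (\<lambda>\<omega>. R (Q (real k * h) \<omega>))" unfolding R_def using int by auto
  have genb: "\<bar>(\<Phi> q)\<^sup>2 + h * gen (\<lambda>q. (\<Phi> q)\<^sup>2) q\<bar> \<le> 4 + h * (total_rate * 4)" for q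
  proof -
    have "\<bar>h * gen (\<lambda>q. (\<Phi> q)\<^sup>2) q\<bar> \<le> h * (total_rate * 4)"
      using gen_bound[where f = "\<lambda>q. (\<Phi> q)\<^sup>2" and c = 4, OF \<Phi>2] h by (simp add: abs_mult)
    then show ?thesis using \<Phi>2[of q] by linarith
  qed
  have "\<bar>expectation (\<lambda>\<omega>. (\<Phi> (Q (real (Suc k) * h) \<omega>))\<^sup>2) -
      expectation (\<lambda>\<omega>. (\<Phi> (Q (real k * h) \<omega>))\<^sup>2 + h * gen (\<lambda>q. (\<Phi> q)\<^sup>2) (Q (real k * h) \<omega>))\<bar> \<le> h\<^sup>2 * total_rate\<^sup>2 * 4"
    using step[where F = "\<lambda>_ q. (\<Phi> q)\<^sup>2" and c = 4 and h = h and k = k] h \<Phi>2 by simp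
  moreover have "expectation (\<lambda>\<omega>. (\<Phi> (Q (real k * h) \<omega>))\<^sup>2 + h * gen (\<lambda>q. (\<Phi> q)\<^sup>2) (Q (real k * h) \<omega>)) \<le>
      expectation (\<lambda>\<omega>. R (Q (real k * h) \<omega>))"
    by (rule integral_mono[OF Q_integrable[OF kh, where G = "\<lambda>q. (\<Phi> q)\<^sup>2 + h * gen (\<lambda>q. (\<Phi> q)\<^sup>2) q", OF genb] intR pointwise])
  moreover have "expectation (\<lambda>\<omega>. R (Q (real k * h) \<omega>)) =
      (1 + h) * expectation (\<lambda>\<omega>. (\<alpha> (Q (real k * h) \<omega>))\<^sup>2) +
      2 * h * (8 * expectation (\<lambda>\<omega>. (rate j (Q (real k * h) \<omega>) - m k)\<^sup>2) + 2 * c1\<^sup>2 * h\<^sup>2) + 4 * (lam + B) * h / real K"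
    unfolding R_def using int by (simp add: prob_space)
  moreover have "(1 + h) * expectation (\<lambda>\<omega>. (\<alpha> (Q (real k * h) \<omega>))\<^sup>2) \<le> (1 + h) * V"
    using IH[of j g, OF j g] h unfolding \<alpha>_def by (intro mult_left_mono) auto
  moreover have "expectation (\<lambda>\<omega>. (rate j (Q (real k * h) \<omega>) - m k)\<^sup>2) \<le> 2 * load_lipschitz\<^sup>2 * (real N)\<^sup>2 * V +
      2 * c2\<^sup>2 * h\<^sup>2"
    by (rule rate_second_moment[OF _ j IH[of _ busy, OF _ busy_bound]]) (use k in auto)
  then have "2 * h * (8 * expectation (\<lambda>\<omega>. (rate j (Q (real k * h) \<omega>) - m k)\<^sup>2) + 2 * c1\<^sup>2 * h\<^sup>2) \<le>
      2 * h * (8 * (2 * load_lipschitz\<^sup>2 * (real N)\<^sup>2 * V + 2 * c2\<^sup>2 * h\<^sup>2) + 2 * c1\<^sup>2 * h\<^sup>2)"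
    using h by (intro mult_left_mono add_right_mono) auto
  ultimately have "expectation (\<lambda>\<omega>. (\<Phi> (Q (real (Suc k) * h) \<omega>))\<^sup>2) \<le> (1 + h) * V +
      2 * h * (8 * (2 * load_lipschitz\<^sup>2 * (real N)\<^sup>2 * V + 2 * c2\<^sup>2 * h\<^sup>2) + 2 * c1\<^sup>2 * h\<^sup>2) + 4 * (lam + B) * h / real K +
          h\<^sup>2 * total_rate\<^sup>2 * 4"
    by linarith
  also have "\<dots> = (1 + growth * h) * V + 4 * (lam + B) * h / real K + 4 * total_rate\<^sup>2 * h\<^sup>2 + (32 * c2\<^sup>2 +
      4 * c1\<^sup>2) * h\<^sup>2 * h"
    by (simp add: growth_def algebra_simps)
  also have "\<dots> \<le> (1 + growth * h) * V + 4 * (lam + B) * h / real K + 4 * total_rate\<^sup>2 * h\<^sup>2 + (32 * c2\<^sup>2 +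
      4 * c1\<^sup>2) * h\<^sup>2 * 1"
    using h by (intro add_left_mono mult_left_mono) auto
  also have "\<dots> = (1 + growth * h) * V + increment_bound" by (simp add: increment_bound_def remainder_const_def algebra_simps)
  also have "\<dots> \<le> variance_bound (Suc k)" unfolding V_def by (rule variance_bound_Suc)
  finally show ?case by (simp add: \<Phi>_def c_def)
qed

lemma variance_bound_mono:
  assumes "k \<le> n"
  shows "variance_bound k \<le> variance_bound n"
  unfolding variance_bound_def
  by (intro mult_mono power_increasing add_left_mono mult_right_mono)
     (use assms bounds_nonneg h in \<open>auto intro!: add_nonneg_nonneg mult_nonneg_nonneg\<close>)

lemma rate_deviation:
  assumes "k \<le> n" "i \<in> {1..N}" "\<eta> > 0"
  shows "expectation (\<lambda>\<omega>. \<bar>rate i (Q (real k * h) \<omega>) - m k\<bar>) \<le>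
    \<eta> + (2 * load_lipschitz\<^sup>2 * (real N)\<^sup>2 * variance_bound n + 2 * c2\<^sup>2 * h\<^sup>2) / \<eta>"
proof -
  have kh: "0 \<le> real k * h" using h by simp
  have rb: "\<bar>rate i q - m k\<bar> \<le> 2 * B" for q using replica_rate_bounds[OF assms(2), of q] m[of k] B by linarith
  have "\<bar>(rate i q - m k)\<^sup>2\<bar> \<le> (2 * B)\<^sup>2" for q using power_mono[OF rb[of q], of 2] by simp
  then have int: "integrable M (\<lambda>\<omega>. (rate i (Q (real k * h) \<omega>) - m k)\<^sup>2)"
    by (rule Q_integrable[OF kh])
  have int2: "integrable M (\<lambda>\<omega>. \<bar>rate i (Q (real k * h) \<omega>) - m k\<bar>)"
    by (rule Q_integrable[OF kh, where c = "2 * B"]) (use rb in simp)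
  \<comment> \<open>This trades the first moment for the second one; the best \<open>\<eta>\<close> is of the order of the standard deviation.\<close>
  have *: "\<bar>x\<bar> \<le> \<eta> + x\<^sup>2 / \<eta>" for x :: real
  proof (cases "\<bar>x\<bar> \<le> \<eta>")
    case False
    then have "\<bar>x\<bar> * \<eta> \<le> \<bar>x\<bar> * \<bar>x\<bar>" by (intro mult_left_mono) auto
    then have "\<bar>x\<bar> \<le> x\<^sup>2 / \<eta>" using assms(3) by (simp add: pos_le_divide_eq power2_eq_square)
    then show ?thesis using assms(3) by simp
  qed (use assms(3) in \<open>simp add: add_increasing2\<close>)
  have "expectation (\<lambda>\<omega>. \<bar>rate i (Q (real k * h) \<omega>) - m k\<bar>) \<le>
      expectation (\<lambda>\<omega>. \<eta> + (rate i (Q (real k * h) \<omega>) - m k)\<^sup>2 / \<eta>)"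
    by (rule integral_mono) (use int int2 * in auto)
  also have "\<dots> = \<eta> + expectation (\<lambda>\<omega>. (rate i (Q (real k * h) \<omega>) - m k)\<^sup>2) / \<eta>" using int by (simp add: prob_space)
  also have "\<dots> \<le> \<eta> + (2 * load_lipschitz\<^sup>2 * (real N)\<^sup>2 * variance_bound n + 2 * c2\<^sup>2 * h\<^sup>2) / \<eta>"
  proof -
    have "expectation (\<lambda>\<omega>. (replica_mean busy j (Q (real k * h) \<omega>) - e k busy)\<^sup>2) \<le> variance_bound n" if "j \<in> {1..N}" for j
      using empirical_variance[where f = busy, OF assms(1) that busy_bound] variance_bound_mono[OF assms(1)] by linarith
    then show ?thesis using assms(3) by (intro add_left_mono divide_right_mono rate_second_moment[OF assms(1,2)]) auto
  qed
  finally show ?thesis .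
qed

text \<open>Both histories are advanced by one birth-death step, with rate \<open>rate i (Q (k h))\<close> and \<open>m k\<close> respectively. Replacing the
  first rate by the second costs \<open>2 h \<epsilon>\<close>; after that the step is absorbed into the test function, and the induction
  hypothesis applies to histories that are shorter by one.\<close>

lemma path_comparison:
  fixes Z :: "nat \<Rightarrow> 'a \<Rightarrow> nat" and F :: "nat list \<Rightarrow> real"
  assumes Zm: "\<And>k. Z k \<in> measurable M (count_space UNIV)"
    and Z_step: "\<And>k H. (\<And>w. \<bar>H w\<bar> \<le> 1) \<Longrightarrow>
      \<bar>expectation (\<lambda>\<omega>. H (map (\<lambda>j. Z j \<omega>) [0..<Suc (Suc k)])) -
       expectation (\<lambda>\<omega>. birth_death_step (lam * h) (m k * h) (\<lambda>x. H (map (\<lambda>j. Z j \<omega>) [0..<Suc k] @ [x])) (Z k \<omega>))\<bar> \<le> c3 * h\<^sup>2"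
    and r: "r \<in> {1..K}" and i: "i \<in> {1..N}"
    and Z0: "AE \<omega> in M. Q 0 \<omega> (r, i) = Z 0 \<omega>"
    and eps: "\<And>k. k < n \<Longrightarrow> expectation (\<lambda>\<omega>. \<bar>rate i (Q (real k * h) \<omega>) - m k\<bar>) \<le> \<epsilon>"
    and k: "k \<le> n" and F: "\<And>w. \<bar>F w\<bar> \<le> 1"
  shows "\<bar>expectation (\<lambda>\<omega>. F (map (\<lambda>j. Q (real j * h) \<omega> (r, i)) [0..<Suc k])) -
     expectation (\<lambda>\<omega>. F (map (\<lambda>j. Z j \<omega>) [0..<Suc k]))\<bar> \<le> real k * (2 * h * \<epsilon> + (total_rate\<^sup>2 + c3) * h\<^sup>2)"
  using k F
proof (induction k arbitrary: F)
  case 0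
  have "expectation (\<lambda>\<omega>. F (map (\<lambda>j. Q (real j * h) \<omega> (r, i)) [0..<Suc 0])) =
      expectation (\<lambda>\<omega>. F (map (\<lambda>j. Z j \<omega>) [0..<Suc 0]))"
  proof (rule integral_cong_AE)
    show "(\<lambda>\<omega>. F (map (\<lambda>j. Q (real j * h) \<omega> (r, i)) [0..<Suc 0])) \<in> borel_measurable M"
      using measurable_compose[OF Q_meas[of 0], of "\<lambda>q. F [q (r, i)]" borel] by simp
    show "(\<lambda>\<omega>. F (map (\<lambda>j. Z j \<omega>) [0..<Suc 0])) \<in> borel_measurable M"
      using measurable_compose[OF Zm[of 0], of "\<lambda>z. F [z]" borel] by simp
    show "AE \<omega> in M. F (map (\<lambda>j. Q (real j * h) \<omega> (r, i)) [0..<Suc 0]) = F (map (\<lambda>j. Z j \<omega>) [0..<Suc 0])"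
      using Z0 by eventually_elim simp
  qed
  then show ?case by simp
next
  case (Suc k)
  note F = Suc.prems(2)
  have kn: "k < n" using Suc.prems(1) by simp
  have kh: "0 \<le> real k * h" using h by simp
  define hist where "hist \<omega> = map (\<lambda>j. Q (real j * h) \<omega>) [0..<Suc k]" for \<omega>
  define y where "y w = map (\<lambda>q. q (r, i)) w" for w :: "(nat \<times> nat \<Rightarrow> nat) list"
  have histm: "hist \<in> measurable M (count_space (lists (replica_states N K)))"
    unfolding hist_def[abs_def] by (rule measurable_map_list[OF states(1)]) (use h Q_meas in auto)
  have last: "last (hist \<omega>) = Q (real k * h) \<omega>" for \<omega> by (simp add: hist_def)
  have yh: "y (hist \<omega>) = map (\<lambda>j. Q (real j * h) \<omega> (r, i)) [0..<Suc k]" for \<omega> by (simp add: y_def hist_def)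
  define G where "G w = birth_death_step (lam * h) (m k * h) (\<lambda>x. F (w @ [x])) (last w)" for w
  have "(lam + m k) * h \<le> (lam + B) * h" using h m by (intro mult_right_mono) auto
  then have "lam * h + m k * h \<le> 1" using h(3) by (simp add: algebra_simps)
  then have G: "\<bar>G w\<bar> \<le> 1" for w
    unfolding G_def by (intro birth_death_step_bound) (use h lam m F in \<open>auto simp: less_imp_le\<close>)
  \<comment> \<open>\<open>G'\<close> advances the history of the replica system with its own rate, \<open>G\<close> with the mean-field rate.\<close>
  define G' where "G' w = birth_death_step (lam * h) (rate i (last w) * h) (\<lambda>x. F (y w @ [x])) (last w (r, i))" for w
  have G': "\<bar>G' w\<bar> \<le> 1" for w
  proof -
    note rb = replica_rate_bounds[OF i, of "last w"]
    have "(lam + rate i (last w)) * h \<le> (lam + B) * h" using h rb by (intro mult_right_mono) auto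
    then have "lam * h + rate i (last w) * h \<le> 1" using h(3) by (simp add: algebra_simps)
    then show ?thesis unfolding G'_def by (intro birth_death_step_bound) (use h lam rb F in \<open>auto simp: less_imp_le\<close>)
  qed
  have lasty: "last (y (hist \<omega>)) = last (hist \<omega>) (r, i)" for \<omega> by (simp add: y_def hist_def)
  have "\<bar>expectation (\<lambda>\<omega>. F (y (hist \<omega>) @ [Q (real (Suc k) * h) \<omega> (r, i)])) -
      expectation (\<lambda>\<omega>. F (y (hist \<omega>) @ [Q (real k * h) \<omega> (r, i)]) +
         h * gen (\<lambda>q. F (y (hist \<omega>) @ [q (r, i)])) (Q (real k * h) \<omega>))\<bar> \<le> h\<^sup>2 * total_rate\<^sup>2 * 1"
    unfolding hist_def
    by (rule step[where F = "\<lambda>w q. F (y w @ [q (r, i)])" and c = 1]) (use h F in auto)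
  moreover have "F (y (hist \<omega>) @ [Q (real k * h) \<omega> (r, i)]) +
         h * gen (\<lambda>q. F (y (hist \<omega>) @ [q (r, i)])) (Q (real k * h) \<omega>) = G' (hist \<omega>)" for \<omega>
    unfolding G'_def last by (rule gen_coordinate[OF r i])
  moreover have "y (hist \<omega>) @ [Q (real (Suc k) * h) \<omega> (r, i)] = map (\<lambda>j. Q (real j * h) \<omega> (r, i)) [0..<Suc (Suc k)]" for \<omega>
    unfolding yh by simp
  ultimately have 1: "\<bar>expectation (\<lambda>\<omega>. F (map (\<lambda>j. Q (real j * h) \<omega> (r, i)) [0..<Suc (Suc k)])) -
      expectation (\<lambda>\<omega>. G' (hist \<omega>))\<bar> \<le> h\<^sup>2 * total_rate\<^sup>2" by (simp only: mult_1_right)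
  have 2: "\<bar>expectation (\<lambda>\<omega>. G' (hist \<omega>)) - expectation (\<lambda>\<omega>. G (y (hist \<omega>)))\<bar> \<le> 2 * h * \<epsilon>"
  proof -
    have int: "integrable M (\<lambda>\<omega>. G' (hist \<omega>))" "integrable M (\<lambda>\<omega>. G (y (hist \<omega>)))"
      by (rule integrable_discrete[OF histm, where c = 1], rule G',
          rule integrable_discrete[OF histm, where c = 1 and G = "\<lambda>w. G (y w)"], rule G)
    have rb: "\<bar>rate i q - m k\<bar> \<le> 2 * B" for q using replica_rate_bounds[OF i, of q] m[of k] B by linarith
    have intr: "integrable M (\<lambda>\<omega>. \<bar>rate i (Q (real k * h) \<omega>) - m k\<bar>)"
      by (rule Q_integrable[OF kh, where c = "2 * B"]) (use rb in simp)
    have "\<bar>expectation (\<lambda>\<omega>. G' (hist \<omega>)) - expectation (\<lambda>\<omega>. G (y (hist \<omega>)))\<bar> =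
        \<bar>expectation (\<lambda>\<omega>. G' (hist \<omega>) - G (y (hist \<omega>)))\<bar>" by (simp only: Bochner_Integration.integral_diff[OF int])
    also have "\<dots> \<le> expectation (\<lambda>\<omega>. \<bar>G' (hist \<omega>) - G (y (hist \<omega>))\<bar>)" by (rule integral_abs_bound)
    also have "\<dots> \<le> expectation (\<lambda>\<omega>. 2 * h * \<bar>rate i (Q (real k * h) \<omega>) - m k\<bar>)"
    proof (rule integral_mono)
      fix \<omega>
      define g where "g x = F (y (hist \<omega>) @ [x])" for x
      define x where "x = last (hist \<omega>) (r, i)"
      have "G' (hist \<omega>) - G (y (hist \<omega>)) = (m k * h - rate i (Q (real k * h) \<omega>) * h) * (g x - g (x - 1))"
        unfolding G'_def G_def lasty g_def[symmetric] x_def[symmetric] last[symmetric]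
        by (rule birth_death_step_rate_change)
      also have "\<bar>\<dots>\<bar> = h * \<bar>rate i (Q (real k * h) \<omega>) - m k\<bar> * \<bar>g x - g (x - 1)\<bar>"
        using h by (simp add: abs_mult left_diff_distrib[symmetric] abs_minus_commute)
      also have "\<dots> \<le> h * \<bar>rate i (Q (real k * h) \<omega>) - m k\<bar> * 2"
      proof (rule mult_left_mono)
        show "\<bar>g x - g (x - 1)\<bar> \<le> 2" using F[of "y (hist \<omega>) @ [x]"] F[of "y (hist \<omega>) @ [x - 1]"] unfolding g_def by linarith
      qed (use h in simp)
      finally show "\<bar>G' (hist \<omega>) - G (y (hist \<omega>))\<bar> \<le> 2 * h * \<bar>rate i (Q (real k * h) \<omega>) - m k\<bar>" by (simp add: mult_ac)
    qed (use int intr in auto)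
    also have "\<dots> \<le> 2 * h * \<epsilon>" using eps[OF kn] h by simp
    finally show ?thesis .
  qed
  have 3: "\<bar>expectation (\<lambda>\<omega>. G (y (hist \<omega>))) - expectation (\<lambda>\<omega>. G (map (\<lambda>j. Z j \<omega>) [0..<Suc k]))\<bar>
      \<le> real k * (2 * h * \<epsilon> + (total_rate\<^sup>2 + c3) * h\<^sup>2)"
    unfolding yh by (rule Suc.IH[OF _ G]) (use kn in simp)
  have 4: "\<bar>expectation (\<lambda>\<omega>. F (map (\<lambda>j. Z j \<omega>) [0..<Suc (Suc k)])) - expectation (\<lambda>\<omega>. G (map (\<lambda>j. Z j \<omega>) [0..<Suc k]))\<bar> \<le>
      c3 * h\<^sup>2"
    using Z_step[of F k, OF F] by (simp add: G_def)
  have "real (Suc k) * (2 * h * \<epsilon> + (total_rate\<^sup>2 + c3) * h\<^sup>2) =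
      real k * (2 * h * \<epsilon> + (total_rate\<^sup>2 + c3) * h\<^sup>2) + 2 * h * \<epsilon> + h\<^sup>2 * total_rate\<^sup>2 + c3 * h\<^sup>2"
    by (simp add: algebra_simps)
  then show ?case using 1 2 3 4 by linarith
qed

end


section \<open>The McKean--Vlasov system and the limit\<close>

lemma (in prob_space) iid_empirical_variance:
  fixes Y :: "'i \<Rightarrow> 'a \<Rightarrow> nat" and f :: "nat \<Rightarrow> real"
  assumes I: "finite I" "I \<noteq> {}" and indep: "indep_vars (\<lambda>_. count_space UNIV) Y I"
    and mean: "\<And>i. i \<in> I \<Longrightarrow> expectation (\<lambda>\<omega>. f (Y i \<omega>)) = a" and f: "\<And>x. \<bar>f x\<bar> \<le> 1"
  shows "expectation (\<lambda>\<omega>. ((\<Sum>i\<in>I. f (Y i \<omega>)) / real (card I) - a)\<^sup>2) \<le> 1 / real (card I)"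
proof -
  have Ym: "Y i \<in> measurable M (count_space UNIV)" if "i \<in> I" for i
    using indep that unfolding indep_vars_def by auto
  define U where "U i \<omega> = f (Y i \<omega>) - a" for i \<omega>
  obtain i0 where "i0 \<in> I" using I by auto
  have intf: "integrable M (\<lambda>\<omega>. g (Y i \<omega>))" if "i \<in> I" "\<And>x. \<bar>g x\<bar> \<le> c" for i c and g :: "nat \<Rightarrow> real"
    by (rule integrable_discrete[OF Ym[OF that(1)]]) (rule that(2))
  have ab: "\<bar>a\<bar> \<le> 1"
    using expectation_diff_le[of "\<lambda>\<omega>. f (Y i0 \<omega>)" "\<lambda>_. 0" 1] intf[OF \<open>i0 \<in> I\<close>, of f 1, OF f] f mean[OF \<open>i0 \<in> I\<close>] by simp
  have Ub: "\<bar>f x - a\<bar> \<le> 2" for x using f[of x] ab by linarith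
  have Um: "U i \<in> borel_measurable M" if "i \<in> I" for i
    unfolding U_def[abs_def] by (rule measurable_compose[OF Ym[OF that], of "\<lambda>x. f x - a"]) simp
  have intUU: "integrable M (\<lambda>\<omega>. U i \<omega> * U j \<omega>)" if "i \<in> I" "j \<in> I" for i j
  proof (rule integrable_const_bound[where B = "2 * 2"])
    show "AE \<omega> in M. norm (U i \<omega> * U j \<omega>) \<le> 2 * 2"
      unfolding U_def real_norm_def abs_mult by (intro AE_I2 mult_mono Ub) auto
  qed (use Um that in auto)
  have EU: "expectation (U i) = 0" if "i \<in> I" for i
    unfolding U_def[abs_def] using intf[OF that, of f 1, OF f] mean[OF that] by (simp add: prob_space)
  have cross: "expectation (\<lambda>\<omega>. U i \<omega> * U j \<omega>) = 0" if "i \<in> I" "j \<in> I" "i \<noteq> j" for i j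
  proof -
    have "indep_vars (\<lambda>_. borel) (\<lambda>i \<omega>. f (Y i \<omega>) - a) I"
      by (rule indep_vars_compose2[OF indep]) simp
    then have "indep_vars (\<lambda>_. borel) U {i, j}"
      unfolding U_def[abs_def] by (rule indep_vars_subset) (use that in auto)
    then have "expectation (\<lambda>\<omega>. \<Prod>k\<in>{i, j}. U k \<omega>) = (\<Prod>k\<in>{i, j}. expectation (U k))"
    proof (rule indep_vars_lebesgue_integral[rotated])
      show "integrable M (U k)" if "k \<in> {i, j}" for k
        unfolding U_def[abs_def] using that \<open>i \<in> I\<close> \<open>j \<in> I\<close>
        by (intro intf[of k "\<lambda>x. f x - a" 2] Ub) auto
    qed simp
    then show ?thesis using that EU by simp
  qed
  have diag: "expectation (\<lambda>\<omega>. U i \<omega> * U i \<omega>) \<le> 1" if "i \<in> I" for i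
  proof -
    have fb: "\<bar>f x * f x\<bar> \<le> 1" for x unfolding abs_mult by (rule mult_le_one) (use f[of x] in auto)
    have int1: "integrable M (\<lambda>\<omega>. f (Y i \<omega>))" "integrable M (\<lambda>\<omega>. f (Y i \<omega>) * f (Y i \<omega>))"
      using intf[OF that, of f 1, OF f] intf[OF that, of "\<lambda>x. f x * f x" 1, OF fb] by auto
    have "(\<lambda>\<omega>. U i \<omega> * U i \<omega>) = (\<lambda>\<omega>. f (Y i \<omega>) * f (Y i \<omega>) - 2 * a * f (Y i \<omega>) + a * a)"
      by (rule ext) (simp add: U_def algebra_simps)
    then have "expectation (\<lambda>\<omega>. U i \<omega> * U i \<omega>) = expectation (\<lambda>\<omega>. f (Y i \<omega>) * f (Y i \<omega>)) - 2 * a * a + a * a"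
      using int1 mean[OF that] by (simp add: prob_space)
    moreover have "expectation (\<lambda>\<omega>. f (Y i \<omega>) * f (Y i \<omega>)) \<le> 1"
      using expectation_diff_le[OF int1(2), of "\<lambda>_. 0" 1] fb by auto
    moreover have "0 \<le> a * a" by simp
    ultimately show ?thesis by linarith
  qed
  have n: "real (card I) > 0" using I by (simp add: card_gt_0_iff)
  have "((\<Sum>i\<in>I. f (Y i \<omega>)) / real (card I) - a)\<^sup>2 = (\<Sum>i\<in>I. \<Sum>j\<in>I. U i \<omega> * U j \<omega>) / (real (card I))\<^sup>2" for \<omega>
  proof -
    have "(\<Sum>i\<in>I. f (Y i \<omega>)) / real (card I) - a = (\<Sum>i\<in>I. U i \<omega>) / real (card I)"
      using n by (simp add: U_def sum_subtractf field_simps)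
    then show ?thesis by (simp add: power_divide power2_eq_square sum_product)
  qed
  then have "expectation (\<lambda>\<omega>. ((\<Sum>i\<in>I. f (Y i \<omega>)) / real (card I) - a)\<^sup>2) =
      (\<Sum>i\<in>I. \<Sum>j\<in>I. expectation (\<lambda>\<omega>. U i \<omega> * U j \<omega>)) / (real (card I))\<^sup>2"
    using intUU by simp
  also have "(\<Sum>i\<in>I. \<Sum>j\<in>I. expectation (\<lambda>\<omega>. U i \<omega> * U j \<omega>)) =
      (\<Sum>i\<in>I. \<Sum>j\<in>I. if j = i then expectation (\<lambda>\<omega>. U i \<omega> * U i \<omega>) else 0)"
    by (intro sum.cong refl) (use cross in auto)
  also have "\<dots> = (\<Sum>i\<in>I. expectation (\<lambda>\<omega>. U i \<omega> * U i \<omega>))" using I by simp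
  also have "\<dots> / (real (card I))\<^sup>2 \<le> (\<Sum>i\<in>I. 1) / (real (card I))\<^sup>2"
    by (intro divide_right_mono sum_mono diag) auto
  also have "\<dots> = 1 / real (card I)" using n by (simp add: power2_eq_square)
  finally show ?thesis .
qed

locale mean_field_system = prob_space M for M :: "'w measure" +
  fixes N :: nat and B lam :: real and l :: "real \<Rightarrow> real"
    and A :: "nat \<Rightarrow> nat \<Rightarrow> 'w \<Rightarrow> real measure"
    and D :: "nat \<Rightarrow> nat \<Rightarrow> 'w \<Rightarrow> (real \<times> real) measure"
    and q :: "nat \<Rightarrow> nat \<Rightarrow> real \<Rightarrow> 'w \<Rightarrow> nat"
  assumes N2: "N \<ge> 2" and Bpos: "B > 0" and lampos: "lam > 0" and loss: "path_loss l"
    and mf: "mf_system M N B lam l A D q"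
    and iid: "iid_with_finite_mean M ({1..} \<times> {1..N}) (\<lambda>(r, j). q r j 0)"
begin

abbreviation mu :: "real \<Rightarrow> real" where "mu \<equiv> mf_rate M N B l q"

definition p :: "real \<Rightarrow> real" where "p z = prob {\<omega> \<in> space M. q 1 1 z \<omega> > 0}"

lemma mu_eq: "mu z = shannon_rate B (p z * xi N l)"
  by (simp add: mf_rate_eq p_def)

text \<open>The constants of this locale used below are the same for every number of replicas, so they are taken
  from the instance with one replica.\<close>

sublocale params: queue_parameters N 1 B lam l
  by unfold_locales (use N2 Bpos lampos loss in auto)

lemma p_bounds: "0 \<le> p z" by (simp add: p_def)

lemma mu_bounds: "0 < mu z \<and> mu z \<le> B"
  unfolding mu_eq using shannon_rate_bounds[OF Bpos, of "p z * xi N l"] p_bounds params.xi_nonneg by simp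

lemma q_meas: "r \<ge> 1 \<Longrightarrow> i \<in> {1..N} \<Longrightarrow> t \<ge> 0 \<Longrightarrow> q r i t \<in> measurable M (count_space UNIV)"
  using mf unfolding mf_system_def by blast

lemma q_cadlag: "r \<ge> 1 \<Longrightarrow> i \<in> {1..N} \<Longrightarrow> \<omega> \<in> space M \<Longrightarrow> cadlag_on {0..} (\<lambda>t. q r i t \<omega>)"
  using mf unfolding mf_system_def by blast

lemma one_in: "1 \<in> {1..N}" using N2 by simp

lemma p_expectation:
  assumes "t \<ge> 0"
  shows "p t = expectation (\<lambda>\<omega>. of_bool (q 1 1 t \<omega> > 0))"
proof -
  have "{\<omega> \<in> space M. q 1 1 t \<omega> > 0} \<in> sets M"
    using measurable_sets[OF q_meas[OF order_refl one_in assms], of "{0<..}"] by (simp add: vimage_def Int_def conj_commute)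
  then have "p t = expectation (indicator {\<omega> \<in> space M. q 1 1 t \<omega> > 0})" by (simp add: p_def)
  also have "\<dots> = expectation (\<lambda>\<omega>. of_bool (q 1 1 t \<omega> > 0))"
    by (rule Bochner_Integration.integral_cong) (auto simp: indicator_def)
  finally show ?thesis .
qed

text \<open>Left limits of the paths pass to the probability by dominated convergence.\<close>

lemma p_left_limit:
  assumes z: "z > 0"
  shows "\<exists>L. (p \<longlongrightarrow> L) (at_left z)"
proof -
  define X where "X \<omega> = Lim (at_left z) (\<lambda>t. q 1 1 t \<omega>)" for \<omega>
  have X: "\<forall>\<^sub>F s in at_left z. q 1 1 s \<omega> = X \<omega>" if "\<omega> \<in> space M" for \<omega>
  proof -
    have "\<exists>l. ((\<lambda>t. q 1 1 t \<omega>) \<longlongrightarrow> l) (at_left z)"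
      by (rule cadlag_left_limit[OF q_cadlag[OF order_refl one_in that] z])
    then obtain l where l: "((\<lambda>t. q 1 1 t \<omega>) \<longlongrightarrow> l) (at_left z)" by blast
    then have "X \<omega> = l" unfolding X_def by (intro tendsto_Lim) simp_all
    then show ?thesis using l by (simp add: tendsto_discrete)
  qed
  define L :: real where "L = expectation (\<lambda>\<omega>. of_bool (X \<omega> > 0))"
  have "(p \<longlongrightarrow> L) (at_left z)"
  proof (rule tendsto_at_left_sequentially[OF z])
    fix S :: "nat \<Rightarrow> real" assume S: "\<And>n. S n < z" "\<And>n. 0 < S n" "S \<longlonglongrightarrow> z"
    have fl: "filterlim S (at_left z) sequentially"
      using S by (intro tendsto_imp_filterlim_at_left) auto
    have lim: "(\<lambda>n. of_bool (q 1 1 (S n) \<omega> > 0) :: real) \<longlonglongrightarrow> of_bool (X \<omega> > 0)" if "\<omega> \<in> space M" for \<omega>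
    proof (rule tendsto_eventually)
      have "\<forall>\<^sub>F n in sequentially. q 1 1 (S n) \<omega> = X \<omega>"
        using X[OF that] fl unfolding filterlim_iff by blast
      then show "\<forall>\<^sub>F n in sequentially. of_bool (q 1 1 (S n) \<omega> > 0) = (of_bool (X \<omega> > 0) :: real)"
        by eventually_elim simp
    qed
    have m: "(\<lambda>\<omega>. of_bool (q 1 1 (S n) \<omega> > 0) :: real) \<in> borel_measurable M" for n
      by (rule measurable_compose[OF q_meas[OF order_refl one_in less_imp_le[OF S(2)]], of "\<lambda>x. of_bool (x > 0)"]) simp
    have "(\<lambda>n. expectation (\<lambda>\<omega>. of_bool (q 1 1 (S n) \<omega> > 0))) \<longlonglongrightarrow> L"
      unfolding L_def
    proof (rule integral_dominated_convergence[where w = "\<lambda>_. 1"])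
      show "(\<lambda>\<omega>. of_bool (X \<omega> > 0) :: real) \<in> borel_measurable M"
        by (rule borel_measurable_LIMSEQ_real[OF lim m])
    qed (use lim m in auto)
    then show "(\<lambda>n. p (S n)) \<longlonglongrightarrow> L" using p_expectation[OF less_imp_le[OF S(2)]] by simp
  qed
  then show ?thesis by blast
qed

text \<open>The left limits of the rate enter the equation before the rate is known to be continuous; continuity is a
  consequence, by \<open>p_lipschitz\<close>.\<close>

lemma mu_left_limit:
  assumes z: "z > 0"
  shows "\<exists>L. (mu \<longlongrightarrow> L) (at_left z)"
proof -
  obtain L where L: "(p \<longlongrightarrow> L) (at_left z)" using p_left_limit[OF z] by blast
  have L0: "0 \<le> L" by (rule tendsto_lowerbound[OF L]) (use p_bounds in auto)
  have x: "0 \<le> L * xi N l" using L0 params.xi_nonneg by simp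
  have "0 < 1 / (1 + L * xi N l)" using x by simp
  then have "1 + 1 / (1 + L * xi N l) > 0" by linarith
  then have "((\<lambda>z. B * (ln (1 + 1 / (1 + p z * xi N l)) / ln 2)) \<longlongrightarrow> B * (ln (1 + 1 / (1 + L * xi N l)) / ln 2)) (at_left z)"
    by (intro tendsto_intros L) (use x in auto)
  then have "((\<lambda>z. shannon_rate B (p z * xi N l)) \<longlongrightarrow> shannon_rate B (L * xi N l)) (at_left z)"
    by (simp add: shannon_rate_def log_def)
  then show ?thesis unfolding mu_eq[abs_def] by blast
qed

lemma queue:
  assumes i: "i \<in> {1..N}"
  shows "queue_equation M (A 1 i) (D 1 i) (q 1 i) lam B mu"
proof unfold_locales
  show "poisson_random_measure M (halfline_intensity lam) (A 1 i)" "poisson_random_measure M quadrant_intensity (D 1 i)"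
    using mf i unfolding mf_system_def by blast+
  show "AE \<omega> in M. \<forall>t\<ge>0. real (q 1 i t \<omega>) = real (q 1 i 0 \<omega>) + measure (A 1 i \<omega>) {0..t} -
          (\<integral>(u, z). indicator ({0..} \<times> {0<..t}) (u, z) *
                    of_bool (Lim (at_left z) (\<lambda>s. q 1 i s \<omega>) > 0) *
                    of_bool (u \<le> Lim (at_left z) mu) \<partial>(D 1 i \<omega>))"
    using mf i unfolding mf_system_def by (elim conjE) (drule spec[of _ 1], simp)+
  fix S V W
  assume V: "V \<in> random_measure_events M (halfline_intensity lam) (A 1 i)"
    and W: "W \<in> random_measure_events M quadrant_intensity (D 1 i)"
  define E where "E s = (case s of Initial \<Rightarrow> q 1 i 0 -` S \<inter> space M | Arrival _ _ \<Rightarrow> V | Departure _ _ \<Rightarrow> W)" for s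
  have indep: "indep_sets (source_events M N lam A D q)
       ({Initial} \<union> {Arrival r i | r i. r \<ge> 1 \<and> i \<in> {1..N}} \<union> {Departure r i | r i. r \<ge> 1 \<and> i \<in> {1..N}})"
    using mf unfolding mf_system_def by blast
  have "q 1 i 0 -` S \<inter> space M \<in> initial_events M N q"
    unfolding initial_events_def by (rule sigma_sets.Basic) (use i in blast)
  then have "prob (\<Inter>s\<in>{Initial, Arrival 1 i, Departure 1 i}. E s) = (\<Prod>s\<in>{Initial, Arrival 1 i, Departure 1 i}. prob (E s))"
    by (intro indep_setsD[OF indep]) (use V W i in \<open>auto simp: E_def source_events_def\<close>)
  then show "prob ((q 1 i 0 -` S \<inter> space M) \<inter> V \<inter> W) = prob (q 1 i 0 -` S \<inter> space M) * prob V * prob W"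
    by (simp add: E_def Int_assoc mult.assoc)
qed (use lampos Bpos q_meas[OF order_refl i] q_cadlag[OF order_refl i] mu_bounds mu_left_limit in auto)

text \<open>The busy probability is Lipschitz with constant \<open>lam + B\<close>, a bound on the total jump rate of a queue.\<close>

definition Lc :: real where "Lc = 2 * B / ln 2 * xi N l * (lam + B)"

lemma p_lipschitz:
  assumes "0 \<le> s" "s \<le> t"
  shows "\<bar>p t - p s\<bar> \<le> (lam + B) * (t - s)"
proof -
  interpret X: queue_equation M "A 1 1" "D 1 1" "q 1 1" lam B mu by (rule queue[OF one_in])
  have "\<bar>p t - p s\<bar> \<le> prob {\<omega> \<in> space M. q 1 1 t \<omega> \<noteq> q 1 1 s \<omega>}"
  proof -
    let ?D = "{\<omega> \<in> space M. q 1 1 t \<omega> \<noteq> q 1 1 s \<omega>}"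
    have sets: "{\<omega> \<in> space M. q 1 1 u \<omega> > 0} \<in> sets M" if "u \<ge> 0" for u
      using measurable_sets[OF q_meas[OF order_refl one_in that], of "{0<..}"] by (simp add: vimage_def Int_def conj_commute)
    have "?D = (\<Union>k. (q 1 1 t -` {k} \<inter> space M) \<inter> (q 1 1 s -` (- {k}) \<inter> space M))" by auto
    also have "\<dots> \<in> sets M"
      by (intro sets.countable_UN'' sets.Int measurable_sets[OF q_meas[OF order_refl one_in]]) (use assms in auto)
    finally have D: "?D \<in> sets M" .
    have le: "prob {\<omega> \<in> space M. q 1 1 u \<omega> > 0} \<le> prob {\<omega> \<in> space M. q 1 1 v \<omega> > 0} + prob ?D"
      if "u \<ge> 0" "v \<ge> 0" "{u, v} = {s, t}" for u v
    proof -
      have "{\<omega> \<in> space M. q 1 1 u \<omega> > 0} \<subseteq> {\<omega> \<in> space M. q 1 1 v \<omega> > 0} \<union> ?D" using that(3) by (auto simp: doubleton_eq_iff)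
      then have "prob {\<omega> \<in> space M. q 1 1 u \<omega> > 0} \<le> prob ({\<omega> \<in> space M. q 1 1 v \<omega> > 0} \<union> ?D)"
        by (rule finite_measure_mono) (use sets D that in auto)
      also have "\<dots> \<le> prob {\<omega> \<in> space M. q 1 1 v \<omega> > 0} + prob ?D" by (rule measure_Un_le) (use sets D that in auto)
      finally show ?thesis .
    qed
    show ?thesis using le[OF assms(1) order_trans[OF assms] refl] le[OF order_trans[OF assms] assms(1) insert_commute]
      by (simp only: p_def abs_le_iff) linarith
  qed
  then show ?thesis using X.change_probability[OF assms] by linarith
qed

lemma mu_p: "\<bar>mu s - shannon_rate B (x * xi N l)\<bar> \<le> params.load_lipschitz * \<bar>p s - x\<bar>" if "0 \<le> x"
proof -
  have "\<bar>mu s - shannon_rate B (x * xi N l)\<bar> \<le> 2 * B / ln 2 * \<bar>p s * xi N l - x * xi N l\<bar>"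
    unfolding mu_eq by (rule shannon_rate_lipschitz[OF Bpos]) (use p_bounds params.xi_nonneg that in auto)
  also have "\<bar>p s * xi N l - x * xi N l\<bar> = xi N l * \<bar>p s - x\<bar>"
    using params.xi_nonneg by (simp add: abs_mult left_diff_distrib[symmetric])
  finally show ?thesis by (simp add: params.load_lipschitz_def)
qed

lemma mu_lipschitz:
  assumes "0 \<le> s" "0 \<le> t"
  shows "\<bar>mu s - mu t\<bar> \<le> Lc * \<bar>s - t\<bar>"
proof -
  have "\<bar>mu s - mu t\<bar> \<le> params.load_lipschitz * \<bar>p s - p t\<bar>" using mu_p[OF p_bounds, of s t] by (simp add: mu_eq)
  also have "\<dots> \<le> params.load_lipschitz * ((lam + B) * \<bar>s - t\<bar>)"
    using p_lipschitz[of s t] p_lipschitz[of t s] assms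
    by (intro mult_left_mono params.load_lipschitz_nonneg) (cases "s \<le> t"; simp add: abs_minus_commute)
  finally show ?thesis by (simp add: Lc_def params.load_lipschitz_def mult.assoc)
qed

lemma lipschitz_queue:
  assumes i: "i \<in> {1..N}"
  shows "lipschitz_queue M (A 1 i) (D 1 i) (q 1 i) lam B mu Lc"
proof -
  interpret queue_equation M "A 1 i" "D 1 i" "q 1 i" lam B mu by (rule queue[OF i])
  show ?thesis
    by unfold_locales (use mu_lipschitz params.xi_nonneg Bpos lampos in \<open>auto simp: Lc_def\<close>)
qed

lemma initial_variance:
  assumes K: "K \<ge> 1" and j: "j \<in> {1..N}" and f: "\<And>x. \<bar>f x\<bar> \<le> (1::real)"
  shows "expectation (\<lambda>\<omega>. ((\<Sum>r\<in>{1..K}. f (q r j 0 \<omega>)) / real K - expectation (\<lambda>\<omega>. f (q 1 1 0 \<omega>)))\<^sup>2) \<le> 1 / real K"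
proof -
  have ind: "indep_vars (\<lambda>_. count_space UNIV) (\<lambda>(r, j). q r j 0) ({1..} \<times> {1..N})"
    and ident: "\<And>x y. x \<in> {1..} \<times> {1..N} \<Longrightarrow> y \<in> {1..} \<times> {1..N} \<Longrightarrow>
      distr M (count_space UNIV) ((\<lambda>(r, j). q r j 0) x) = distr M (count_space UNIV) ((\<lambda>(r, j). q r j 0) y)"
    using iid unfolding iid_with_finite_mean_def by blast+
  have mean: "expectation (\<lambda>\<omega>. f (q r j 0 \<omega>)) = expectation (\<lambda>\<omega>. f (q 1 1 0 \<omega>))" if "r \<ge> 1" for r
  proof -
    have m: "q r j 0 \<in> measurable M (count_space UNIV)" "q 1 1 0 \<in> measurable M (count_space UNIV)"
      using q_meas j one_in that by auto
    have "expectation (\<lambda>\<omega>. f (q r j 0 \<omega>)) = integral\<^sup>L (distr M (count_space UNIV) (q r j 0)) f"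
      using integral_distr[OF m(1), of f] by simp
    also have "distr M (count_space UNIV) (q r j 0) = distr M (count_space UNIV) (q 1 1 0)"
      using ident[of "(r, j)" "(1, 1)"] that j one_in by simp
    also have "integral\<^sup>L \<dots> f = expectation (\<lambda>\<omega>. f (q 1 1 0 \<omega>))" using integral_distr[OF m(2), of f] by simp
    finally show ?thesis .
  qed
  have I: "card ({1..K} \<times> {j}) = K" by simp
  have S: "(\<Sum>z\<in>{1..K} \<times> {j}. f ((case z of (r, j) \<Rightarrow> q r j 0) \<omega>)) = (\<Sum>r\<in>{1..K}. f (q r j 0 \<omega>))" for \<omega>
    by (rule sum.reindex_bij_witness[of _ "\<lambda>r. (r, j)" fst]) auto
  have "expectation (\<lambda>\<omega>. ((\<Sum>z\<in>{1..K} \<times> {j}. f ((case z of (r, j) \<Rightarrow> q r j 0) \<omega>)) / real (card ({1..K} \<times> {j})) -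
      expectation (\<lambda>\<omega>. f (q 1 1 0 \<omega>)))\<^sup>2) \<le> 1 / real (card ({1..K} \<times> {j}))"
  proof (rule iid_empirical_variance)
    show "indep_vars (\<lambda>_. count_space UNIV) (\<lambda>z. case z of (r, j) \<Rightarrow> q r j 0) ({1..K} \<times> {j})"
      by (rule indep_vars_subset[OF ind]) (use j in auto)
  qed (use K f mean in auto)
  then show ?thesis by (simp only: S I)
qed


definition grid_const :: real where
  "grid_const = lipschitz_queue.bad_const lam B Lc"

lemma grid_const_nonneg: "0 \<le> grid_const"
proof -
  interpret lipschitz_queue M "A 1 1" "D 1 1" "q 1 1" lam B mu Lc by (rule lipschitz_queue[OF one_in])
  show ?thesis unfolding grid_const_def by (rule bad_const_nonneg)
qed

abbreviation chain :: "nat \<Rightarrow> real \<Rightarrow> nat \<Rightarrow> 'w \<Rightarrow> nat" where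
  "chain j \<equiv> lipschitz_queue.chain (A 1 j) (D 1 j) (q 1 j) mu"

lemma chain_measurable: "j \<in> {1..N} \<Longrightarrow> h > 0 \<Longrightarrow> chain j h k \<in> measurable M (count_space UNIV)"
  by (rule lipschitz_queue.chain_measurable[OF lipschitz_queue])

text \<open>In total variation the laws of the chain and of the queue on the grid differ by at most twice the probability
  that they ever disagree.\<close>

lemma chain_replacement:
  fixes G :: "nat list \<Rightarrow> real"
  assumes j: "j \<in> {1..N}" and T: "T > 0" and n: "n > 0" and h: "h = T / real n" and G: "\<And>w. \<bar>G w\<bar> \<le> 1"
  shows "\<bar>expectation (\<lambda>\<omega>. G (map (\<lambda>k. chain j h k \<omega>) [0..<Suc n])) -
    expectation (\<lambda>\<omega>. G (map (\<lambda>k. q 1 j (real k * h) \<omega>) [0..<Suc n]))\<bar> \<le> 2 * T * grid_const * h"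
proof -
  have hpos: "h > 0" and nh: "real n * h = T" using T n h by simp_all
  note meas = chain_measurable[OF j hpos] q_meas[OF order_refl j]
  define E where "E = {\<omega> \<in> space M. \<exists>k\<le>n. chain j h k \<omega> \<noteq> q 1 j (real k * h) \<omega>}"
  define f where "f \<omega> = G (map (\<lambda>k. chain j h k \<omega>) [0..<Suc n])" for \<omega>
  define g where "g \<omega> = G (map (\<lambda>k. q 1 j (real k * h) \<omega>) [0..<Suc n])" for \<omega>
  have "E = (\<Union>k\<in>{..n}. \<Union>x. (chain j h k -` {x} \<inter> space M) \<inter> (q 1 j (real k * h) -` (- {x}) \<inter> space M))"
    unfolding E_def by auto
  also have "\<dots> \<in> sets M"
    by (intro sets.finite_UN sets.countable_UN'' sets.Int measurable_sets[OF meas(1)] measurable_sets[OF meas(2)])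
       (use hpos in auto)
  finally have E: "E \<in> sets M" .
  have "prob E \<le> real n * (lipschitz_queue.bad_const lam B Lc * h\<^sup>2)"
    unfolding E_def by (rule lipschitz_queue.chain_deviation[OF lipschitz_queue[OF j] hpos])
  also have "\<dots> = T * grid_const * h"
    unfolding nh[symmetric] grid_const_def by (simp add: power2_eq_square)
  finally have dev: "prob E \<le> T * grid_const * h" .
  have int: "integrable M f" "integrable M g"
    unfolding f_def[abs_def] g_def[abs_def]
    by (rule integrable_discrete[OF measurable_map_list[OF countableI_type meas(1)], of G 1], rule G,
        rule integrable_discrete[OF measurable_map_list[OF countableI_type meas(2)], of "Suc n" "\<lambda>k. real k * h" G 1])
       (use hpos G in auto)
  have "\<bar>expectation f - expectation g\<bar> = \<bar>expectation (\<lambda>\<omega>. f \<omega> - g \<omega>)\<bar>"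
    by (simp only: Bochner_Integration.integral_diff[OF int])
  also have "\<dots> \<le> expectation (\<lambda>\<omega>. \<bar>f \<omega> - g \<omega>\<bar>)" by (rule integral_abs_bound)
  also have "\<dots> \<le> expectation (\<lambda>\<omega>. 2 * indicator E \<omega>)"
  proof (rule integral_mono)
    show "integrable M (\<lambda>\<omega>. 2 * indicat_real E \<omega>)"
      by (intro integrable_mult_right integrable_real_indicator[OF E]) (simp add: emeasure_eq_measure)
    show "\<bar>f \<omega> - g \<omega>\<bar> \<le> 2 * indicat_real E \<omega>" if "\<omega> \<in> space M" for \<omega>
    proof (cases "\<omega> \<in> E")
      case True
      have "\<bar>f \<omega>\<bar> \<le> 1" "\<bar>g \<omega>\<bar> \<le> 1" unfolding f_def g_def by (rule G)+
      then show ?thesis using True by simp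
    next
      case False
      then have "map (\<lambda>k. chain j h k \<omega>) [0..<Suc n] = map (\<lambda>k. q 1 j (real k * h) \<omega>) [0..<Suc n]"
        using that unfolding E_def by (intro map_cong refl) (auto simp: less_Suc_eq_le simp del: upt_Suc)
      then have "f \<omega> = g \<omega>" unfolding f_def g_def by (rule arg_cong)
      then show ?thesis by simp
    qed
  qed (use int in auto)
  also have "\<dots> = 2 * prob E" using E by simp
  finally show ?thesis using dev unfolding f_def[abs_def] g_def[abs_def] by linarith
qed

definition chain_mean :: "real \<Rightarrow> nat \<Rightarrow> (nat \<Rightarrow> real) \<Rightarrow> real" where
  "chain_mean h k f = expectation (\<lambda>\<omega>. f (chain 1 h k \<omega>))"
definition step_const :: real where "step_const = 3 * (lam + B)\<^sup>2"
definition rate_const :: "real \<Rightarrow> real" where "rate_const T = params.load_lipschitz * (2 * T * grid_const)"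

text \<open>The chain for position \<open>1\<close> provides the mean-field expectations, as the busy probability in the rate is that of
  position \<open>1\<close>.\<close>

lemma comparison:
  assumes K: "K \<ge> 1" and system: "replica_system M N B lam l K Q"
    and start: "\<And>r j. r \<in> {1..K} \<Longrightarrow> j \<in> {1..N} \<Longrightarrow> AE \<omega> in M. Q 0 \<omega> (r, j) = q r j 0 \<omega>"
    and T: "T > 0" and n: "n > 0" and h: "h = T / real n" "h \<le> 1" "(lam + B) * h \<le> 1"
  shows "mean_field_comparison M N K B lam l Q h step_const (rate_const T) n (chain_mean h) (\<lambda>k. mu (real k * h))"
proof -
  interpret R: replica_chain M N K B lam l Q
    by unfold_locales (use N2 K Bpos lampos loss system in auto)
  have hpos: "h > 0" using T n h by simp
  have chain_int: "integrable M (\<lambda>\<omega>. f (chain 1 h k \<omega>))" if "\<And>x. \<bar>f x\<bar> \<le> 1" for f :: "nat \<Rightarrow> real" and k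
    by (rule integrable_discrete[OF chain_measurable[OF one_in hpos]]) (rule that)
  have busy: "chain_mean h k R.busy \<ge> 0" for k
    unfolding chain_mean_def R.busy_def by (rule integral_nonneg_AE) simp
  show ?thesis
  proof unfold_locales
    show "0 < h" "h \<le> 1" "(lam + B) * h \<le> 1" by fact+
    show "\<bar>chain_mean h k f\<bar> \<le> 1" if "\<And>x. \<bar>f x\<bar> \<le> 1" for k f
      using expectation_diff_le[OF chain_int[of f k, OF that], of "\<lambda>_. 0" 1] that unfolding chain_mean_def by simp
    show "0 \<le> chain_mean h k R.busy" for k by (rule busy)
    show "0 < mu (real k * h)" "mu (real k * h) \<le> B" for k using mu_bounds by simp_all
    show "0 \<le> step_const" "0 \<le> rate_const T"
      unfolding step_const_def rate_const_def using params.load_lipschitz_nonneg T grid_const_nonneg by simp_all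
    show "\<bar>chain_mean h (Suc k) f - chain_mean h k (birth_death_step (lam * h) (mu (real k * h) * h) f)\<bar> \<le> step_const * h\<^sup>2"
      if "\<And>x. \<bar>f x\<bar> \<le> 1" for k f
      using lipschitz_queue.chain_step[OF lipschitz_queue[OF one_in] hpos, of "\<lambda>w. f (last w)" k] that
      by (simp add: chain_mean_def step_const_def power_mult_distrib)
    show "\<bar>mu (real k * h) - shannon_rate B (chain_mean h k R.busy * xi N l)\<bar> \<le> rate_const T * h" if k: "k \<le> n" for k
    proof -
      \<comment> \<open>The busy indicator at step \<open>k\<close> as a bounded function of the whole list.\<close>
      define G where "G w = (if k < length w then R.busy (w ! k) else 0)" for w
      have G: "\<bar>G w\<bar> \<le> 1" for w by (simp add: G_def R.busy_def)
      have "chain_mean h k R.busy = expectation (\<lambda>\<omega>. G (map (\<lambda>k. chain 1 h k \<omega>) [0..<Suc n]))"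
        using k by (simp add: chain_mean_def G_def less_Suc_eq_le del: upt_Suc)
      moreover have "p (real k * h) = expectation (\<lambda>\<omega>. G (map (\<lambda>k. q 1 1 (real k * h) \<omega>) [0..<Suc n]))"
        using k hpos by (simp add: p_expectation G_def R.busy_def less_Suc_eq_le del: upt_Suc)
      ultimately have "\<bar>p (real k * h) - chain_mean h k R.busy\<bar> \<le> 2 * T * grid_const * h"
        using chain_replacement[where G = G, OF one_in T n h(1) G] by (simp only: abs_minus_commute)
      then have "params.load_lipschitz * \<bar>p (real k * h) - chain_mean h k R.busy\<bar> \<le>
          params.load_lipschitz * (2 * T * grid_const * h)"
        by (rule mult_left_mono) (rule params.load_lipschitz_nonneg)
      with mu_p[OF busy, of "real k * h" k] show ?thesis
        unfolding rate_const_def mult.assoc by (rule order_trans)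
    qed
    show "expectation (\<lambda>\<omega>. (R.replica_mean f j (Q 0 \<omega>) - chain_mean h 0 f)\<^sup>2) \<le> 1 / real K" if j: "j \<in> {1..N}"
        and f: "\<And>x. \<bar>f x\<bar> \<le> 1" for j f
    proof -
      have e0: "chain_mean h 0 f = expectation (\<lambda>\<omega>. f (q 1 1 0 \<omega>))"
        unfolding chain_mean_def lipschitz_queue.chain_0[OF lipschitz_queue[OF one_in]] ..
      have "AE \<omega> in M. \<forall>r\<in>{1..K}. Q 0 \<omega> (r, j) = q r j 0 \<omega>" by (rule AE_finite_allI) (use start j in auto)
      then have ae: "AE \<omega> in M. (R.replica_mean f j (Q 0 \<omega>) - chain_mean h 0 f)\<^sup>2 =
          ((\<Sum>r\<in>{1..K}. f (q r j 0 \<omega>)) / real K - expectation (\<lambda>\<omega>. f (q 1 1 0 \<omega>)))\<^sup>2"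
        by eventually_elim (simp add: R.replica_mean_def e0)
      have "expectation (\<lambda>\<omega>. (R.replica_mean f j (Q 0 \<omega>) - chain_mean h 0 f)\<^sup>2) =
          expectation (\<lambda>\<omega>. ((\<Sum>r\<in>{1..K}. f (q r j 0 \<omega>)) / real K - expectation (\<lambda>\<omega>. f (q 1 1 0 \<omega>)))\<^sup>2)"
      proof (rule integral_cong_AE[OF _ _ ae])
        show "(\<lambda>\<omega>. (R.replica_mean f j (Q 0 \<omega>) - chain_mean h 0 f)\<^sup>2) \<in> borel_measurable M"
          by (rule measurable_compose[OF R.Q_meas[OF order_refl], of "\<lambda>x. (R.replica_mean f j x - chain_mean h 0 f)\<^sup>2"]) simp
        have [measurable]: "(\<lambda>\<omega>. f (q r j 0 \<omega>)) \<in> borel_measurable M" if "r \<in> {1..K}" for r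
          by (rule measurable_compose[OF q_meas]) (use that j in auto)
        show "(\<lambda>\<omega>. ((\<Sum>r\<in>{1..K}. f (q r j 0 \<omega>)) / real K - expectation (\<lambda>\<omega>. f (q 1 1 0 \<omega>)))\<^sup>2) \<in> borel_measurable M"
          by measurable
      qed
      also have "\<dots> \<le> 1 / real K" by (rule initial_variance[OF K j f])
      finally show ?thesis .
    qed
  qed
qed

definition variance_error :: "nat \<Rightarrow> real \<Rightarrow> real \<Rightarrow> real" where
  "variance_error K T h = exp ((1 + 32 * params.load_lipschitz\<^sup>2 * (real N)\<^sup>2) * T) * (1 / real K + T * (4 * (lam +
      B) / real K +
     (4 * (2 * (real K * real N * (lam + B)))\<^sup>2 + 32 * (rate_const T)\<^sup>2 + 4 * step_const\<^sup>2) * h))"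

text \<open>The parameter \<open>\<eta>\<close> is that of \<open>rate_deviation\<close>. As \<open>h\<close> tends to \<open>0\<close> only \<open>\<eta>\<close> itself and a term of order \<open>1 / (K \<eta>)\<close>
  remain.\<close>

definition law_error :: "nat \<Rightarrow> real \<Rightarrow> real \<Rightarrow> real \<Rightarrow> real" where
  "law_error K T \<eta> h =
     2 * T * (\<eta> + (2 * params.load_lipschitz\<^sup>2 * (real N)\<^sup>2 * variance_error K T h + 2 * (rate_const T)\<^sup>2 * h\<^sup>2) / \<eta>) +
     T * ((2 * (real K * real N * (lam + B)))\<^sup>2 + step_const) * h + 2 * T * grid_const * h"

lemma grid_law_distance:
  fixes F :: "nat list \<Rightarrow> real" and h \<eta> T :: real
  assumes K: "K \<ge> 1" and system: "replica_system M N B lam l K Q"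
    and start: "\<And>r j. r \<in> {1..K} \<Longrightarrow> j \<in> {1..N} \<Longrightarrow> AE \<omega> in M. Q 0 \<omega> (r, j) = q r j 0 \<omega>"
    and i: "i \<in> {1..N}" and T: "T > 0" and n: "n > 0" and h: "h = T / real n" "h \<le> 1" "(lam + B) * h \<le> 1"
    and \<eta>: "\<eta> > 0" and F: "\<And>w. \<bar>F w\<bar> \<le> 1"
  shows "\<bar>expectation (\<lambda>\<omega>. F (grid_values h n (\<lambda>t. Q t \<omega> (1, i)))) -
    expectation (\<lambda>\<omega>. F (grid_values h n (\<lambda>t. q 1 i t \<omega>)))\<bar> \<le> law_error K T \<eta> h"
proof -
  interpret C: mean_field_comparison M N K B lam l Q h step_const "rate_const T" n "chain_mean h" "\<lambda>k. mu (real k * h)"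
    by (rule comparison[OF K system start T n h])
  have hpos: "h > 0" and nh: "real n * h = T" using T n h by simp_all
  have total: "C.total_rate = 2 * (real K * real N * (lam + B))" by (simp add: C.total_rate_def)
  have variance: "C.variance_bound n \<le> variance_error K T h"
  proof -
    have "(1 + C.growth * h) ^ n \<le> exp (C.growth * h) ^ n"
      using C.bounds_nonneg hpos by (intro power_mono) (auto simp: exp_ge_add_one_self)
    also have "\<dots> = exp (C.growth * T)" by (simp add: exp_of_nat_mult[symmetric] nh[symmetric] mult.left_commute)
    also have "\<dots> = exp ((1 + 32 * params.load_lipschitz\<^sup>2 * (real N)\<^sup>2) * T)" by (simp add: C.growth_def)
    finally have 1: "(1 + C.growth * h) ^ n \<le> exp ((1 + 32 * params.load_lipschitz\<^sup>2 * (real N)\<^sup>2) * T)" .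
    have "real n * C.increment_bound = (real n * h) * (4 * (lam + B) / real K + C.remainder_const * h)"
      by (simp add: C.increment_bound_def power2_eq_square algebra_simps)
    then have 2: "real n * C.increment_bound = T * (4 * (lam + B) / real K + C.remainder_const * h)" by (simp only: nh)
    have "0 \<le> 1 / real K + real n * C.increment_bound" using C.bounds_nonneg by simp
    with 1 have "C.variance_bound n \<le> exp ((1 + 32 * params.load_lipschitz\<^sup>2 * (real N)\<^sup>2) * T) * (1 / real K +
        real n * C.increment_bound)"
      unfolding C.variance_bound_def by (rule mult_right_mono)
    then show ?thesis unfolding variance_error_def 2 C.remainder_const_def total .
  qed
  define \<epsilon> where "\<epsilon> = \<eta> + (2 * params.load_lipschitz\<^sup>2 * (real N)\<^sup>2 * variance_error K T h + 2 * (rate_const T)\<^sup>2 * h\<^sup>2) / \<eta>"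
  have eps: "expectation (\<lambda>\<omega>. \<bar>C.rate i (Q (real k * h) \<omega>) - mu (real k * h)\<bar>) \<le> \<epsilon>" if "k < n" for k
  proof -
    have "expectation (\<lambda>\<omega>. \<bar>C.rate i (Q (real k * h) \<omega>) - mu (real k * h)\<bar>) \<le>
        \<eta> + (2 * params.load_lipschitz\<^sup>2 * (real N)\<^sup>2 * C.variance_bound n + 2 * (rate_const T)\<^sup>2 * h\<^sup>2) / \<eta>"
      by (rule C.rate_deviation) (use that i \<eta> in auto)
    also have "\<dots> \<le> \<epsilon>" unfolding \<epsilon>_def
      using variance \<eta> by (intro add_left_mono divide_right_mono add_right_mono mult_left_mono) auto
    finally show ?thesis .
  qed
  have 1: "\<bar>expectation (\<lambda>\<omega>. F (map (\<lambda>j. Q (real j * h) \<omega> (1, i)) [0..<Suc n])) -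
      expectation (\<lambda>\<omega>. F (map (\<lambda>j. chain i h j \<omega>) [0..<Suc n]))\<bar> \<le>
      real n * (2 * h * \<epsilon> + (C.total_rate\<^sup>2 + step_const) * h\<^sup>2)"
  proof (rule C.path_comparison[where Z = "chain i h" and r = 1 and i = i and \<epsilon> = \<epsilon> and F = F and k = n])
    show "\<bar>expectation (\<lambda>\<omega>. H (map (\<lambda>j. chain i h j \<omega>) [0..<Suc (Suc k)])) - expectation (\<lambda>\<omega>.
        birth_death_step (lam * h) (mu (real k * h) * h) (\<lambda>x. H (map (\<lambda>j. chain i h j \<omega>) [0..<Suc k] @ [x])) (chain i h k \<omega>))\<bar>
        \<le> step_const * h\<^sup>2" if "\<And>w. \<bar>H w\<bar> \<le> 1" for k H
      using lipschitz_queue.chain_step[OF lipschitz_queue[OF i], of h H k, OF hpos that]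
      unfolding step_const_def power_mult_distrib mult.assoc .
    show "chain i h k \<in> measurable M (count_space UNIV)" for k by (rule chain_measurable[OF i hpos])
    show "1 \<in> {1..K}" using K by simp
    show "i \<in> {1..N}" by (rule i)
    show "AE \<omega> in M. Q 0 \<omega> (1, i) = chain i h 0 \<omega>"
      unfolding lipschitz_queue.chain_0[OF lipschitz_queue[OF i]] using start[of 1 i] K i by simp
    show "expectation (\<lambda>\<omega>. \<bar>C.rate i (Q (real k * h) \<omega>) - mu (real k * h)\<bar>) \<le> \<epsilon>" if "k < n" for k by (rule eps[OF that])
    show "\<bar>F w\<bar> \<le> 1" for w by (rule F)
  qed simp
  have 2: "\<bar>expectation (\<lambda>\<omega>. F (map (\<lambda>j. chain i h j \<omega>) [0..<Suc n])) -
      expectation (\<lambda>\<omega>. F (map (\<lambda>j. q 1 i (real j * h) \<omega>) [0..<Suc n]))\<bar> \<le> 2 * T * grid_const * h"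
    by (rule chain_replacement[OF i T n h(1)]) (rule F)
  have "real n * (2 * h * \<epsilon> + (C.total_rate\<^sup>2 + step_const) * h\<^sup>2) =
      2 * (real n * h) * \<epsilon> + (real n * h) * (C.total_rate\<^sup>2 + step_const) * h"
    by (simp add: power2_eq_square algebra_simps)
  then have 3: "real n * (2 * h * \<epsilon> + (C.total_rate\<^sup>2 + step_const) * h\<^sup>2) = 2 * T * \<epsilon> + T * (C.total_rate\<^sup>2 +
      step_const) * h"
    by (simp only: nh)
  have "\<bar>expectation (\<lambda>\<omega>. F (grid_values h n (\<lambda>t. Q t \<omega> (1, i)))) - expectation (\<lambda>\<omega>. F (grid_values h n (\<lambda>t. q 1 i t \<omega>)))\<bar> \<le>
      2 * T * \<epsilon> + T * (C.total_rate\<^sup>2 + step_const) * h + 2 * T * grid_const * h"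
    using 1 2 unfolding 3 grid_values_def by linarith
  then show ?thesis unfolding law_error_def \<epsilon>_def total .
qed

definition gap_const :: "real \<Rightarrow> real" where
  "gap_const T = 2 * T * (1 + 2 * params.load_lipschitz\<^sup>2 * (real N)\<^sup>2 * exp ((1 + 32 * params.load_lipschitz\<^sup>2 * (real N)\<^sup>2)
      * T) * (1 + 4 * T * (lam + B)))"

text \<open>With \<open>K\<close> fixed and \<open>h \<rightarrow> 0\<close> the bound for grid laws becomes \<open>2 T (\<eta> + c / (K \<eta>))\<close>, and \<open>\<eta> = 1 / sqrt K\<close> balances the
  two terms.\<close>

lemma expectation_gap:
  assumes K: "K \<ge> 1" and system: "replica_system M N B lam l K Q"
    and start: "\<And>r j. r \<in> {1..K} \<Longrightarrow> j \<in> {1..N} \<Longrightarrow> AE \<omega> in M. Q 0 \<omega> (r, j) = q r j 0 \<omega>"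
    and i: "i \<in> {1..N}" and T: "T > 0"
    and cont: "continuous_map (skorokhod_topology T) euclideanreal \<phi>"
    and bnd: "\<And>x. x \<in> skorokhod_space T \<Longrightarrow> \<bar>\<phi> x\<bar> \<le> b" and b: "b > 0"
  shows "\<bar>expectation (\<lambda>\<omega>. \<phi> (restrict (\<lambda>t. Q t \<omega> (1, i)) {0..T})) - expectation (\<lambda>\<omega>. \<phi> (restrict (\<lambda>t. q 1 i t \<omega>) {0..T}))\<bar>
    \<le> b * (gap_const T / sqrt (real K))"
proof -
  define h where "h n = T / real (Suc n)" for n
  define \<eta> where "\<eta> = 1 / sqrt (real K)"
  have \<eta>: "\<eta> > 0" using K by (simp add: \<eta>_def)
  define gY where "gY n \<omega> = grid_values (T / real (Suc n)) (Suc n) (\<lambda>t. Q t \<omega> (1, i))" for n \<omega>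
  define gZ where "gZ n \<omega> = grid_values (T / real (Suc n)) (Suc n) (\<lambda>t. q 1 i t \<omega>)" for n \<omega>
  define a where "a n = expectation (\<lambda>\<omega>. \<phi> (step_path T (Suc n) (gY n \<omega>))) - expectation (\<lambda>\<omega>. \<phi> (step_path T (Suc n)
      (gZ n \<omega>)))" for n
  interpret R: replica_chain M N K B lam l Q
    by unfold_locales (use N2 K Bpos lampos loss system in auto)
  have Ym: "(\<lambda>\<omega>. Q t \<omega> (1, i)) \<in> measurable M (count_space UNIV)" if "t \<ge> 0" for t
    by (rule measurable_compose[OF R.Q_meas[OF that], of "\<lambda>q. q (1, i)"]) simp
  have Yc: "cadlag_on {0..} (\<lambda>t. Q t \<omega> (1, i))" if "\<omega> \<in> space M" for \<omega>
    using system that i K unfolding replica_system_def by simp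
  have lim: "a \<longlonglongrightarrow> expectation (\<lambda>\<omega>. \<phi> (restrict (\<lambda>t. Q t \<omega> (1, i)) {0..T})) - expectation (\<lambda>\<omega>. \<phi> (restrict (\<lambda>t. q 1 i t \<omega>)
      {0..T}))"
    unfolding a_def gY_def gZ_def
    by (intro tendsto_diff expectation_step_path_tendsto[where b = b, OF prob_space_axioms T _ _ cont bnd])
       (use Ym Yc q_meas[OF order_refl i] q_cadlag[OF order_refl i] in auto)
  have h0: "h \<longlonglongrightarrow> 0" unfolding h_def by (rule LIMSEQ_Suc[OF lim_const_over_n])
  have "(\<lambda>n. law_error K T \<eta> (h n)) \<longlonglongrightarrow> law_error K T \<eta> 0" unfolding law_error_def variance_error_def
    by (intro tendsto_intros h0) (use \<eta> in simp)
  then have lim2: "(\<lambda>n. b * law_error K T \<eta> (h n)) \<longlonglongrightarrow> b * law_error K T \<eta> 0" by (rule tendsto_mult_left)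
  have ev1: "\<forall>\<^sub>F n in sequentially. h n < 1" by (rule order_tendstoD(2)[OF h0]) simp
  have ev2: "\<forall>\<^sub>F n in sequentially. h n < 1 / (lam + B)" by (rule order_tendstoD(2)[OF h0]) (use lampos Bpos in simp)
  have "\<forall>\<^sub>F n in sequentially. \<bar>a n\<bar> \<le> b * law_error K T \<eta> (h n)"
    using ev1 ev2
  proof eventually_elim
    case (elim n)
    define F where "F w = \<phi> (step_path T (Suc n) w) / b" for w
    have "step_path T (Suc n) w \<in> skorokhod_space T" for w by (rule step_path_in_skorokhod_space[OF T]) simp
    then have F: "\<bar>F w\<bar> \<le> 1" for w using bnd b by (simp add: F_def abs_divide)
    have hB: "(lam + B) * h n \<le> 1" using elim(2) lampos Bpos by (simp add: field_simps)
    have "\<bar>expectation (\<lambda>\<omega>. F (gY n \<omega>)) - expectation (\<lambda>\<omega>. F (gZ n \<omega>))\<bar> \<le> law_error K T \<eta> (h n)"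
      unfolding gY_def gZ_def h_def[symmetric]
      by (rule grid_law_distance[OF K system start i T _ _ _ hB \<eta> F]) (use elim in \<open>auto simp: h_def\<close>)
    moreover have "expectation (\<lambda>\<omega>. F (gY n \<omega>)) - expectation (\<lambda>\<omega>. F (gZ n \<omega>)) = a n / b"
      by (simp add: F_def a_def diff_divide_distrib)
    ultimately have "\<bar>a n\<bar> / b \<le> law_error K T \<eta> (h n)" using b by (simp add: abs_divide)
    then show ?case using b by (simp add: pos_divide_le_eq mult.commute)
  qed
  then have "\<bar>expectation (\<lambda>\<omega>. \<phi> (restrict (\<lambda>t. Q t \<omega> (1, i)) {0..T})) - expectation (\<lambda>\<omega>. \<phi> (restrict (\<lambda>t. q 1 i t \<omega>)
      {0..T}))\<bar> \<le> b * law_error K T \<eta> 0"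
    by (rule tendsto_le[OF sequentially_bot lim2 tendsto_rabs[OF lim]])
  also have "law_error K T \<eta> 0 = gap_const T / sqrt (real K)"
  proof -
    have K0: "real K > 0" using K by simp
    have s: "x / real K / \<eta> = x / sqrt (real K)" for x
      using K0 real_sqrt_mult_self[of "real K"] by (simp add: \<eta>_def field_simps)
    define c where "c = 2 * params.load_lipschitz\<^sup>2 * (real N)\<^sup>2 * exp ((1 + 32 * params.load_lipschitz\<^sup>2 * (real N)\<^sup>2) * T) *
        (1 + 4 * T * (lam + B))"
    have "law_error K T \<eta> 0 = 2 * T * (\<eta> + 2 * params.load_lipschitz\<^sup>2 * (real N)\<^sup>2 * variance_error K T 0 / \<eta>)"
      by (simp add: law_error_def)
    also have "2 * params.load_lipschitz\<^sup>2 * (real N)\<^sup>2 * variance_error K T 0 = c / real K"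
      using K0 by (simp add: variance_error_def c_def field_simps)
    also have "2 * T * (\<eta> + c / real K / \<eta>) = 2 * T * (1 + c) / sqrt (real K)"
      by (subst s) (simp only: \<eta>_def add_divide_distrib[symmetric] times_divide_eq_right)
    finally show ?thesis by (simp only: gap_const_def c_def)
  qed
  finally show ?thesis .
qed

end

theorem theorem3p13:
  fixes M :: "'w measure"
    and N :: nat and B lam T :: real and l :: "real \<Rightarrow> real"
    and A :: "nat \<Rightarrow> nat \<Rightarrow> 'w \<Rightarrow> real measure"
    and D :: "nat \<Rightarrow> nat \<Rightarrow> 'w \<Rightarrow> (real \<times> real) measure"
    and q :: "nat \<Rightarrow> nat \<Rightarrow> real \<Rightarrow> 'w \<Rightarrow> nat"
    and Q :: "nat \<Rightarrow> real \<Rightarrow> 'w \<Rightarrow> nat \<times> nat \<Rightarrow> nat"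
  assumes "prob_space M"
    and "N \<ge> 2" and "B > 0" and "lam > 0" and "T > 0"
    and "path_loss l"
    and "\<And>K. K \<ge> 1 \<Longrightarrow> replica_system M N B lam l K (Q K)"
    and "mf_system M N B lam l A D q"
    and "\<And>K r j. K \<ge> 1 \<Longrightarrow> r \<in> {1..K} \<Longrightarrow> j \<in> {1..N} \<Longrightarrow>
           AE \<omega> in M. Q K 0 \<omega> (r, j) = q r j 0 \<omega>"
    and "iid_with_finite_mean M ({1..} \<times> {1..N}) (\<lambda>(r, j). q r j 0)"
  shows "\<forall>i\<in>{1..N}.
           converges_in_distribution M (skorokhod_topology T)
             (\<lambda>n \<omega>. restrict (\<lambda>t. Q (Suc n) t \<omega> (1, i)) {0..T})
             (\<lambda>\<omega>. restrict (\<lambda>t. q 1 i t \<omega>) {0..T})"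
proof
  fix i assume i: "i \<in> {1..N}"
  interpret prob_space M by fact
  interpret mean_field_system M N B lam l A D q
    by unfold_locales (use assms in auto)
  note T = \<open>T > 0\<close>
  have sys: "replica_system M N B lam l (Suc n) (Q (Suc n))" for n by (rule assms(7)) simp
  have Ym: "(\<lambda>\<omega>. restrict (\<lambda>t. Q (Suc n) t \<omega> (1, i)) {0..T}) \<in> measurable M (borel_of (skorokhod_topology T))" for n
  proof (rule measurable_skorokhod_path[OF T])
    interpret R: replica_chain M N "Suc n" B lam l "Q (Suc n)"
      by unfold_locales (use assms sys in auto)
    show "(\<lambda>\<omega>. Q (Suc n) t \<omega> (1, i)) \<in> measurable M (count_space UNIV)" if "t \<ge> 0" for t
      by (rule measurable_compose[OF R.Q_meas[OF that], of "\<lambda>q. q (1, i)"]) simp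
    show "cadlag_on {0..} (\<lambda>t. Q (Suc n) t \<omega> (1, i))" if "\<omega> \<in> space M" for \<omega>
      using sys[of n] that i unfolding replica_system_def by simp
  qed
  have Zm: "(\<lambda>\<omega>. restrict (\<lambda>t. q 1 i t \<omega>) {0..T}) \<in> measurable M (borel_of (skorokhod_topology T))"
    by (rule measurable_skorokhod_path[OF T q_cadlag[OF order_refl i] q_meas[OF order_refl i]])
  have conv: "(\<lambda>n. \<integral>\<omega>. \<phi> (restrict (\<lambda>t. Q (Suc n) t \<omega> (1, i)) {0..T}) \<partial>M) \<longlonglongrightarrow> (\<integral>\<omega>. \<phi> (restrict (\<lambda>t. q 1 i t \<omega>) {0..T}) \<partial>M)"
    if cont: "continuous_map (skorokhod_topology T) euclideanreal \<phi>" and bdd: "bounded (\<phi> ` topspace (skorokhod_topology T))"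
        for \<phi>
  proof -
    obtain b where b: "b > 0" "\<And>x. x \<in> skorokhod_space T \<Longrightarrow> \<bar>\<phi> x\<bar> \<le> b"
      using bdd unfolding bounded_pos topspace_skorokhod by auto
    have "(\<lambda>n. (\<integral>\<omega>. \<phi> (restrict (\<lambda>t. Q (Suc n) t \<omega> (1, i)) {0..T}) \<partial>M) - (\<integral>\<omega>. \<phi> (restrict (\<lambda>t. q 1 i t \<omega>) {0..T}) \<partial>M)) \<longlonglongrightarrow> 0"
    proof (rule Lim_null_comparison)
      show "\<forall>\<^sub>F n in sequentially. norm ((\<integral>\<omega>. \<phi> (restrict (\<lambda>t. Q (Suc n) t \<omega> (1, i)) {0..T}) \<partial>M) -
          (\<integral>\<omega>. \<phi> (restrict (\<lambda>t. q 1 i t \<omega>) {0..T}) \<partial>M)) \<le> b * (gap_const T / sqrt (real (Suc n)))"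
        unfolding real_norm_def
        by (intro always_eventually allI expectation_gap[OF _ sys assms(9) i T cont b(2,1)]) auto
      have "(\<lambda>n. gap_const T / sqrt (real n)) \<longlonglongrightarrow> 0"
        by (rule tendsto_divide_0[OF tendsto_const])
           (rule filterlim_at_top_imp_at_infinity[OF filterlim_compose[OF sqrt_at_top filterlim_real_sequentially]])
      then have "(\<lambda>n. gap_const T / sqrt (real (Suc n))) \<longlonglongrightarrow> 0" by (rule LIMSEQ_Suc)
      then show "(\<lambda>n. b * (gap_const T / sqrt (real (Suc n)))) \<longlonglongrightarrow> 0" by (rule tendsto_mult_right_zero)
    qed
    then show ?thesis by (rule LIM_zero_cancel)
  qed
  show "converges_in_distribution M (skorokhod_topology T)
             (\<lambda>n \<omega>. restrict (\<lambda>t. Q (Suc n) t \<omega> (1, i)) {0..T})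
             (\<lambda>\<omega>. restrict (\<lambda>t. q 1 i t \<omega>) {0..T})"
    unfolding converges_in_distribution_def using Ym Zm conv by blast
qed

end
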